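(* Let $(A,\omega_A)$ be a weak pair. The collection of isomorphism classes of abelian varieties $B$ for which there exists $\omega_B\in NS_B(\mathbb C)^0$ such that the weak pairs $(A,\omega_A)$ and $(B,\omega_B)$ are mirror symmetric is finite.
   Context: A complex torus is $A=(V/\Gamma,J)$ with $\Gamma=\Gamma_A=H_1(A,\mathbb Z)$ a lattice of rank $2\dim A$, $V=V_A=\Gamma\otimes\mathbb R$, and $J=J_A\in\mathrm{End}(V)$, $J^2=-1$. The dual torus is $\hat A=(V^*/\Gamma^*,\hat J)$, $(\hat Jw)(v)=w(-Jv)$. The Néron–Severi group $NS_A$ is identified (by first Chern class) with the group of integral skew-symmetric forms $c$ on $\Gamma$ with $c_{\mathbb R}$ $J$-invariant, and with a subgroup of $\mathrm{Hom}(A,\hat A)$ via $c\mapsto(v\mapsto c(v,\cdot))$. $NS_A(\mathbb R)=NS_A\otimes\mathbb R$, $NS_A(\mathbb C)=NS_A\otimes\mathbb C$, $NS_A(\mathbb R)^0\subset NS_A(\mathbb R)$ is the set of nondegenerate forms, and $NS_A(\mathbb C)^0=\{\varphi_1+i\varphi_2\in NS_A(\mathbb C):\varphi_1\in NS_A(\mathbb R),\ \varphi_2\in NS_A(\mathbb R)^0\}$. Put $\Lambda_A=\Gamma_A\oplus\Gamma_{\hat A}$ ($\Gamma_{\hat A}=\Gamma_A^*$) with $Q_A((a_1,b_1),(a_2,b_2))=b_1(a_2)+b_2(a_1)$; $J_{A\times\hat A}=(J,\hat J)$ acts on $V_A\oplus V_{\hat A}$. For $\omega=\varphi_1+i\varphi_2\in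 NS_A(\mathbb C)^0$ (with $\varphi_k:V_A\to V_{\hat A}$) put $$I_\omega=\begin{pmatrix}\varphi_2^{-1}\varphi_1&-\varphi_2^{-1}\\ \varphi_2+\varphi_1\varphi_2^{-1}\varphi_1&-\varphi_1\varphi_2^{-1}\end{pmatrix},$$ a complex structure on $V_A\oplus V_{\hat A}$. A weak pair $(A,\omega_A)$ is a complex torus $A$ with $\omega_A\in NS_A(\mathbb C)^0$. Weak pairs $(A,\omega_A)$, $(B,\omega_B)$ are mirror symmetric if there is an isomorphism $\alpha:\Lambda_A\to\Lambda_B$ identifying $Q_A$ with $Q_B$ such that $\alpha_{\mathbb R}J_{A\times\hat A}=I_{\omega_B}\alpha_{\mathbb R}$ and $\alpha_{\mathbb R}I_{\omega_A}=J_{B\times\hat B}\alpha_{\mathbb R}$. *)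

theory Defs
  imports "HOL-Analysis.Analysis" "HOL-Library.Function_Algebras"
begin

instantiation "fun" :: (type, real_vector) real_vector
begin

definition scaleR_fun :: "real \<Rightarrow> ('a \<Rightarrow> 'b) \<Rightarrow> 'a \<Rightarrow> 'b"
  where "scaleR_fun r f = (\<lambda>x. r *\<^sub>R f x)"

instance
  by standard (simp_all add: scaleR_fun_def fun_eq_iff scaleR_add_right scaleR_add_left)

end

lemma scaleR_fun_apply [simp]: "(r *\<^sub>R f) x = r *\<^sub>R f x"
  by (simp add: scaleR_fun_def)


text \<open>
  The spaces \<open>V = \<Gamma> \<otimes> \<real>\<close> are finite-dimensional subspaces of an arbitrary real vector space
  type. Hence a single type can carry tori of every dimension, and the dimension of a torus is not
  fixed by its type.
\<close>

definition linear_on_space :: "'a::real_vector set \<Rightarrow> ('a \<Rightarrow> 'b::real_vector) \<Rightarrow> bool"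
  where "linear_on_space V f \<longleftrightarrow>
    (\<forall>x\<in>V. \<forall>y\<in>V. f (x + y) = f x + f y) \<and> (\<forall>r. \<forall>x\<in>V. f (r *\<^sub>R x) = r *\<^sub>R f x)"

text \<open>
  \<open>Hom(V, W)\<close>. A linear map on \<open>V\<close> is encoded by its extension by zero to the whole type, so
  that distinct functions are distinct maps and the pointwise operations are those of \<open>Hom(V, W)\<close>.
\<close>

definition lin_hom :: "'a::real_vector set \<Rightarrow> 'b::real_vector set \<Rightarrow> ('a \<Rightarrow> 'b) set"
  where "lin_hom V W = {f. linear_on_space V f \<and> f ` V \<subseteq> W \<and> (\<forall>x. x \<notin> V \<longrightarrow> f x = 0)}"

definition dual_space :: "'a::real_vector set \<Rightarrow> ('a \<Rightarrow> real) set"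
  where "dual_space V = lin_hom V UNIV"

definition is_lattice :: "'a::real_vector set \<Rightarrow> bool"
  where "is_lattice \<Gamma> \<longleftrightarrow>
    (\<exists>E. finite E \<and> independent E \<and> \<Gamma> = range (\<lambda>k :: 'a \<Rightarrow> int. \<Sum>e\<in>E. of_int (k e) *\<^sub>R e))"


text \<open>
  A torus is given by its lattice \<open>\<Gamma>\<close> and its complex structure \<open>J\<close>; only the restriction of \<open>J\<close>
  to \<open>V = span \<Gamma>\<close> matters. That the rank of \<open>\<Gamma>\<close> is even follows from \<open>J\<^sup>2 = -1\<close>.
\<close>

record 'a torus =
  lattice :: "'a set"
  cstruct :: "'a \<Rightarrow> 'a"

definition tspace :: "'a::real_vector torus \<Rightarrow> 'a set"
  where "tspace A = span (lattice A)"

definition complex_torus :: "'a::real_vector torus \<Rightarrow> bool"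
  where "complex_torus A \<longleftrightarrow>
    is_lattice (lattice A) \<and>
    linear_on_space (tspace A) (cstruct A) \<and>
    (\<forall>v\<in>tspace A. cstruct A v \<in> tspace A \<and> cstruct A (cstruct A v) = - v)"

definition dual_torus :: "'a::real_vector torus \<Rightarrow> ('a \<Rightarrow> real) torus"
  where "dual_torus A =
    \<lparr> lattice = {w \<in> dual_space (tspace A). \<forall>\<gamma>\<in>lattice A. w \<gamma> \<in> \<int>},
      cstruct = (\<lambda>w v. if v \<in> tspace A then w (- cstruct A v) else 0) \<rparr>"

definition prod_torus :: "'a::real_vector torus \<Rightarrow> 'b::real_vector torus \<Rightarrow> ('a \<times> 'b) torus"
  where "prod_torus A B =
    \<lparr> lattice = lattice A \<times> lattice B,
      cstruct = map_prod (cstruct A) (cstruct B) \<rparr>"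

definition torus_iso :: "'a::real_vector torus \<Rightarrow> 'b::real_vector torus \<Rightarrow> bool"
  where "torus_iso A B \<longleftrightarrow>
    (\<exists>f. linear_on_space (tspace A) f \<and>
         bij_betw f (lattice A) (lattice B) \<and>
         (\<forall>v\<in>tspace A. f (cstruct A v) = cstruct B (f v)))"


text \<open>
  A bilinear form \<open>c\<close> on \<open>V\<close> is an element of \<open>Hom(V, V\<^sup>*)\<close> via \<open>v \<mapsto> c(v, -)\<close>. In curried form
  these are literally the same function, so \<open>c v w\<close> is the value of the form and \<open>c v\<close> is the image
  of \<open>v\<close> under the associated map.
\<close>

definition neron_severi :: "'a::real_vector torus \<Rightarrow> ('a \<Rightarrow> 'a \<Rightarrow> real) set"
  where "neron_severi A =
    {c \<in> lin_hom (tspace A) (dual_space (tspace A)).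
       (\<forall>v\<in>tspace A. \<forall>w\<in>tspace A. c v w = - c w v) \<and>
       (\<forall>v\<in>lattice A. \<forall>w\<in>lattice A. c v w \<in> \<int>) \<and>
       (\<forall>v\<in>tspace A. \<forall>w\<in>tspace A. c (cstruct A v) (cstruct A w) = c v w)}"

text \<open>
  \<open>NS \<otimes> \<real>\<close> is a real span, because integral forms that are independent over \<open>\<int>\<close> are
  independent over \<open>\<real>\<close>.
\<close>

definition neron_severi_real :: "'a::real_vector torus \<Rightarrow> ('a \<Rightarrow> 'a \<Rightarrow> real) set"
  where "neron_severi_real A = span (neron_severi A)"

definition neron_severi_real0 :: "'a::real_vector torus \<Rightarrow> ('a \<Rightarrow> 'a \<Rightarrow> real) set"
  where "neron_severi_real0 A =
    {c \<in> neron_severi_real A. \<forall>v\<in>tspace A. (\<forall>w\<in>tspace A. c v w = 0) \<longrightarrow> v = 0}"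

text \<open>The element \<open>\<phi>\<^sub>1 + i\<phi>\<^sub>2\<close> of \<open>NS \<otimes> \<complex>\<close> is encoded by the pair \<open>(\<phi>\<^sub>1, \<phi>\<^sub>2)\<close>.\<close>

definition neron_severi_complex0 ::
    "'a::real_vector torus \<Rightarrow> (('a \<Rightarrow> 'a \<Rightarrow> real) \<times> ('a \<Rightarrow> 'a \<Rightarrow> real)) set"
  where "neron_severi_complex0 A = neron_severi_real A \<times> neron_severi_real0 A"

text \<open>
  An abelian variety is a complex torus that admits a polarization. The sign convention for
  positivity is immaterial, as \<open>c\<close> may be replaced by \<open>-c\<close>.
\<close>

definition polarization :: "'a::real_vector torus \<Rightarrow> ('a \<Rightarrow> 'a \<Rightarrow> real) \<Rightarrow> bool"
  where "polarization A c \<longleftrightarrow>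
    c \<in> neron_severi A \<and> (\<forall>v\<in>tspace A. v \<noteq> 0 \<longrightarrow> c v (cstruct A v) > 0)"

definition abelian_variety :: "'a::real_vector torus \<Rightarrow> bool"
  where "abelian_variety A \<longleftrightarrow> complex_torus A \<and> (\<exists>c. polarization A c)"

definition abelian_variety_iso :: "('a::real_vector torus \<times> 'a torus) set"
  where "abelian_variety_iso =
    {(A, B). abelian_variety A \<and> abelian_variety B \<and> torus_iso A B}"


definition weak_pair ::
    "'a::real_vector torus \<Rightarrow> ('a \<Rightarrow> 'a \<Rightarrow> real) \<times> ('a \<Rightarrow> 'a \<Rightarrow> real) \<Rightarrow> bool"
  where "weak_pair A \<omega> \<longleftrightarrow> complex_torus A \<and> \<omega> \<in> neron_severi_complex0 A"

definition pairing_form :: "'a \<times> ('a \<Rightarrow> real) \<Rightarrow> 'a \<times> ('a \<Rightarrow> real) \<Rightarrow> real"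
  where "pairing_form x y = snd x (fst y) + snd y (fst x)"

text \<open>
  For nondegenerate \<open>\<phi>\<^sub>2\<close> the map \<open>V \<rightarrow> V\<^sup>*\<close> is bijective, so that \<open>inv_into\<close> on \<open>V\<close> is its inverse.
\<close>

definition I_omega ::
    "'a::real_vector torus \<Rightarrow> ('a \<Rightarrow> 'a \<Rightarrow> real) \<times> ('a \<Rightarrow> 'a \<Rightarrow> real) \<Rightarrow>
      'a \<times> ('a \<Rightarrow> real) \<Rightarrow> 'a \<times> ('a \<Rightarrow> real)"
  where "I_omega A = (\<lambda>(\<phi>1, \<phi>2) (v, w).
    let \<psi> = inv_into (tspace A) \<phi>2 in
      (\<psi> (\<phi>1 v) - \<psi> w,
       \<phi>2 v + \<phi>1 (\<psi> (\<phi>1 v)) - \<phi>1 (\<psi> w)))"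

text \<open>
  The lattice isomorphism is represented by its real-linear extension \<open>\<alpha>\<close>.
\<close>

definition mirror_symmetric ::
    "'a::real_vector torus \<Rightarrow> ('a \<Rightarrow> 'a \<Rightarrow> real) \<times> ('a \<Rightarrow> 'a \<Rightarrow> real) \<Rightarrow>
     'b::real_vector torus \<Rightarrow> ('b \<Rightarrow> 'b \<Rightarrow> real) \<times> ('b \<Rightarrow> 'b \<Rightarrow> real) \<Rightarrow> bool"
  where "mirror_symmetric A \<omega>A B \<omega>B \<longleftrightarrow>
    (let AA = prod_torus A (dual_torus A); BB = prod_torus B (dual_torus B) in
      \<exists>\<alpha>. linear_on_space (tspace AA) \<alpha> \<and>
          bij_betw \<alpha> (lattice AA) (lattice BB) \<and>
          (\<forall>x\<in>lattice AA. \<forall>y\<in>lattice AA. pairing_form (\<alpha> x) (\<alpha> y) = pairing_form x y) \<and>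
          (\<forall>x\<in>tspace AA. \<alpha> (cstruct AA x) = I_omega B \<omega>B (\<alpha> x)) \<and>
          (\<forall>x\<in>tspace AA. \<alpha> (I_omega A \<omega>A x) = cstruct BB (\<alpha> x)))"

end

theory Submission
  imports Defs "HOL-Analysis.Kronecker_Approximation_Theorem"
begin

text \<open>
  If \<open>B\<close> is a mirror partner of \<open>(A, \<omega>\<^sub>A)\<close>, the isomorphism \<open>\<alpha>\<close> identifies the complex torus
  \<open>(\<Lambda>\<^sub>A, I\<^sub>\<omega>)\<close>, which does not depend on \<open>B\<close>, with \<open>B \<times> B^\<close>, where \<open>B^\<close> is the dual torus. So any two
  partners satisfy \<open>B\<^sub>0 \<times> B\<^sub>0^ \<cong> B \<times> B^\<close> (\<open>mirror_partners_iso\<close>), and \<open>B\<close> is a direct factor of a fixed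
  torus. Finiteness is then an instance of the theorem that an abelian variety has only finitely many
  direct factors up to isomorphism. That theorem is usually deduced from the Jordan-Zassenhaus
  theorem for orders in semisimple algebras; the proof below replaces the algebra by geometry of
  numbers.

  Fix one partner \<open>B\<^sub>0\<close>. A polarization is an isogeny \<open>B\<^sub>0 \<rightarrow> B\<^sub>0^\<close>, and composing it with the
  projection of \<open>B\<^sub>0 \<times> B\<^sub>0^ \<cong> B \<times> B^\<close> to \<open>B\<close> shows that a multiple of the lattice of \<open>B\<close>, by a factor
  independent of \<open>B\<close>, lies in the sum of two homomorphic images of the lattice of \<open>B\<^sub>0\<close>
  (\<open>partner_generated\<close>). By Poincare reducibility \<open>B\<^sub>0\<close> is isogenous to a sum of simple tori taken from
  a finite family \<open>\<S>\<close> (\<open>simple_decomposition\<close>). Hence, up to a bounded factor, the lattice of \<open>B\<close> is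
  generated by the images of all homomorphisms \<open>S \<rightarrow> B\<close> with \<open>S \<in> \<S>\<close>.

  For each such \<open>B\<close> choose homomorphisms \<open>x\<^sub>0, x\<^sub>1, \<dots>\<close> from members of \<open>\<S>\<close> as successive minima: \<open>x\<^sub>m\<close> is
  a shortest homomorphism that is injective modulo the images of its predecessors. By simplicity they
  combine to an isogeny onto \<open>B\<close> (\<open>minimal_system_exists\<close>). Every homomorphism \<open>g : T \<rightarrow> B\<close> with
  \<open>T \<in> \<S>\<close> is therefore \<open>\<Sum>x\<^sub>i \<circ> d\<^sub>i\<close> with rational \<open>d\<^sub>i\<close>. Dirichlet's approximation theorem gives a bounded
  multiple \<open>t\<close> and integral \<open>w\<^sub>i\<close> for which all \<open>\<epsilon>\<^sub>i = t d\<^sub>i - w\<^sub>i\<close> are tiny. If some \<open>\<epsilon>\<^sub>i\<close> were nonzero and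
  \<open>m\<close> the last such index, then \<open>t g - \<Sum>x\<^sub>i \<circ> w\<^sub>i = \<Sum>x\<^sub>i \<circ> \<epsilon>\<^sub>i\<close> would be a homomorphism that is
  independent of \<open>x\<^sub>0, \<dots>, x\<^bsub>m-1\<^esub>\<close> and shorter than \<open>x\<^sub>m\<close>, because a nonzero \<open>\<epsilon>\<^sub>m\<close> between simple tori is
  injective. So \<open>t g = \<Sum>x\<^sub>i \<circ> w\<^sub>i\<close> (\<open>small_relation\<close>).

  Consequently the lattice of \<open>B\<close> lies between a product \<open>P\<close> of lattices of members of \<open>\<S>\<close> and \<open>(1/K) P\<close>,
  with \<open>K\<close> and the number of factors bounded independently of \<open>B\<close>. There are finitely many such
  products and finitely many lattices between each of them and its multiple (\<open>finite_iso_classes\<close>).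
\<close>

section \<open>Subgroups and lattices\<close>

definition add_subgroup :: "'a::ab_group_add set \<Rightarrow> bool"
  where "add_subgroup G \<longleftrightarrow> 0 \<in> G \<and> (\<forall>x\<in>G. \<forall>y\<in>G. x - y \<in> G)"

text \<open>
  The subgroup generated by a set. Minimality among the subgroups that contain the set is the only
  property needed to compare such subgroups, and generation by differences alone keeps it a one-line
  induction.
\<close>

inductive_set zgen :: "'a::ab_group_add set \<Rightarrow> 'a set" for X
  where
    zero: "0 \<in> zgen X"
  | base: "x \<in> X \<Longrightarrow> x \<in> zgen X"
  | diff: "a \<in> zgen X \<Longrightarrow> b \<in> zgen X \<Longrightarrow> a - b \<in> zgen X"

lemma add_subgroup_zgen [simp]: "add_subgroup (zgen X)"
  by (auto simp: add_subgroup_def intro: zgen.intros)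

lemma zgen_minimal: "X \<subseteq> G \<Longrightarrow> add_subgroup G \<Longrightarrow> zgen X \<subseteq> G"
proof
  fix v assume "v \<in> zgen X" and "X \<subseteq> G" "add_subgroup G"
  then show "v \<in> G" by induction (auto simp: add_subgroup_def)
qed

lemma add_subgroup_zero: "add_subgroup G \<Longrightarrow> 0 \<in> G"
  and add_subgroup_diff: "add_subgroup G \<Longrightarrow> x \<in> G \<Longrightarrow> y \<in> G \<Longrightarrow> x - y \<in> G"
  by (auto simp: add_subgroup_def)

lemma add_subgroup_neg: "add_subgroup G \<Longrightarrow> x \<in> G \<Longrightarrow> - x \<in> G"
  using add_subgroup_diff[of G 0 x] add_subgroup_zero[of G] by simp

lemma add_subgroup_add: "add_subgroup G \<Longrightarrow> x \<in> G \<Longrightarrow> y \<in> G \<Longrightarrow> x + y \<in> G"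
  using add_subgroup_diff[of G x "- y"] add_subgroup_neg[of G y] by simp

lemma add_subgroup_sum:
  "add_subgroup G \<Longrightarrow> (\<And>i. i \<in> I \<Longrightarrow> f i \<in> G) \<Longrightarrow> sum f I \<in> G"
  by (induction I rule: infinite_finite_induct)
     (auto intro: add_subgroup_zero add_subgroup_add)

lemma add_subgroup_scale:
  fixes x :: "'a::real_vector"
  assumes "add_subgroup G" "x \<in> G"
  shows "of_int n *\<^sub>R x \<in> G"
proof (induction n rule: int_induct[where k=0])
  case base then show ?case using assms by (simp add: add_subgroup_zero)
next
  case (step1 i) then show ?case
    using add_subgroup_add[OF assms(1) step1(2) assms(2)] by (simp add: algebra_simps)
next
  case (step2 i) then show ?case
    using add_subgroup_diff[OF assms(1) step2(2) assms(2)] by (simp add: algebra_simps)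
qed

lemma add_subgroup_subspace: "subspace V \<Longrightarrow> add_subgroup V"
  by (simp add: add_subgroup_def subspace_0 subspace_diff)

lemma zgen_subset_span: "zgen X \<subseteq> span X"
  by (simp add: zgen_minimal add_subgroup_subspace span_superset)

lemma zgen_finite:
  fixes E :: "'a::real_vector set"
  assumes "finite E"
  shows "zgen E = range (\<lambda>k. \<Sum>e\<in>E. of_int (k e) *\<^sub>R e)" (is "_ = ?R")
proof
  have "0 \<in> ?R" by (rule range_eqI[of _ _ "\<lambda>_. 0"]) simp
  moreover have "x - y \<in> ?R" if "x \<in> ?R" "y \<in> ?R" for x y
  proof -
    obtain k l where "x = (\<Sum>e\<in>E. of_int (k e) *\<^sub>R e)" "y = (\<Sum>e\<in>E. of_int (l e) *\<^sub>R e)"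
      using \<open>x \<in> ?R\<close> \<open>y \<in> ?R\<close> by auto
    then show ?thesis
      by (intro range_eqI[of _ _ "\<lambda>e. k e - l e"])
         (simp add: sum_subtractf scaleR_left_diff_distrib)
  qed
  moreover have "E \<subseteq> ?R"
  proof
    fix e assume "e \<in> E"
    have "(\<Sum>e'\<in>E. of_int (if e' = e then 1 else 0) *\<^sub>R e') = (\<Sum>e'\<in>E. if e' = e then e' else 0)"
      by (intro sum.cong) auto
    then have "e = (\<Sum>e'\<in>E. of_int (if e' = e then 1 else 0) *\<^sub>R e')"
      using \<open>e \<in> E\<close> assms by simp
    then show "e \<in> ?R" by (rule range_eqI[of _ _ "\<lambda>e'. if e' = e then 1 else 0"])
  qed
  ultimately show "zgen E \<subseteq> ?R" by (intro zgen_minimal) (auto simp: add_subgroup_def)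
  show "?R \<subseteq> zgen E"
    by (intro image_subsetI add_subgroup_sum[OF add_subgroup_zgen] add_subgroup_scale zgen.base)
       simp_all
qed

lemma is_lattice_iff: "is_lattice \<Gamma> \<longleftrightarrow> (\<exists>E. finite E \<and> independent E \<and> \<Gamma> = zgen E)"
  unfolding is_lattice_def by (intro ex_cong conj_cong refl) (simp add: zgen_finite)

lemma is_lattice_zgen: "finite E \<Longrightarrow> independent E \<Longrightarrow> is_lattice (zgen E)"
  by (auto simp: is_lattice_iff)

lemma lattice_basis:
  assumes "is_lattice \<Gamma>"
  obtains E where "finite E" "independent E" "\<Gamma> = zgen E"
  using assms by (auto simp: is_lattice_iff)

lemma lattice_add_subgroup: "is_lattice \<Gamma> \<Longrightarrow> add_subgroup \<Gamma>"
  by (auto simp: is_lattice_iff)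

lemma span_zgen [simp]: "span (zgen X) = span X"
  by (metis span_eq zgen_subset_span span_superset subsetI zgen.base subset_trans)

lemma representation_zgen:
  assumes "finite E" "independent E"
  shows "v \<in> zgen E \<longleftrightarrow> v \<in> span E \<and> (\<forall>e\<in>E. representation E v e \<in> \<int>)"
proof (intro iffI conjI ballI)
  show "v \<in> zgen E \<Longrightarrow> v \<in> span E" using zgen_subset_span by blast
  let ?G = "{v \<in> span E. \<forall>e\<in>E. representation E v e \<in> \<int>}"
  have "add_subgroup ?G"
    using assms by (auto simp: add_subgroup_def span_zero span_diff representation_zero
        representation_diff)
  moreover have "E \<subseteq> ?G" using assms by (auto simp: span_base representation_basis)
  ultimately have "zgen E \<subseteq> ?G" by (intro zgen_minimal) auto
  then show "v \<in> zgen E \<Longrightarrow> e \<in> E \<Longrightarrow> representation E v e \<in> \<int>" for e by blast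
next
  assume *: "v \<in> span E \<and> (\<forall>e\<in>E. representation E v e \<in> \<int>)"
  then have "v = (\<Sum>e\<in>E. representation E v e *\<^sub>R e)"
    using sum_representation_eq assms by (metis order_refl)
  also have "\<dots> = (\<Sum>e\<in>E. of_int \<lfloor>representation E v e\<rfloor> *\<^sub>R e)"
    using * by (intro sum.cong refl) (simp add: of_int_floor)
  also have "\<dots> \<in> zgen E" by (intro add_subgroup_sum add_subgroup_scale zgen.base) auto
  finally show "v \<in> zgen E" .
qed

text \<open>
  Extending to a map that is linear on the whole type gives access to the general theory of linear
  maps.
\<close>

lemma linear_on_space_extend:
  assumes "subspace V" "linear_on_space V f"
  obtains g where "linear g" "\<And>v. v \<in> V \<Longrightarrow> g v = f v"
proof -
  obtain B where B: "B \<subseteq> V" "independent B" "V \<subseteq> span B"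
    using maximal_independent_subset by blast
  obtain g where g: "linear g" "\<forall>b\<in>B. g b = f b"
    using linear_independent_extend[OF B(2)] by blast
  have sub: "span B \<subseteq> V" using B(1) assms(1) by (simp add: span_minimal)
  have "v \<in> V \<and> g v = f v" if "v \<in> span B" for v
    using that
  proof (induction v rule: span_induct_alt)
    case base
    have "f 0 = 0" using assms unfolding linear_on_space_def
      by (metis subspace_0 scaleR_zero_left)
    then show ?case using assms(1) g(1) by (simp add: subspace_0 linear_0)
  next
    case (step c x y)
    then show ?case
      using assms g B(1) unfolding linear_on_space_def
      by (auto simp: linear_add linear_scale subspace_add subspace_scale subset_iff)
  qed
  then show ?thesis using that g(1) B(3) by blast
qed

section \<open>Integral norms and rationality\<close>

text \<open>
  A norm on the real span that takes integral values on the lattice. Discreteness enters the proof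
  only through the consequence that a lattice vector of norm less than \<open>1\<close> is zero, and through the
  existence of shortest vectors.
\<close>

definition integral_norm :: "'a::real_vector set \<Rightarrow> ('a \<Rightarrow> real) \<Rightarrow> bool"
  where "integral_norm \<Gamma> nm \<longleftrightarrow>
    (\<forall>v\<in>span \<Gamma>. \<forall>w\<in>span \<Gamma>. nm (v + w) \<le> nm v + nm w) \<and>
    (\<forall>r. \<forall>v\<in>span \<Gamma>. nm (r *\<^sub>R v) = \<bar>r\<bar> * nm v) \<and>
    (\<forall>v\<in>span \<Gamma>. 0 \<le> nm v \<and> (nm v = 0 \<longrightarrow> v = 0)) \<and>
    (\<forall>v\<in>\<Gamma>. nm v \<in> \<int>)"

lemma lattice_integral_norm:
  assumes "is_lattice \<Gamma>"
  obtains nm where "integral_norm \<Gamma> nm"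
proof -
  obtain E where E: "finite E" "independent E" "\<Gamma> = zgen E"
    using lattice_basis[OF assms] .
  define nm where "nm v = (\<Sum>e\<in>E. \<bar>representation E v e\<bar>)" for v
  have "v = 0" if "v \<in> span E" "nm v = 0" for v
  proof -
    have "\<forall>e\<in>E. representation E v e = 0"
      using that(2) E(1) by (simp add: nm_def sum_nonneg_eq_0_iff)
    then show ?thesis
      using sum_representation_eq[OF E(2) that(1) E(1) order_refl] by simp
  qed
  moreover have "nm (v + w) \<le> nm v + nm w" if "v \<in> span E" "w \<in> span E" for v w
    unfolding nm_def sum.distrib[symmetric] using that E(2)
    by (intro sum_mono) (simp add: representation_add)
  moreover have "nm (r *\<^sub>R v) = \<bar>r\<bar> * nm v" if "v \<in> span E" for r v
    using that E(2) by (simp add: nm_def representation_scale abs_mult sum_distrib_left)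
  moreover have "nm v \<in> \<int>" if "v \<in> \<Gamma>" for v
    using that representation_zgen[OF E(1,2)] unfolding nm_def E(3) by (auto intro!: Ints_sum Ints_abs)
  ultimately have "integral_norm \<Gamma> nm"
    by (auto simp: integral_norm_def E(3) nm_def intro!: sum_nonneg)
  then show ?thesis by (rule that)
qed

lemma integral_norm_sum:
  assumes "integral_norm \<Gamma> nm" "finite I" "\<And>i. i \<in> I \<Longrightarrow> f i \<in> span \<Gamma>"
  shows "nm (\<Sum>i\<in>I. f i) \<le> (\<Sum>i\<in>I. nm (f i))"
  using assms(2,3)
proof (induction I rule: finite_induct)
  case empty
  have "nm (0 *\<^sub>R 0) = \<bar>0\<bar> * nm 0" using assms(1) unfolding integral_norm_def by (metis span_zero)
  then show ?case by simp
next
  case (insert i I)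
  then have "nm (f i + sum f I) \<le> nm (f i) + nm (sum f I)"
    using assms(1) by (auto simp: integral_norm_def span_sum)
  then show ?case using insert by simp
qed

lemma Dirichlet_approx_finite:
  fixes \<theta> :: "'i \<Rightarrow> real"
  assumes "finite I" "N > (0::nat)"
  obtains q p where "0 < q" "q \<le> int (N ^ card I)"
    "\<And>i. i \<in> I \<Longrightarrow> \<bar>of_int q * \<theta> i - of_int (p i)\<bar> < 1 / N"
proof -
  obtain h where h: "bij_betw h {0..<card I} I"
    using ex_bij_betw_nat_finite[OF assms(1)] by blast
  obtain q p where qp: "0 < q" "q \<le> int (N ^ card I)"
    "\<And>i. i < card I \<Longrightarrow> \<bar>of_int q * \<theta> (h i) - of_int (p i)\<bar> < 1 / N"
    using Dirichlet_approx_simult[OF assms(2), of "card I" "\<lambda>i. \<theta> (h i)"] by metis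
  show ?thesis
  proof
    fix i assume i: "i \<in> I"
    define j where "j = inv_into {0..<card I} h i"
    have "h j = i" "j < card I"
      using i h unfolding j_def bij_betw_def by (auto simp: f_inv_into_f) (metis atLeastLessThan_iff inv_into_into)
    then show "\<bar>of_int q * \<theta> i - of_int (p (inv_into {0..<card I} h i))\<bar> < 1 / N"
      using qp(3)[of j] unfolding j_def by simp
  qed (use qp in auto)
qed

text \<open>
  A real linear relation between lattice vectors is a rational one. If \<open>v = \<Sum>r\<^sub>a a\<close>, simultaneous
  approximation of the coefficients gives \<open>q > 0\<close> and integers \<open>p\<^sub>a\<close> such that the lattice vector
  \<open>q v - \<Sum>p\<^sub>a a\<close> has norm less than \<open>1\<close>, hence vanishes.
\<close>

lemma clear_denominator:
  assumes lat: "is_lattice \<Gamma>" and X: "X \<subseteq> \<Gamma>" and v: "v \<in> \<Gamma>" "v \<in> span X"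
  obtains k where "(k::int) > 0" "of_int k *\<^sub>R v \<in> zgen X"
proof -
  obtain t r where t: "finite t" "t \<subseteq> X" "v = (\<Sum>a\<in>t. r a *\<^sub>R a)"
    using v(2) unfolding span_explicit by blast
  obtain nm where nm: "integral_norm \<Gamma> nm" using lattice_integral_norm[OF lat] .
  define M where "M = (\<Sum>a\<in>t. nm a)"
  have tG: "a \<in> span \<Gamma>" if "a \<in> t" for a using t(2) X that by (auto intro: span_base)
  have nn: "0 \<le> nm a" if "a \<in> span \<Gamma>" for a using nm that by (auto simp: integral_norm_def)
  obtain N :: nat where N: "N > 0" "M < N"
    using reals_Archimedean2[of "max M 1"] by (metis gr0I le_less_trans max_less_iff_conj not_one_le_zero of_nat_0 less_irrefl zero_less_one order_less_trans)
  obtain q p where qp: "0 < q" "\<And>a. a \<in> t \<Longrightarrow> \<bar>of_int q * r a - of_int (p a)\<bar> < 1 / N"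
    using Dirichlet_approx_finite[OF t(1) N(1), of r] by metis
  define w where "w = of_int q *\<^sub>R v - (\<Sum>a\<in>t. of_int (p a) *\<^sub>R a)"
  have sG: "add_subgroup \<Gamma>" using lat by (rule lattice_add_subgroup)
  have wG: "w \<in> \<Gamma>"
    unfolding w_def using v t X sG
    by (intro add_subgroup_diff add_subgroup_sum add_subgroup_scale) auto
  have w: "w = (\<Sum>a\<in>t. (of_int q * r a - of_int (p a)) *\<^sub>R a)"
    unfolding w_def t(3) by (simp add: scaleR_sum_right sum_subtractf scaleR_left_diff_distrib)
  have "nm w \<le> (\<Sum>a\<in>t. nm ((of_int q * r a - of_int (p a)) *\<^sub>R a))"
    unfolding w using tG by (intro integral_norm_sum[OF nm t(1)] span_scale) auto
  also have "\<dots> = (\<Sum>a\<in>t. \<bar>of_int q * r a - of_int (p a)\<bar> * nm a)"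
    using nm tG by (intro sum.cong) (auto simp: integral_norm_def)
  also have "\<dots> \<le> (\<Sum>a\<in>t. 1 / N * nm a)"
    using qp(2) nn tG by (intro sum_mono mult_right_mono) (auto intro: less_imp_le)
  also have "\<dots> = M / N" by (simp add: M_def sum_divide_distrib)
  also have "\<dots> < 1" using N by simp
  finally have "nm w < 1" .
  moreover have "nm w \<in> \<int>" "0 \<le> nm w" using wG nm by (auto simp: integral_norm_def span_base)
  ultimately have "nm w = 0" by (auto elim!: Ints_cases)
  then have "w = 0" using nm wG by (auto simp: integral_norm_def span_base)
  then have "of_int q *\<^sub>R v = (\<Sum>a\<in>t. of_int (p a) *\<^sub>R a)" unfolding w_def by simp
  also have "\<dots> \<in> zgen X" using t(2) by (intro add_subgroup_sum add_subgroup_scale zgen.base) auto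
  finally show ?thesis using that qp(1) by blast
qed

lemma add_subgroup_scale_into:
  fixes G :: "'a::real_vector set"
  shows "add_subgroup G \<Longrightarrow> add_subgroup {v. r *\<^sub>R v \<in> G}"
  by (auto simp: add_subgroup_def scaleR_right_diff_distrib)

lemma clear_denominators:
  assumes lat: "is_lattice \<Gamma>" and X: "X \<subseteq> \<Gamma>" "\<Gamma> \<subseteq> span X"
  obtains k where "(k::int) > 0" "\<And>v. v \<in> \<Gamma> \<Longrightarrow> of_int k *\<^sub>R v \<in> zgen X"
proof -
  obtain E where E: "finite E" "independent E" "\<Gamma> = zgen E"
    using lattice_basis[OF lat] .
  have "\<exists>k::int. k > 0 \<and> of_int k *\<^sub>R e \<in> zgen X" if "e \<in> E" for e
    using clear_denominator[OF lat X(1), of e] that X(2) E(3) by (metis zgen.base subset_iff)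
  then obtain k where k: "\<And>e. e \<in> E \<Longrightarrow> (k e :: int) > 0 \<and> of_int (k e) *\<^sub>R e \<in> zgen X"
    by metis
  define K where "K = prod k E"
  have "of_int K *\<^sub>R e \<in> zgen X" if "e \<in> E" for e
  proof -
    have "of_int K *\<^sub>R e = of_int (prod k (E - {e})) *\<^sub>R (of_int (k e) *\<^sub>R e)"
      unfolding K_def using prod.remove[OF E(1) that, of k] by (simp add: mult.commute)
    then show ?thesis using k[OF that] add_subgroup_scale add_subgroup_zgen by metis
  qed
  then have "zgen E \<subseteq> {v. of_int K *\<^sub>R v \<in> zgen X}"
    by (intro zgen_minimal add_subgroup_scale_into) auto
  moreover have "K > 0" unfolding K_def using k by (intro prod_pos) auto
  ultimately show ?thesis using that E(3) by blast
qed

text \<open>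
  Under a homomorphism of lattices the preimage of a rational subspace is rational. The proof takes
  lattice vectors \<open>X\<close> whose images complete a basis of \<open>span Y\<close>; clearing denominators, a multiple of
  any lattice vector differs from an integral combination of \<open>X\<close> by a lattice vector in the preimage,
  and no nonzero combination of \<open>X\<close> lies in the preimage.
\<close>

lemma rational_preimage:
  assumes Lam: "add_subgroup \<Lambda>" and g: "linear g" "g ` \<Lambda> \<subseteq> \<Gamma>" and lat: "is_lattice \<Gamma>"
    and Y: "Y \<subseteq> \<Gamma>" and v: "v \<in> span \<Lambda>" "g v \<in> span Y"
  shows "v \<in> span {l \<in> \<Lambda>. g l \<in> span Y}"
proof -
  let ?K = "{l \<in> \<Lambda>. g l \<in> span Y}"
  obtain Y0 where Y0: "Y0 \<subseteq> Y" "independent Y0" "Y \<subseteq> span Y0"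
    using maximal_independent_subset by blast
  have spY: "span Y0 = span Y" by (metis Y0(1,3) span_eq span_superset subset_trans)
  obtain B where B: "Y0 \<subseteq> B" "B \<subseteq> g ` \<Lambda> \<union> Y" "independent B" "g ` \<Lambda> \<union> Y \<subseteq> span B"
    using maximal_independent_subset_extend[of Y0 "g ` \<Lambda> \<union> Y"] Y0 by blast
  have BY: "B - Y0 \<subseteq> g ` \<Lambda>"
  proof
    fix b assume b: "b \<in> B - Y0"
    have "b \<notin> span Y0"
    proof
      assume "b \<in> span Y0"
      then have "b \<in> span (B - {b})" using b B(1) span_mono[of Y0 "B - {b}"] by blast
      then show False using B(3) b dependent_def by blast
    qed
    then show "b \<in> g ` \<Lambda>" using b B(2) Y0(3) by blast
  qed
  define X where "X = inv_into \<Lambda> g ` (B - Y0)"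
  have X: "X \<subseteq> \<Lambda>" "g ` X = B - Y0"
    unfolding X_def using BY by (auto simp: inv_into_into f_inv_into_f image_image subset_iff)
  have injX: "inj_on g X"
    unfolding X_def using BY by (intro inj_onI) (auto simp: f_inv_into_f subset_iff)
  have "X \<subseteq> \<Lambda>" by (rule X(1))
  have spX: "l \<in> span (?K \<union> X)" if l: "l \<in> \<Lambda>" for l
  proof -
    have "B \<subseteq> \<Gamma>" using B(2) g(2) Y by blast
    moreover have "g l \<in> \<Gamma>" "g l \<in> span B" using l g(2) B(4) by auto
    ultimately obtain k where k: "(k::int) > 0" "of_int k *\<^sub>R g l \<in> zgen B"
      using clear_denominator[OF lat] by metis
    have "zgen B \<subseteq> {b. \<exists>x\<in>zgen X. b - g x \<in> span Y}"
    proof (rule zgen_minimal)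
      show "add_subgroup {b. \<exists>x\<in>zgen X. b - g x \<in> span Y}"
        unfolding add_subgroup_def
      proof (intro conjI ballI)
        show "0 \<in> {b. \<exists>x\<in>zgen X. b - g x \<in> span Y}"
          using zgen.zero[of X] by (auto intro!: bexI[of _ 0] simp: linear_0 g(1) span_zero)
        fix a b assume "a \<in> {b. \<exists>x\<in>zgen X. b - g x \<in> span Y}" "b \<in> {b. \<exists>x\<in>zgen X. b - g x \<in> span Y}"
        then obtain x y where "x \<in> zgen X" "y \<in> zgen X" "a - g x \<in> span Y" "b - g y \<in> span Y" by auto
        then have "x - y \<in> zgen X" "(a - b) - g (x - y) \<in> span Y"
          using span_diff[of "a - g x" Y "b - g y"]
          by (auto simp: linear_diff[OF g(1)] algebra_simps intro: zgen.diff)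
        then show "a - b \<in> {b. \<exists>x\<in>zgen X. b - g x \<in> span Y}" by blast
      qed
      show "B \<subseteq> {b. \<exists>x\<in>zgen X. b - g x \<in> span Y}"
      proof
        fix b assume b: "b \<in> B"
        show "b \<in> {b. \<exists>x\<in>zgen X. b - g x \<in> span Y}"
        proof (cases "b \<in> Y0")
          case True
          then have "b - g 0 \<in> span Y" using Y0(1) by (auto simp: linear_0 g(1) span_base)
          then show ?thesis using zgen.zero by blast
        next
          case False
          then obtain x where "x \<in> X" "b = g x" using b X(2) by blast
          then show ?thesis by (auto intro!: bexI[of _ x] zgen.base simp: span_zero)
        qed
      qed
    qed
    then obtain x where x: "x \<in> zgen X" "of_int k *\<^sub>R g l - g x \<in> span Y" using k(2) by blast
    have "of_int k *\<^sub>R l - x \<in> ?K"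
    proof -
      have "x \<in> \<Lambda>" using x(1) zgen_minimal[OF X(1) Lam] by blast
      then show ?thesis using x(2) l Lam
        by (auto simp: linear_diff[OF g(1)] linear_scale[OF g(1)] intro!: add_subgroup_diff add_subgroup_scale)
    qed
    then have "of_int k *\<^sub>R l - x \<in> span (?K \<union> X)" by (intro span_base) auto
    moreover have "x \<in> span (?K \<union> X)" using x(1) zgen_subset_span[of X] span_mono[of X "?K \<union> X"] by blast
    ultimately have "of_int k *\<^sub>R l \<in> span (?K \<union> X)" using span_add by fastforce
    then show ?thesis using k(1) span_scale[of "of_int k *\<^sub>R l" _ "1 / of_int k"] by simp
  qed
  then have "span \<Lambda> \<subseteq> span (?K \<union> X)" by (intro span_minimal) auto
  then obtain a b where ab: "v = a + b" "a \<in> span ?K" "b \<in> span X"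
    using v(1) unfolding span_Un by blast
  have "?K \<subseteq> {l. g l \<in> span Y}" "subspace {l. g l \<in> span Y}"
    using linear_subspace_vimage[OF g(1), of "span Y"] by (auto simp: vimage_def)
  then have "g a \<in> span Y" using ab(2) span_minimal by blast
  then have gbY: "g b \<in> span Y" using v(2) span_diff[of "g v" Y "g a"] by (simp add: ab(1) linear_add[OF g(1)])
  have gbX: "g b \<in> span (B - Y0)" using ab(3) X(2) linear_span_image[OF g(1), of X] by (metis imageI)
  have "span Y0 \<inter> span (B - Y0) \<subseteq> {0}"
  proof -
    have "representation B u = (\<lambda>_. 0)" if "u \<in> span Y0" "u \<in> span (B - Y0)" for u
    proof
      fix b
      have 1: "representation B u = representation Y0 u" using representation_extend[OF B(3) that(1) B(1)] .
      have 2: "representation B u = representation (B - Y0) u" using representation_extend[OF B(3) that(2)] by blast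
      show "representation B u b = 0"
        using representation_ne_zero[of Y0 u b] representation_ne_zero[of "B - Y0" u b] 1 2 by auto
    qed
    moreover have "u = 0" if "u \<in> span B" "representation B u = (\<lambda>_. 0)" for u
      using sum_nonzero_representation_eq[OF B(3) that(1)] that(2) by simp
    ultimately show ?thesis using span_mono[OF B(1)] by blast
  qed
  then have "g b = 0" using gbY gbX spY by blast
  moreover have "inj_on g (span X)"
    using linear_inj_on_span_iff_independent_image[OF g(1), of X] injX
    by (metis B(3) Diff_subset X(2) dependent_mono)
  ultimately have "b = 0" using ab(3) inj_onD[of g "span X" b 0] by (auto simp: linear_0[OF g(1)] span_zero)
  then show ?thesis using ab by simp
qed

section \<open>Tori\<close>

lemma subspace_tspace [simp]: "subspace (tspace A)"
  by (simp add: tspace_def)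

lemma lattice_subset_tspace: "lattice A \<subseteq> tspace A"
  by (simp add: tspace_def span_superset)

lemma complex_torus_lattice: "complex_torus A \<Longrightarrow> is_lattice (lattice A)"
  and complex_torus_cstruct: "complex_torus A \<Longrightarrow> v \<in> tspace A \<Longrightarrow> cstruct A v \<in> tspace A"
  by (auto simp: complex_torus_def)

lemma torus_iso_extend:
  assumes "torus_iso A B"
  obtains f where "linear f" "bij_betw f (lattice A) (lattice B)" "f ` tspace A = tspace B"
    "\<And>v. v \<in> tspace A \<Longrightarrow> cstruct A v \<in> tspace A \<Longrightarrow> f (cstruct A v) = cstruct B (f v)"
proof -
  obtain f0 where f0: "linear_on_space (tspace A) f0" "bij_betw f0 (lattice A) (lattice B)"
    "\<And>v. v \<in> tspace A \<Longrightarrow> f0 (cstruct A v) = cstruct B (f0 v)"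
    using assms unfolding torus_iso_def by blast
  obtain f where f: "linear f" "\<And>v. v \<in> tspace A \<Longrightarrow> f v = f0 v"
    using linear_on_space_extend[OF subspace_tspace f0(1)] by blast
  have *: "\<And>v. v \<in> lattice A \<Longrightarrow> f v = f0 v" using f(2) lattice_subset_tspace by blast
  have bij: "bij_betw f (lattice A) (lattice B)"
    using f0(2) bij_betw_cong[of "lattice A" f f0] * by blast
  then have "f ` tspace A = tspace B"
    unfolding tspace_def using linear_span_image[OF f(1), of "lattice A"]
    by (simp add: bij_betw_def)
  then show ?thesis using that[OF f(1) bij] f f0(3) by metis
qed

lemma linear_on_space_linear: "linear f \<Longrightarrow> linear_on_space V f"
  by (simp add: linear_on_space_def linear_add linear_scale)

lemma torus_iso_trans:
  assumes "torus_iso A B" "torus_iso B C"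
    and "\<And>v. v \<in> tspace A \<Longrightarrow> cstruct A v \<in> tspace A"
    and "\<And>v. v \<in> tspace B \<Longrightarrow> cstruct B v \<in> tspace B"
  shows "torus_iso A C"
proof -
  obtain f where f: "linear f" "bij_betw f (lattice A) (lattice B)" "f ` tspace A = tspace B"
    "\<And>v. v \<in> tspace A \<Longrightarrow> f (cstruct A v) = cstruct B (f v)"
    using torus_iso_extend[OF assms(1)] assms(3) by metis
  obtain g where g: "linear g" "bij_betw g (lattice B) (lattice C)"
    "\<And>v. v \<in> tspace B \<Longrightarrow> g (cstruct B v) = cstruct C (g v)"
    using torus_iso_extend[OF assms(2)] assms(4) by metis
  have "bij_betw (g \<circ> f) (lattice A) (lattice C)" using f(2) g(2) by (rule bij_betw_trans)
  moreover have "(g \<circ> f) (cstruct A v) = cstruct C ((g \<circ> f) v)" if "v \<in> tspace A" for v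
    using that f(3,4) g(3) by auto
  ultimately show ?thesis
    unfolding torus_iso_def using linear_on_space_linear[OF linear_compose[OF f(1) g(1)]] by blast
qed

text \<open>
  The definition of an isomorphism asks for bijectivity on lattices only. Injectivity on the real spans
  follows because the kernel is a rational subspace.
\<close>

lemma torus_iso_sym:
  assumes iso: "torus_iso A B" and lat: "is_lattice (lattice B)"
    and Ag: "add_subgroup (lattice A)"
    and J: "\<And>v. v \<in> tspace A \<Longrightarrow> cstruct A v \<in> tspace A"
  shows "torus_iso B A"
proof -
  obtain f where f: "linear f" "bij_betw f (lattice A) (lattice B)" "f ` tspace A = tspace B"
    "\<And>v. v \<in> tspace A \<Longrightarrow> f (cstruct A v) = cstruct B (f v)"
    using torus_iso_extend[OF assms(1)] J by metis
  have "v = 0" if v: "v \<in> tspace A" "f v = 0" for v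
  proof -
    have "f ` lattice A \<subseteq> lattice B" using f(2) by (simp add: bij_betw_def)
    then have "v \<in> span {l \<in> lattice A. f l \<in> span {}}"
      using v unfolding tspace_def by (intro rational_preimage[OF Ag f(1) _ lat]) auto
    moreover have "{l \<in> lattice A. f l \<in> span {}} \<subseteq> {0}"
    proof
      fix l assume "l \<in> {l \<in> lattice A. f l \<in> span {}}"
      then have "l \<in> lattice A" "f l = f 0" by (auto simp: linear_0[OF f(1)])
      then show "l \<in> {0}"
        using f(2) add_subgroup_zero[OF Ag] unfolding bij_betw_def by (auto dest: inj_onD)
    qed
    ultimately have "v \<in> span {0}" using span_mono by blast
    then show "v = 0" by simp
  qed
  then have inj: "inj_on f (tspace A)"
    using linear_injective_on_subspace_0[OF f(1) subspace_tspace] by blast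
  obtain h where h: "linear h" "\<forall>v\<in>tspace A. h (f v) = v"
    using linear_exists_left_inverse_on[OF f(1) subspace_tspace inj] by blast
  have "bij_betw h (lattice B) (lattice A)"
  proof (rule bij_betw_byWitness[where f'=f])
    show "\<forall>b\<in>lattice B. f (h b) = b" "h ` lattice B \<subseteq> lattice A"
      using f(2) h(2) lattice_subset_tspace[of A] unfolding bij_betw_def by force+
    show "\<forall>a\<in>lattice A. h (f a) = a" using h(2) lattice_subset_tspace by blast
    show "f ` lattice A \<subseteq> lattice B" using f(2) by (simp add: bij_betw_def)
  qed
  moreover have "h (cstruct B v) = cstruct A (h v)" if v: "v \<in> tspace B" for v
  proof -
    obtain u where "u \<in> tspace A" "v = f u" using v f(3) by blast
    then show ?thesis using f(4) h(2) J by metis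
  qed
  ultimately show ?thesis unfolding torus_iso_def using linear_on_space_linear[OF h(1)] by blast
qed

section \<open>Dual lattices\<close>

lemma sum_fun_apply: "(\<Sum>i\<in>I. f i) x = (\<Sum>i\<in>I. f i x)"
  by (induction I rule: infinite_finite_induct) auto

lemma subspace_lin_hom:
  assumes "subspace W" shows "subspace (lin_hom V W)"
  using assms unfolding subspace_def lin_hom_def linear_on_space_def
  by (auto simp: algebra_simps image_subset_iff scaleR_add_right)

text \<open>
  The coordinate functions of a basis are the dual basis; outside the span \<open>representation\<close> is zero,
  in agreement with the encoding of linear forms by extension by zero.
\<close>

lemma dual_space_expand:
  assumes E: "finite E" "independent E" and w: "w \<in> dual_space (span E)"
  shows "w = (\<Sum>e\<in>E. w e *\<^sub>R (\<lambda>v. representation E v e))"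
proof
  fix v
  show "w v = (\<Sum>e\<in>E. w e *\<^sub>R (\<lambda>v. representation E v e)) v"
  proof (cases "v \<in> span E")
    case True
    obtain g where g: "linear g" "\<And>v. v \<in> span E \<Longrightarrow> g v = w v"
      using w linear_on_space_extend[of "span E" w] unfolding dual_space_def lin_hom_def by auto
    have "w v = g (\<Sum>e\<in>E. representation E v e *\<^sub>R e)"
      using g(2)[OF True] sum_representation_eq[OF E(2) True E(1) order_refl] by simp
    also have "\<dots> = (\<Sum>e\<in>E. representation E v e *\<^sub>R w e)"
      by (simp add: linear_sum[OF g(1)] linear_scale[OF g(1)] g(2) span_base)
    finally show ?thesis by (simp add: sum_fun_apply mult.commute)
  next
    case False
    then have "w v = 0" "\<And>e. representation E v e = 0"
      using w by (auto simp: dual_space_def lin_hom_def representation_def)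
    then show ?thesis by (simp add: sum_fun_apply)
  qed
qed

lemma representation_dual_space:
  assumes "independent E"
  shows "(\<lambda>v. representation E v e) \<in> dual_space (span E)"
  using assms
  by (auto simp: dual_space_def lin_hom_def linear_on_space_def representation_add representation_scale)
     (simp add: representation_def)

lemma dual_lattice:
  assumes A: "is_lattice (lattice A)"
  shows "is_lattice (lattice (dual_torus A))" "tspace (dual_torus A) = dual_space (tspace A)"
proof -
  obtain E where E: "finite E" "independent E" "lattice A = zgen E"
    using lattice_basis[OF A] .
  have V: "tspace A = span E" by (simp add: tspace_def E(3))
  define d where "d e = (\<lambda>v. representation E v e)" for e
  have dE: "d e e' = (if e' = e then 1 else 0)" if "e' \<in> E" for e e'
    using representation_basis[OF E(2) that] unfolding d_def by auto
  have inj: "inj_on d E"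
    using dE by (intro inj_onI) (metis zero_neq_one)
  have ind: "independent (d ` E)"
  proof (rule independent_if_scalars_zero)
    fix f x assume *: "(\<Sum>x\<in>d ` E. f x *\<^sub>R x) = 0" "x \<in> d ` E"
    then obtain e where e: "e \<in> E" "x = d e" by blast
    have "0 = (\<Sum>x\<in>d ` E. f x *\<^sub>R x) e" using *(1) by simp
    also have "\<dots> = (\<Sum>e'\<in>E. f (d e') * d e' e)"
      using inj by (simp add: sum.reindex sum_fun_apply)
    also have "\<dots> = (\<Sum>e'\<in>E. if e' = e then f (d e') else 0)"
      using dE[OF e(1)] by (intro sum.cong) auto
    also have "\<dots> = f x" using E(1) e by simp
    finally show "f x = 0" by simp
  qed (use E in simp)
  have L: "lattice (dual_torus A) = zgen (d ` E)"
  proof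
    show "lattice (dual_torus A) \<subseteq> zgen (d ` E)"
    proof
      fix w assume w: "w \<in> lattice (dual_torus A)"
      then have "w \<in> dual_space (span E)" "\<And>e. e \<in> E \<Longrightarrow> w e \<in> \<int>"
        by (auto simp: dual_torus_def V E(3) zgen.base)
      then have "w = (\<Sum>e\<in>E. of_int \<lfloor>w e\<rfloor> *\<^sub>R d e)"
        using dual_space_expand[OF E(1,2), of w] unfolding d_def by (simp add: of_int_floor)
      also have "\<dots> \<in> zgen (d ` E)"
        by (intro add_subgroup_sum[OF add_subgroup_zgen] add_subgroup_scale zgen.base) auto
      finally show "w \<in> zgen (d ` E)" .
    qed
    have "add_subgroup (lattice (dual_torus A))"
      using add_subgroup_subspace[OF subspace_lin_hom[OF subspace_UNIV, of "tspace A"]]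
      by (auto simp: dual_torus_def add_subgroup_def dual_space_def)
    moreover have "d ` E \<subseteq> lattice (dual_torus A)"
      using representation_dual_space[OF E(2)] representation_zgen[OF E(1,2)]
      by (auto simp: dual_torus_def V d_def E(3) representation_ne_zero)
    ultimately show "zgen (d ` E) \<subseteq> lattice (dual_torus A)" by (rule zgen_minimal[rotated])
  qed
  show "is_lattice (lattice (dual_torus A))" unfolding L using E(1) ind by (intro is_lattice_zgen) auto
  have "dual_space (span E) \<subseteq> span (d ` E)"
  proof
    fix w assume "w \<in> dual_space (span E)"
    then have "w = (\<Sum>e\<in>E. w e *\<^sub>R d e)"
      using dual_space_expand[OF E(1,2), of w] unfolding d_def by simp
    also have "\<dots> \<in> span (d ` E)" by (intro span_sum span_scale span_base) auto
    finally show "w \<in> span (d ` E)" .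
  qed
  moreover have "span (d ` E) \<subseteq> dual_space (span E)"
    using representation_dual_space[OF E(2)] subspace_lin_hom[OF subspace_UNIV, of "span E"]
    unfolding d_def dual_space_def by (intro span_minimal) auto
  ultimately show "tspace (dual_torus A) = dual_space (tspace A)"
    unfolding tspace_def L using V by (simp add: tspace_def)
qed

text \<open>
  An injective linear map into a space of the same finite dimension is onto. The ambient type may have
  infinite dimension, so the dimension count is carried out with cardinalities of independent sets.
\<close>

lemma nondegenerate_surj:
  assumes V: "V \<subseteq> span E" "finite E" "subspace V" and c: "linear_on_space V c" "c ` V \<subseteq> dual_space V"
    and nd: "\<And>v. v \<in> V \<Longrightarrow> c v = 0 \<Longrightarrow> v = 0"
  shows "c ` V = dual_space V"
proof
  show "dual_space V \<subseteq> c ` V"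
  proof
    fix w assume w: "w \<in> dual_space V"
    obtain B where B: "B \<subseteq> V" "independent B" "V \<subseteq> span B"
      using maximal_independent_subset by blast
    have spB: "span B = V" using B span_minimal[OF B(1) V(3)] by blast
    have fin: "finite B" using independent_span_bound[OF V(2) B(2)] B(1) V(1) by blast
    obtain g where g: "linear g" "\<And>v. v \<in> V \<Longrightarrow> g v = c v"
      using linear_on_space_extend[OF V(3) c(1)] by blast
    have inj: "inj_on g V"
      using linear_injective_on_subspace_0[OF g(1) V(3)] g(2) nd by metis
    have ind: "independent (g ` B)"
      using linear_independent_injective_image[OF g(1) B(2)] inj spB by simp
    let ?D = "(\<lambda>e v. representation B v e) ` B"
    have sub: "dual_space V \<subseteq> span ?D"
    proof
      fix u assume "u \<in> dual_space V"
      then have "u = (\<Sum>e\<in>B. u e *\<^sub>R (\<lambda>v. representation B v e))"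
        using dual_space_expand[OF fin B(2), of u] spB by simp
      also have "\<dots> \<in> span ?D" by (intro span_sum span_scale span_base) auto
      finally show "u \<in> span ?D" .
    qed
    have gB: "g ` B \<subseteq> dual_space V" using B(1) g(2) c(2) by auto
    have "w \<in> span (g ` B)"
    proof (rule ccontr)
      assume nw: "w \<notin> span (g ` B)"
      then have "independent (insert w (g ` B))" using ind by (simp add: independent_insert)
      moreover have "insert w (g ` B) \<subseteq> span ?D" using gB w sub by auto
      ultimately have "card (insert w (g ` B)) \<le> card ?D"
        using independent_span_bound[of ?D "insert w (g ` B)"] fin by auto
      moreover have "card (g ` B) = card B"
        using inj B(1) by (intro card_image) (rule inj_on_subset)
      moreover have "w \<notin> g ` B" using nw span_superset[of "g ` B"] by auto
      ultimately show False using fin card_image_le[OF fin, of "\<lambda>e v. representation B v e"] by simp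
    qed
    then have "w \<in> g ` V" using linear_span_image[OF g(1), of B] spB by simp
    then show "w \<in> c ` V" using g(2) by auto
  qed
qed (rule c)

lemma span_Times_zero:
  fixes X :: "'a::real_vector set" and Y :: "'b::real_vector set"
  assumes "0 \<in> X" "0 \<in> Y"
  shows "span (X \<times> Y) = span X \<times> span Y"
proof
  show "span (X \<times> Y) \<subseteq> span X \<times> span Y"
    by (intro span_minimal subspace_Times) (auto intro: span_base)
  show "span X \<times> span Y \<subseteq> span (X \<times> Y)"
  proof clarify
    fix x y assume xy: "x \<in> span X" "y \<in> span Y"
    have l: "linear (\<lambda>x::'a. (x, 0::'b))" "linear (\<lambda>y::'b. (0::'a, y))"
      by (auto intro!: linearI)
    have "(x, 0) \<in> span ((\<lambda>x. (x, 0::'b)) ` X)"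
      using xy(1) unfolding linear_span_image[OF l(1)] by blast
    moreover have "(0, y) \<in> span ((\<lambda>y. (0::'a, y)) ` Y)"
      using xy(2) unfolding linear_span_image[OF l(2)] by blast
    moreover have "span ((\<lambda>x. (x, 0::'b)) ` X) \<subseteq> span (X \<times> Y)" "span ((\<lambda>y. (0::'a, y)) ` Y) \<subseteq> span (X \<times> Y)"
      using assms by (intro span_mono; auto)+
    ultimately have "(x, 0) \<in> span (X \<times> Y)" "(0, y) \<in> span (X \<times> Y)"
      by auto
    from span_add[OF this] show "(x, y) \<in> span (X \<times> Y)" by simp
  qed
qed

lemma prod_dual_tspace:
  assumes "is_lattice (lattice A)"
  shows "tspace (prod_torus A (dual_torus A)) = tspace A \<times> dual_space (tspace A)"
proof -
  have "0 \<in> lattice A" "0 \<in> lattice (dual_torus A)"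
    using assms dual_lattice(1)[OF assms] by (auto intro: add_subgroup_zero lattice_add_subgroup)
  then show ?thesis
    unfolding dual_lattice(2)[OF assms, symmetric]
    by (simp add: tspace_def prod_torus_def span_Times_zero)
qed

lemma is_lattice_Times:
  fixes \<Gamma> :: "'a::real_vector set" and \<Delta> :: "'b::real_vector set"
  assumes "is_lattice \<Gamma>" "is_lattice \<Delta>"
  shows "is_lattice (\<Gamma> \<times> \<Delta>)"
proof -
  obtain E where E: "finite E" "independent E" "\<Gamma> = zgen E" using lattice_basis[OF assms(1)] .
  obtain F where F: "finite F" "independent F" "\<Delta> = zgen F" using lattice_basis[OF assms(2)] .
  let ?i = "\<lambda>x::'a. (x, 0::'b)" and ?j = "\<lambda>y::'b. (0::'a, y)"
  have l: "linear ?i" "linear ?j" by (auto intro!: linearI)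
  have "independent (?i ` E \<union> ?j ` F)"
  proof (rule independent_if_scalars_zero)
    fix f x assume *: "(\<Sum>x\<in>?i ` E \<union> ?j ` F. f x *\<^sub>R x) = 0" "x \<in> ?i ` E \<union> ?j ` F"
    have "0 \<notin> E" using E(2) dependent_zero by blast
    then have "(\<Sum>x\<in>?i ` E \<union> ?j ` F. f x *\<^sub>R x) = (\<Sum>x\<in>?i ` E. f x *\<^sub>R x) + (\<Sum>x\<in>?j ` F. f x *\<^sub>R x)"
      using E(1) F(1) by (intro sum.union_disjoint) auto
    also have "\<dots> = (\<Sum>e\<in>E. f (e, 0) *\<^sub>R (e, 0)) + (\<Sum>y\<in>F. f (0, y) *\<^sub>R (0, y))"
      by (simp add: sum.reindex inj_on_def)
    also have "\<dots> = (\<Sum>e\<in>E. f (e, 0) *\<^sub>R e, \<Sum>y\<in>F. f (0, y) *\<^sub>R y)"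
      by (rule prod_eqI) (simp_all add: fst_sum snd_sum)
    finally have 0: "(\<Sum>e\<in>E. f (e, 0) *\<^sub>R e) = 0" "(\<Sum>y\<in>F. f (0, y) *\<^sub>R y) = 0"
      using *(1) by (simp_all add: zero_prod_def)
    then show "f x = 0"
      using *(2) independentD[OF E(2,1) order_refl 0(1)] independentD[OF F(2,1) order_refl 0(2)] by auto
  qed (use E F in simp)
  moreover have "\<Gamma> \<times> \<Delta> = zgen (?i ` E \<union> ?j ` F)" (is "_ = zgen ?U")
  proof
    show "zgen ?U \<subseteq> \<Gamma> \<times> \<Delta>"
      using E F by (intro zgen_minimal) (auto simp: add_subgroup_def zero_prod_def intro: zgen.intros)
    have "zgen E \<subseteq> {x. ?i x \<in> zgen ?U}" "zgen F \<subseteq> {y. ?j y \<in> zgen ?U}"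
      using add_subgroup_diff[OF add_subgroup_zgen[of ?U]] zgen.zero[of ?U]
      by (intro zgen_minimal; force simp: add_subgroup_def zero_prod_def intro: zgen.base)+
    then show "\<Gamma> \<times> \<Delta> \<subseteq> zgen ?U"
      unfolding E F using add_subgroup_add[OF add_subgroup_zgen[of ?U], of "?i x" "?j y" for x y] by fastforce
  qed
  ultimately show ?thesis using E(1) F(1) is_lattice_zgen by (metis finite_UnI finite_imageI)
qed

text \<open>
  This is where nondegeneracy of \<open>\<phi>\<^sub>2\<close> is used: \<open>inv_into\<close> has the intended values only because
  \<open>\<phi>\<^sub>2 : V \<rightarrow> V\<^sup>*\<close> is onto.
\<close>

lemma I_omega_closed:
  assumes wp: "weak_pair A \<omega>" and x: "x \<in> tspace A \<times> dual_space (tspace A)"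
  shows "I_omega A \<omega> x \<in> tspace A \<times> dual_space (tspace A)"
proof -
  let ?V = "tspace A"
  obtain \<phi>1 \<phi>2 where \<omega>: "\<omega> = (\<phi>1, \<phi>2)" by (cases \<omega>)
  obtain v w where vw: "x = (v, w)" "v \<in> ?V" "w \<in> dual_space ?V" using x by auto
  have subd: "subspace (dual_space ?V)" unfolding dual_space_def by (simp add: subspace_lin_hom)
  have "neron_severi_real A \<subseteq> lin_hom ?V (dual_space ?V)"
    unfolding neron_severi_real_def neron_severi_def
    by (intro span_minimal subspace_lin_hom subd) auto
  then have \<phi>: "\<phi>1 \<in> lin_hom ?V (dual_space ?V)" "\<phi>2 \<in> lin_hom ?V (dual_space ?V)"
      and nd: "\<And>v. v \<in> ?V \<Longrightarrow> (\<forall>w\<in>?V. \<phi>2 v w = 0) \<Longrightarrow> v = 0"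
    using wp by (auto simp: weak_pair_def \<omega> neron_severi_complex0_def neron_severi_real0_def)
  obtain E where E: "finite E" "lattice A = zgen E"
    using wp lattice_basis unfolding weak_pair_def complex_torus_def by metis
  have "\<phi>2 ` ?V = dual_space ?V"
    using \<phi>(2) nd E by (intro nondegenerate_surj[of _ E]) (auto simp: lin_hom_def tspace_def)
  then have \<psi>: "inv_into ?V \<phi>2 u \<in> ?V" if "u \<in> dual_space ?V" for u
    using that by (simp add: inv_into_into)
  have \<phi>V: "\<phi>1 u \<in> dual_space ?V" "\<phi>2 u \<in> dual_space ?V" if "u \<in> ?V" for u
    using \<phi> that by (auto simp: lin_hom_def)
  show ?thesis
    unfolding \<omega> vw(1) I_omega_def Let_def
    using vw(2,3) by (auto intro!: subspace_diff subspace_add subd \<psi> \<phi>V)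
qed

lemma mirror_symmetric_torus_iso:
  assumes "mirror_symmetric A \<omega>A B \<omega>B"
  shows "torus_iso \<lparr>lattice = lattice A \<times> lattice (dual_torus A), cstruct = I_omega A \<omega>A\<rparr>
    (prod_torus B (dual_torus B))"
proof -
  obtain \<alpha> where
    "linear_on_space (tspace (prod_torus A (dual_torus A))) \<alpha>"
    "bij_betw \<alpha> (lattice (prod_torus A (dual_torus A))) (lattice (prod_torus B (dual_torus B)))"
    "\<forall>x\<in>tspace (prod_torus A (dual_torus A)).
      \<alpha> (I_omega A \<omega>A x) = cstruct (prod_torus B (dual_torus B)) (\<alpha> x)"
    using assms unfolding mirror_symmetric_def Let_def by (elim exE conjE)
  then show ?thesis
    unfolding torus_iso_def by (intro exI[of _ \<alpha>]) (simp add: tspace_def prod_torus_def)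
qed

text \<open>
  Both products are isomorphic to the torus with lattice \<open>\<Lambda>\<^sub>A\<close> and complex structure \<open>I\<^sub>\<omega>\<close>.
\<close>

lemma mirror_partners_iso:
  assumes A: "weak_pair A \<omega>A"
    and B: "mirror_symmetric A \<omega>A B \<omega>B" "complex_torus B"
    and C: "mirror_symmetric A \<omega>A C \<omega>C"
  shows "torus_iso (prod_torus B (dual_torus B)) (prod_torus C (dual_torus C))"
proof -
  let ?T = "\<lparr>lattice = lattice A \<times> lattice (dual_torus A), cstruct = I_omega A \<omega>A\<rparr>"
  let ?BB = "prod_torus B (dual_torus B)"
  have latA: "is_lattice (lattice A)" using A by (simp add: weak_pair_def complex_torus_def)
  have latB: "is_lattice (lattice B)" using B by (simp add: complex_torus_def)
  have tT: "tspace ?T = tspace A \<times> dual_space (tspace A)"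
    using prod_dual_tspace[OF latA] by (simp add: tspace_def prod_torus_def)
  have T: "\<And>v. v \<in> tspace ?T \<Longrightarrow> cstruct ?T v \<in> tspace ?T"
    unfolding tT using I_omega_closed[OF A] by simp
  have lT: "is_lattice (lattice ?T)" using is_lattice_Times[OF latA dual_lattice(1)[OF latA]] by simp
  have lBB: "is_lattice (lattice ?BB)"
    using is_lattice_Times[OF latB dual_lattice(1)[OF latB]] by (simp add: prod_torus_def)
  have 1: "torus_iso ?BB ?T"
    using torus_iso_sym[OF mirror_symmetric_torus_iso[OF B(1)] lBB lattice_add_subgroup[OF lT] T] .
  have 2: "cstruct ?BB v \<in> tspace ?BB" if "v \<in> tspace ?BB" for v
  proof -
    have "(\<lambda>v. if v \<in> tspace B then w (- cstruct B v) else 0) \<in> dual_space (tspace B)"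
      if w: "w \<in> dual_space (tspace B)" for w
    proof -
      have J: "linear_on_space (tspace B) (cstruct B)" "\<And>v. v \<in> tspace B \<Longrightarrow> cstruct B v \<in> tspace B"
        using B(2) by (auto simp: complex_torus_def)
      obtain g where g: "linear g" "\<And>v. v \<in> tspace B \<Longrightarrow> g v = w v"
        using w linear_on_space_extend[of "tspace B" w] unfolding dual_space_def lin_hom_def by auto
      obtain j where j: "linear j" "\<And>v. v \<in> tspace B \<Longrightarrow> j v = cstruct B v"
        using linear_on_space_extend[OF subspace_tspace J(1)] by blast
      have wJ: "w (- cstruct B v) = - g (j v)" if v: "v \<in> tspace B" for v
      proof -
        have "w (- cstruct B v) = g (- cstruct B v)" using g(2) J v by (simp add: subspace_neg)
        then show ?thesis using j(2)[OF v] by (simp add: linear_neg[OF g(1)])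
      qed
      show ?thesis
        unfolding dual_space_def lin_hom_def linear_on_space_def
        using g(1) j(1)
        by (auto simp: wJ subspace_add subspace_scale linear_add linear_scale)
    qed
    then show ?thesis
      using that B(2) unfolding prod_dual_tspace[OF latB]
      by (auto simp: prod_torus_def dual_torus_def complex_torus_def)
  qed
  show ?thesis
    by (rule torus_iso_trans[OF 1 mirror_symmetric_torus_iso[OF C]]) (fact 2, fact T)
qed

section \<open>Decomposition of an abelian variety into simple tori\<close>

text \<open>
  Subtori correspond to the complex-stable subspaces that are spanned by lattice vectors.
\<close>

definition simple_torus :: "'a::real_vector torus \<Rightarrow> bool"
  where "simple_torus S \<longleftrightarrow> complex_torus S \<and> tspace S \<noteq> {0} \<and>
    (\<forall>X\<subseteq>lattice S. cstruct S ` span X \<subseteq> span X \<longrightarrow> span X = {0} \<or> span X = tspace S)"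

lemma dim_strict_mono:
  fixes W :: "'a::real_vector set"
  assumes "subspace U" "subspace W" "U \<subset> W" "W \<subseteq> span E" "finite E"
  shows "dim U < dim W"
proof -
  obtain B where B: "B \<subseteq> U" "independent B" "U \<subseteq> span B" "card B = dim U"
    using basis_exists by blast
  obtain C where C: "B \<subseteq> C" "C \<subseteq> W" "independent C" "W \<subseteq> span C"
    using maximal_independent_subset_extend[of B W] B assms(3) by blast
  have "finite C" using independent_span_bound[OF assms(5) C(3)] C(2) assms(4) by blast
  moreover have "card C = dim W" using basis_card_eq_dim C by blast
  moreover have "B \<noteq> C" using B(1) C(4) assms(1,3) span_minimal[of B U] by blast
  ultimately show ?thesis using B(4) C(1) psubset_card_mono[of C B] by auto
qed

lemma is_lattice_Ints: "is_lattice (\<int> :: real set)"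
proof -
  have "(\<int> :: real set) = range (\<lambda>k :: real \<Rightarrow> int. \<Sum>e\<in>{1}. of_int (k e) *\<^sub>R e)"
    by (auto simp: Ints_def intro!: image_eqI[of _ _ "\<lambda>_. _"])
  then show ?thesis unfolding is_lattice_def
    by (intro exI[of _ "{1}"]) (auto simp: dependent_single)
qed

text \<open>
  Imposing the equations one at a time keeps the kernel a rational subspace, since the rationality of
  a preimage is available over an arbitrary subgroup.
\<close>

lemma rational_common_kernel:
  fixes g :: "'i \<Rightarrow> 'a::real_vector \<Rightarrow> real"
  assumes "finite I" "add_subgroup \<Lambda>" "\<And>i. i \<in> I \<Longrightarrow> linear (g i)"
    "\<And>i l. i \<in> I \<Longrightarrow> l \<in> \<Lambda> \<Longrightarrow> g i l \<in> \<int>" "w \<in> span \<Lambda>" "\<And>i. i \<in> I \<Longrightarrow> g i w = 0"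
  shows "w \<in> span {l \<in> \<Lambda>. \<forall>i\<in>I. g i l = 0}"
  using assms
proof (induction I rule: finite_induct)
  case empty
  then show ?case by simp
next
  case (insert i I)
  let ?L = "{l \<in> \<Lambda>. \<forall>i\<in>I. g i l = 0}"
  have w: "w \<in> span ?L" using insert by auto
  have gI: "linear (g j)" if "j \<in> I" for j using insert.prems that by auto
  have L: "add_subgroup ?L"
    using insert.prems(1) gI by (auto simp: add_subgroup_def linear_0 linear_diff)
  have "w \<in> span {l \<in> ?L. g i l \<in> span {}}"
    using insert.prems w by (intro rational_preimage[OF L _ _ is_lattice_Ints]) auto
  also have "{l \<in> ?L. g i l \<in> span {}} = {l \<in> \<Lambda>. \<forall>i\<in>insert i I. g i l = 0}" by auto
  finally show ?case .
qed

text \<open>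
  Poincare reducibility. The orthogonal complement of a stable rational subspace \<open>U\<close> for a polarization
  \<open>c\<close> is again stable and rational, and it is a complement because \<open>c(u, J u) > 0\<close> for \<open>u \<noteq> 0\<close>. The
  induction is on the dimension of the spanned subspace. The lattices of the summands are generated by
  bases consisting of lattice vectors, so a summand is determined only up to isogeny.
\<close>

lemma simple_decomposition:
  assumes "abelian_variety A"
  obtains \<S> where "finite \<S>"
    "\<And>S. S \<in> \<S> \<Longrightarrow> simple_torus S \<and> lattice S \<subseteq> lattice A \<and> cstruct S = cstruct A"
    "lattice A \<subseteq> span (\<Union>S\<in>\<S>. lattice S)"
proof -
  let ?V = "tspace A" and ?L = "lattice A" and ?J = "cstruct A"
  obtain c where ct: "complex_torus A" and pol: "polarization A c"
    using assms unfolding abelian_variety_def by blast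
  have lat: "is_lattice ?L" and J: "linear_on_space ?V ?J"
      "\<And>v. v \<in> ?V \<Longrightarrow> ?J v \<in> ?V" "\<And>v. v \<in> ?V \<Longrightarrow> ?J (?J v) = - v"
    using ct by (auto simp: complex_torus_def)
  have c: "c \<in> lin_hom ?V (dual_space ?V)"
      and cJ: "\<And>v w. v \<in> ?V \<Longrightarrow> w \<in> ?V \<Longrightarrow> c (?J v) (?J w) = c v w"
      and cint: "\<And>v w. v \<in> ?L \<Longrightarrow> w \<in> ?L \<Longrightarrow> c v w \<in> \<int>"
      and cpos: "\<And>v. v \<in> ?V \<Longrightarrow> v \<noteq> 0 \<Longrightarrow> c v (?J v) > 0"
    using pol unfolding polarization_def neron_severi_def by blast+
  have c_left: "c (a + b) = c a + c b" "c (r *\<^sub>R a) = r *\<^sub>R c a" if "a \<in> ?V" "b \<in> ?V" for a b r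
    using c that by (auto simp: lin_hom_def linear_on_space_def)
  have c_right: "linear_on_space ?V (c a)" "\<And>v. v \<notin> ?V \<Longrightarrow> c a v = 0" if "a \<in> ?V" for a
    using c that by (auto simp: lin_hom_def dual_space_def)
  have c_right': "c a (x + y) = c a x + c a y" "c a (r *\<^sub>R x) = r * c a x"
    if "a \<in> ?V" "x \<in> ?V" "y \<in> ?V" for a x y r
    using c_right(1)[OF that(1)] that by (auto simp: linear_on_space_def)
  have c_left': "c (a - b) u = c a u - c b u" if "a \<in> ?V" "b \<in> ?V" for a b u
    using c_left(1)[OF that(1), of "(-1) *\<^sub>R b"] c_left(2)[OF that(2,2), of "-1"] that
    by (simp add: subspace_neg)
  obtain E where E: "finite E" "independent E" "?L = zgen E" using lattice_basis[OF lat] .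
  have VE: "?V = span E" by (simp add: tspace_def E(3))
  have LV: "?L \<subseteq> ?V" by (rule lattice_subset_tspace)
  have claim: "\<exists>\<S>. finite \<S> \<and> (\<forall>S\<in>\<S>. simple_torus S \<and> lattice S \<subseteq> ?L \<and> cstruct S = ?J) \<and>
      X \<subseteq> span (\<Union>S\<in>\<S>. lattice S)"
    if "X \<subseteq> ?L" "?J ` span X \<subseteq> span X" for X
    using that
  proof (induction "dim X" arbitrary: X rule: less_induct)
    case less
    let ?W = "span X"
    have WV: "?W \<subseteq> ?V" using less.prems(1) by (auto simp: tspace_def intro!: span_mono)
    then have WE: "?W \<subseteq> span E" by (simp add: VE)
    consider "?W = {0}"
      | "?W \<noteq> {0}" "\<forall>Y\<subseteq>?L. span Y \<subseteq> ?W \<and> ?J ` span Y \<subseteq> span Y \<longrightarrow> span Y = {0} \<or> span Y = ?W"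
      | Y where "Y \<subseteq> ?L" "span Y \<subset> ?W" "?J ` span Y \<subseteq> span Y" "span Y \<noteq> {0}"
      by blast
    then show ?case
    proof cases
      case 1
      then have "X \<subseteq> span (\<Union>S\<in>{}. lattice S)" using span_superset[of X] by simp
      then show ?thesis by (intro exI[of _ "{}"]) simp
    next
      case 2
      obtain B where B: "B \<subseteq> X" "independent B" "X \<subseteq> span B"
        using maximal_independent_subset by blast
      have fB: "finite B" using independent_span_bound[OF E(1) B(2)] B(1) WE span_superset by blast
      have spB: "span B = ?W" using B by (metis span_eq span_superset subset_trans)
      define S where "S = \<lparr>lattice = zgen B, cstruct = ?J\<rparr>"
      have tS: "tspace S = ?W" "lattice S = zgen B" "cstruct S = ?J" by (simp_all add: S_def tspace_def spB)
      have LS: "lattice S \<subseteq> ?L"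
        unfolding tS using B(1) less.prems(1) zgen_minimal[OF _ lattice_add_subgroup[OF lat]] by blast
      have "complex_torus S"
        unfolding complex_torus_def tS
        using is_lattice_zgen[OF fB B(2)] J WV less.prems(2)
        by (auto simp: linear_on_space_def subset_iff image_subset_iff)
      moreover have "span Z = {0} \<or> span Z = tspace S"
        if "Z \<subseteq> lattice S" "cstruct S ` span Z \<subseteq> span Z" for Z
      proof -
        have "span Z \<subseteq> ?W" using that(1) spB span_mono[of Z "zgen B"] by (simp add: tS)
        moreover have "Z \<subseteq> ?L" using that(1) LS by (rule subset_trans)
        moreover have "?J ` span Z \<subseteq> span Z" using that(2) by (simp add: tS)
        ultimately show ?thesis unfolding tS using 2(2)[rule_format, of Z] by simp
      qed
      ultimately have "simple_torus S" using 2(1) unfolding simple_torus_def tS(1) by simp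
      moreover have "X \<subseteq> span (\<Union>S\<in>{S}. lattice S)" using B(3) by (simp add: tS)
      ultimately show ?thesis using LS tS by (intro exI[of _ "{S}"]) simp
    next
      case 3
      let ?U = "span Y"
      have UV: "?U \<subseteq> ?V" using 3(2) WV by blast
      obtain B where B: "B \<subseteq> Y" "independent B" "Y \<subseteq> span B"
        using maximal_independent_subset by blast
      have fB: "finite B"
        using independent_span_bound[OF E(1) B(2)] B(1) UV VE span_superset by blast
      have spB: "span B = ?U" using B by (metis span_eq span_superset subset_trans)
      have BL: "B \<subseteq> ?L" using B(1) 3(1) by blast
      define X' where "X' = {l \<in> ?L \<inter> ?W. \<forall>b\<in>B. c l b = 0}"
      have orth: "c w u = 0" if w: "w \<in> ?V" "\<And>b. b \<in> B \<Longrightarrow> c w b = 0" and u: "u \<in> ?U" for w u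
      proof -
        obtain f where f: "linear f" "\<And>v. v \<in> ?V \<Longrightarrow> f v = c w v"
          using linear_on_space_extend[OF subspace_tspace c_right(1)[OF w(1)]] by blast
        have "f u = 0"
          using linear_eq_0_on_span[OF f(1), of B u] f(2) w(2) u BL LV unfolding spB by (metis subset_iff)
        then show ?thesis using f(2) u UV by (metis subset_iff)
      qed
      have X'mem: "w \<in> span X'" if w: "w \<in> ?W" "\<And>b. b \<in> B \<Longrightarrow> c w b = 0" for w
      proof -
        have "\<exists>f. linear f \<and> (\<forall>v\<in>?V. f v = c v b)" if "b \<in> B" for b
        proof -
          have "linear_on_space ?V (\<lambda>v. c v b)"
            unfolding linear_on_space_def using c_left by auto
          then show ?thesis using linear_on_space_extend[OF subspace_tspace] by metis
        qed
        then obtain f where f: "\<And>b. b \<in> B \<Longrightarrow> linear (f b)" "\<And>b v. b \<in> B \<Longrightarrow> v \<in> ?V \<Longrightarrow> f b v = c v b"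
          by metis
        have ag: "add_subgroup (?L \<inter> ?W)"
          using lattice_add_subgroup[OF lat] add_subgroup_subspace[OF subspace_span, of X]
          by (auto simp: add_subgroup_def)
        have "w \<in> span (?L \<inter> ?W)"
          using w(1) less.prems(1) span_mono[of X "?L \<inter> ?W"] span_superset[of X] by blast
        moreover have "f b w = 0" if "b \<in> B" for b using f(2)[OF that] w WV that by auto
        moreover have "f b l \<in> \<int>" if "b \<in> B" "l \<in> ?L \<inter> ?W" for b l
        proof -
          have "l \<in> ?L" "b \<in> ?L" using that BL by auto
          then show ?thesis using f(2)[OF that(1), of l] cint[of l b] LV by auto
        qed
        ultimately have "w \<in> span {l \<in> ?L \<inter> ?W. \<forall>b\<in>B. f b l = 0}"
          by (intro rational_common_kernel[OF fB ag f(1)])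
        moreover have "{l \<in> ?L \<inter> ?W. \<forall>b\<in>B. f b l = 0} = X'"
          unfolding X'_def using f(2) LV by auto
        ultimately show ?thesis by simp
      qed
      have X'V: "X' \<subseteq> ?W" "X' \<subseteq> ?L" by (auto simp: X'_def)
      have X'W: "span X' \<subseteq> ?W" using X'V(1) by (simp add: span_minimal)
      have subK: "subspace {w \<in> ?V. c w u = 0}" if "u \<in> ?V" for u
        unfolding subspace_def
      proof (intro conjI ballI allI)
        have "c 0 u = 0" using c_left(2)[of 0 0 0] subspace_0[OF subspace_tspace, of A] by simp
        then show "0 \<in> {w \<in> ?V. c w u = 0}" by (simp add: subspace_0)
      qed (use c_left in \<open>auto simp: subspace_add subspace_scale\<close>)
      have X'orth: "c w u = 0" if "w \<in> span X'" "u \<in> ?U" for w u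
      proof -
        have "X' \<subseteq> {w \<in> ?V. c w u = 0}"
          using orth[OF _ _ that(2)] LV by (auto simp: X'_def)
        then have "span X' \<subseteq> {w \<in> ?V. c w u = 0}" using subK UV that(2) by (intro span_minimal) auto
        then show ?thesis using that(1) by blast
      qed
      have X'J: "?J ` span X' \<subseteq> span X'"
      proof
        fix v assume "v \<in> ?J ` span X'"
        then obtain w where w: "w \<in> span X'" "v = ?J w" by blast
        have wV: "w \<in> ?V" using w X'W WV by blast
        show "v \<in> span X'"
        proof (rule X'mem)
          show "v \<in> ?W" using w X'W less.prems(2) by blast
          fix b assume b: "b \<in> B"
          then have bV: "b \<in> ?V" and bU: "b \<in> ?U" using BL LV spB span_base by blast+
          have "c (?J w) b = c (?J (?J w)) (?J b)" using cJ[of "?J w" b] J(2) wV bV by simp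
          also have "\<dots> = c ((-1) *\<^sub>R w) (?J b)" using J(3)[OF wV] by simp
          also have "\<dots> = - c w (?J b)" using c_left(2)[OF wV wV, of "-1"] by simp
          also have "\<dots> = 0" using X'orth[OF w(1), of "?J b"] bU 3(3) by auto
          finally show "c v b = 0" by (simp add: w(2))
        qed
      qed
      have "span X' \<noteq> ?W"
      proof
        assume *: "span X' = ?W"
        obtain u where u: "u \<in> ?U" "u \<noteq> 0" using 3(4) span_zero[of Y] by blast
        then have "u \<in> span X'" "?J u \<in> ?U" using * 3(2,3) by auto
        then have "c u (?J u) = 0" by (rule X'orth)
        then show False using cpos[of u] u UV by auto
      qed
      then have dX': "dim X' < dim X"
        using dim_strict_mono[of "span X'" ?W E] X'W WE E(1) by auto
      have dY: "dim Y < dim X"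
        using dim_strict_mono[of "span Y" ?W E] 3(2) WE E(1) by auto
      obtain \<S>1 where S1: "finite \<S>1" "\<forall>S\<in>\<S>1. simple_torus S \<and> lattice S \<subseteq> ?L \<and> cstruct S = ?J"
          "Y \<subseteq> span (\<Union>S\<in>\<S>1. lattice S)"
        using less.hyps[OF dY 3(1,3)] by blast
      obtain \<S>2 where S2: "finite \<S>2" "\<forall>S\<in>\<S>2. simple_torus S \<and> lattice S \<subseteq> ?L \<and> cstruct S = ?J"
          "X' \<subseteq> span (\<Union>S\<in>\<S>2. lattice S)"
        using less.hyps[OF dX' X'V(2) X'J] by blast
      let ?SS = "span (\<Union>S\<in>\<S>1 \<union> \<S>2. lattice S)"
      have "span Y \<subseteq> ?SS" "span X' \<subseteq> ?SS"
        using S1(3) S2(3) span_mono[of "\<Union>S\<in>\<S>1. lattice S" "\<Union>S\<in>\<S>1 \<union> \<S>2. lattice S"]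
          span_mono[of "\<Union>S\<in>\<S>2. lattice S" "\<Union>S\<in>\<S>1 \<union> \<S>2. lattice S"]
        by (intro span_minimal; auto)+
      moreover have decomp: "\<exists>u\<in>span Y. w - u \<in> span X'" if w: "w \<in> ?W" for w
      proof -
        \<comment> \<open>The projection of \<open>w\<close> to \<open>U\<close> exists because \<open>c\<close> is nondegenerate on \<open>U\<close>.\<close>
        define r where "r v = (\<lambda>u. if u \<in> ?U then c v u else 0)" for v
        have rd: "r v \<in> dual_space ?U" if "v \<in> ?V" for v
          unfolding dual_space_def lin_hom_def linear_on_space_def r_def
          using c_right'[OF that] UV by (auto simp: span_add span_scale subset_iff)
        have "r ` ?U = dual_space ?U"
        proof (rule nondegenerate_surj[OF _ E(1) subspace_span])
          show "?U \<subseteq> span E" using UV VE by simp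
          show "linear_on_space ?U r"
            unfolding linear_on_space_def r_def using c_left UV by (auto simp: fun_eq_iff subset_iff)
          show "r ` ?U \<subseteq> dual_space ?U" using rd UV by blast
          fix u assume u: "u \<in> ?U" "r u = 0"
          have "?J u \<in> ?U" using u(1) 3(3) by blast
          then have "c u (?J u) = 0" using fun_cong[OF u(2), of "?J u"] by (simp add: r_def)
          then show "u = 0" using cpos[of u] u UV by auto
        qed
        then obtain u where u: "u \<in> ?U" "r u = r w" using rd[of w] w WV by (metis imageE subset_iff)
        have "w - u \<in> span X'"
        proof (rule X'mem)
          show "w - u \<in> ?W" using w u 3(2) by (auto intro: span_diff)
          fix b assume "b \<in> B"
          then have "b \<in> ?U" using spB span_base by blast
          then have "c u b = c w b" using fun_cong[OF u(2), of b] by (simp add: r_def)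
          moreover have "w \<in> ?V" "u \<in> ?V" using w u UV WV by auto
          ultimately show "c (w - u) b = 0" using c_left'[of w u b] by simp
        qed
        then show ?thesis using u by blast
      qed
      ultimately have W_SS: "w \<in> ?SS" if "w \<in> ?W" for w
      proof -
        obtain u where "u \<in> span Y" "w - u \<in> span X'"
          using decomp[OF \<open>w \<in> ?W\<close>] by blast
        then have "u \<in> ?SS" "w - u \<in> ?SS"
          using \<open>span Y \<subseteq> ?SS\<close> \<open>span X' \<subseteq> ?SS\<close> by auto
        then show "w \<in> ?SS" using span_add[of u _ "w - u"] by simp
      qed
      have "X \<subseteq> ?SS" using W_SS span_superset[of X] by blast
      then show ?thesis using S1 S2 by (intro exI[of _ "\<S>1 \<union> \<S>2"]) auto
    qed
  qed
  have "?J ` span ?L \<subseteq> span ?L" using J(2) by (auto simp: tspace_def)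
  from claim[OF order_refl this] obtain \<S> where "finite \<S>"
      "\<forall>S\<in>\<S>. simple_torus S \<and> lattice S \<subseteq> ?L \<and> cstruct S = ?J"
      "?L \<subseteq> span (\<Union>S\<in>\<S>. lattice S)"
    by blast
  then show ?thesis using that by blast
qed

section \<open>Homomorphisms\<close>

text \<open>
  Homomorphisms are encoded as functions that vanish outside the domain, so that they form a subgroup of
  a real vector space of functions; the approximation argument works in the real span of this subgroup.
\<close>

definition torus_hom :: "'a::real_vector torus \<Rightarrow> 'b::real_vector torus \<Rightarrow> ('a \<Rightarrow> 'b) set"
  where "torus_hom A B = {f \<in> lin_hom (tspace A) (tspace B).
    f ` lattice A \<subseteq> lattice B \<and> (\<forall>v\<in>tspace A. f (cstruct A v) = cstruct B (f v))}"

lemma lin_hom_extend: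
  assumes "subspace V" "f \<in> lin_hom V W"
  obtains g where "linear g" "\<And>v. v \<in> V \<Longrightarrow> g v = f v"
  using assms linear_on_space_extend[of V f] unfolding lin_hom_def by blast

lemma lin_hom_sum:
  assumes "subspace V" "f \<in> lin_hom V W" "\<And>i. i \<in> I \<Longrightarrow> a i \<in> V"
  shows "f (\<Sum>i\<in>I. c i *\<^sub>R a i) = (\<Sum>i\<in>I. c i *\<^sub>R f (a i))"
proof -
  obtain g where g: "linear g" "\<And>v. v \<in> V \<Longrightarrow> g v = f v"
    using lin_hom_extend[OF assms(1,2)] by blast
  have "(\<Sum>i\<in>I. c i *\<^sub>R a i) \<in> V"
    using assms(1,3) by (intro subspace_sum subspace_scale)
  then have "f (\<Sum>i\<in>I. c i *\<^sub>R a i) = g (\<Sum>i\<in>I. c i *\<^sub>R a i)" using g(2) by simp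
  also have "\<dots> = (\<Sum>i\<in>I. c i *\<^sub>R f (a i))"
    using g(2) assms(3) by (simp add: linear_sum[OF g(1)] linear_scale[OF g(1)])
  finally show ?thesis .
qed

lemma lin_hom_mem: "f \<in> lin_hom V W \<Longrightarrow> v \<in> V \<Longrightarrow> f v \<in> W"
  and lin_hom_outside: "f \<in> lin_hom V W \<Longrightarrow> v \<notin> V \<Longrightarrow> f v = 0"
  and lin_hom_add: "f \<in> lin_hom V W \<Longrightarrow> v \<in> V \<Longrightarrow> w \<in> V \<Longrightarrow> f (v + w) = f v + f w"
  and lin_hom_scale: "f \<in> lin_hom V W \<Longrightarrow> v \<in> V \<Longrightarrow> f (r *\<^sub>R v) = r *\<^sub>R f v"
  by (auto simp: lin_hom_def linear_on_space_def)

lemma lin_hom_zero: "f \<in> lin_hom V W \<Longrightarrow> subspace V \<Longrightarrow> f 0 = 0"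
  using lin_hom_scale[of f V W 0 0] by (simp add: subspace_0)

lemma lin_hom_diff:
  "f \<in> lin_hom V W \<Longrightarrow> subspace V \<Longrightarrow> v \<in> V \<Longrightarrow> w \<in> V \<Longrightarrow> f (v - w) = f v - f w"
  using lin_hom_add[of f V W v "(-1) *\<^sub>R w"] lin_hom_scale[of f V W w "-1"]
  by (simp add: subspace_neg)

lemma torus_hom_lin_hom: "f \<in> torus_hom A B \<Longrightarrow> f \<in> lin_hom (tspace A) (tspace B)"
  and torus_hom_lattice: "f \<in> torus_hom A B \<Longrightarrow> v \<in> lattice A \<Longrightarrow> f v \<in> lattice B"
  and torus_hom_cstruct:
    "f \<in> torus_hom A B \<Longrightarrow> v \<in> tspace A \<Longrightarrow> f (cstruct A v) = cstruct B (f v)"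
  by (auto simp: torus_hom_def)

lemma cstruct_lin:
  assumes "complex_torus A" "v \<in> tspace A" "w \<in> tspace A"
  shows "cstruct A (v - w) = cstruct A v - cstruct A w" "cstruct A (r *\<^sub>R v) = r *\<^sub>R cstruct A v"
    "cstruct A (v + w) = cstruct A v + cstruct A w"
proof -
  obtain g where g: "linear g" "\<And>v. v \<in> tspace A \<Longrightarrow> g v = cstruct A v"
    using assms(1) linear_on_space_extend[of "tspace A" "cstruct A"]
    unfolding complex_torus_def by (metis subspace_tspace)
  show "cstruct A (v - w) = cstruct A v - cstruct A w" "cstruct A (r *\<^sub>R v) = r *\<^sub>R cstruct A v"
    "cstruct A (v + w) = cstruct A v + cstruct A w"
    using assms(2,3) g linear_diff[OF g(1), of v w] linear_scale[OF g(1), of r v] linear_add[OF g(1), of v w]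
    by (simp_all add: g(2)[symmetric] subspace_diff subspace_scale subspace_add del: g(2))
qed

lemma add_subgroup_torus_hom:
  assumes "complex_torus A" "complex_torus B"
  shows "add_subgroup (torus_hom A B)"
  unfolding add_subgroup_def
proof (intro conjI ballI)
  have B: "add_subgroup (lattice B)" using assms lattice_add_subgroup complex_torus_lattice by blast
  have sub: "add_subgroup (lin_hom (tspace A) (tspace B))"
    by (intro add_subgroup_subspace subspace_lin_hom subspace_tspace)
  have "cstruct B 0 = 0" using cstruct_lin(2)[OF assms(2), of 0 0 0] by (simp add: subspace_0)
  then show "0 \<in> torus_hom A B"
    using add_subgroup_zero[OF sub] add_subgroup_zero[OF B] by (auto simp: torus_hom_def)
  fix f g assume fg: "f \<in> torus_hom A B" "g \<in> torus_hom A B"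
  then show "f - g \<in> torus_hom A B"
    using add_subgroup_diff[OF sub, of f g] add_subgroup_diff[OF B] assms
    by (auto simp: torus_hom_def lin_hom_mem cstruct_lin image_subset_iff)
qed

lemma torus_hom_comp:
  assumes f: "f \<in> torus_hom A B" and g: "g \<in> torus_hom B C"
  shows "(\<lambda>v. g (f v)) \<in> torus_hom A C"
proof -
  note fl = torus_hom_lin_hom[OF f] and gl = torus_hom_lin_hom[OF g]
  have "(\<lambda>v. g (f v)) \<in> lin_hom (tspace A) (tspace C)"
    using fl gl lin_hom_zero[OF gl subspace_tspace]
    by (auto simp: lin_hom_def linear_on_space_def image_subset_iff)
  then show ?thesis
    using f g lin_hom_mem[OF fl] by (auto simp: torus_hom_def image_subset_iff)
qed

lemma lin_hom_finite_dim:
  fixes E :: "'a::real_vector set" and F :: "'b::real_vector set"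
  assumes E: "finite E" "independent E" and F: "finite F"
  obtains T where "finite T" "lin_hom (span E) (span F) \<subseteq> span T"
proof
  let ?t = "\<lambda>(e, f). (\<lambda>v. representation E v e *\<^sub>R f)"
  let ?T = "?t ` (E \<times> F)"
  show "finite ?T" using E(1) F by simp
  show "lin_hom (span E) (span F) \<subseteq> span ?T"
  proof
    fix h assume h: "h \<in> lin_hom (span E) (span F)"
    have "\<exists>u. h e = (\<Sum>f\<in>F. u f *\<^sub>R f)" if "e \<in> E" for e
    proof -
      have "h e \<in> span F" using h that by (auto simp: lin_hom_def span_base)
      then show ?thesis using F by (auto simp: span_finite)
    qed
    then obtain u where u: "\<And>e. e \<in> E \<Longrightarrow> h e = (\<Sum>f\<in>F. u e f *\<^sub>R f)" by metis
    have "h = (\<Sum>e\<in>E. \<Sum>f\<in>F. u e f *\<^sub>R ?t (e, f))"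
    proof
      fix v
      show "h v = (\<Sum>e\<in>E. \<Sum>f\<in>F. u e f *\<^sub>R ?t (e, f)) v"
      proof (cases "v \<in> span E")
        case True
        have "h v = h (\<Sum>e\<in>E. representation E v e *\<^sub>R e)"
          using sum_representation_eq[OF E(2) True E(1) order_refl] by simp
        also have "\<dots> = (\<Sum>e\<in>E. representation E v e *\<^sub>R h e)"
          by (rule lin_hom_sum[OF subspace_span h]) (rule span_base)
        also have "\<dots> = (\<Sum>e\<in>E. \<Sum>f\<in>F. u e f *\<^sub>R ?t (e, f)) v"
          by (simp add: u sum_fun_apply scaleR_sum_right mult.commute)
        finally show ?thesis .
      next
        case False
        then have "h v = 0" "\<And>e. representation E v e = 0"
          using h by (auto simp: lin_hom_def representation_def)
        then show ?thesis by (simp add: sum_fun_apply)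
      qed
    qed
    also have "\<dots> \<in> span ?T" by (intro span_sum span_scale span_base) auto
    finally show "h \<in> span ?T" .
  qed
qed

lemma torus_hom_basis:
  assumes "is_lattice (lattice A)" "is_lattice (lattice B)"
  obtains D where "finite D" "D \<subseteq> torus_hom A B" "torus_hom A B \<subseteq> span D"
proof -
  obtain E where E: "finite E" "independent E" "lattice A = zgen E" using lattice_basis[OF assms(1)] .
  obtain F where F: "finite F" "independent F" "lattice B = zgen F" using lattice_basis[OF assms(2)] .
  obtain T where T: "finite T" "lin_hom (span E) (span F) \<subseteq> span T"
    using lin_hom_finite_dim[OF E(1,2) F(1)] .
  obtain D where D: "D \<subseteq> torus_hom A B" "independent D" "torus_hom A B \<subseteq> span D"
    using maximal_independent_subset by blast
  have "D \<subseteq> span T" using D(1) T(2) E(3) F(3) by (auto simp: torus_hom_def tspace_def)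
  then show ?thesis using that D independent_span_bound[OF T(1) D(2)] by blast
qed

text \<open>
  The preimage of a subtorus is a subtorus, so in a simple torus it is zero or everything.
\<close>

lemma simple_hom_dichotomy:
  assumes S: "simple_torus S" and B: "complex_torus B" and g: "g \<in> torus_hom S B"
    and Y: "Y \<subseteq> lattice B" "cstruct B ` span Y \<subseteq> span Y"
  shows "(\<forall>s\<in>tspace S. g s \<in> span Y \<longrightarrow> s = 0) \<or> (\<forall>s\<in>tspace S. g s \<in> span Y)"
proof -
  have cS: "complex_torus S" using S by (simp add: simple_torus_def)
  note gl = torus_hom_lin_hom[OF g]
  obtain g' where g': "linear g'" "\<And>v. v \<in> tspace S \<Longrightarrow> g' v = g v"
    using lin_hom_extend[OF subspace_tspace gl] by blast
  let ?X = "{l \<in> lattice S. g' l \<in> span Y}"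
  have gL: "g' ` lattice S \<subseteq> lattice B"
    using g g'(2) lattice_subset_tspace[of S] by (auto simp: torus_hom_def)
  have 1: "s \<in> span ?X" if "s \<in> tspace S" "g s \<in> span Y" for s
    using that g'(2)[OF that(1)] cS B
    by (intro rational_preimage[OF _ g'(1) gL _ Y(1)])
       (auto simp: tspace_def complex_torus_lattice lattice_add_subgroup)
  have 2: "s \<in> tspace S \<and> g s \<in> span Y" if "s \<in> span ?X" for s
  proof -
    have "span ?X \<subseteq> tspace S \<inter> g' -` span Y"
      using lattice_subset_tspace[of S]
      by (intro span_minimal subspace_inter subspace_tspace linear_subspace_vimage g') auto
    then have "s \<in> tspace S" "g' s \<in> span Y" using that by blast+
    then show ?thesis using g'(2)[of s] by simp
  qed
  have "cstruct S ` span ?X \<subseteq> span ?X"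
  proof
    fix v assume "v \<in> cstruct S ` span ?X"
    then obtain s where s: "s \<in> span ?X" "v = cstruct S s" by blast
    show "v \<in> span ?X"
    proof (rule 1)
      show "v \<in> tspace S" using 2 s cS complex_torus_cstruct by blast
      show "g v \<in> span Y" using 2[OF s(1)] s(2) torus_hom_cstruct[OF g] Y(2) by auto
    qed
  qed
  then have "span ?X = {0} \<or> span ?X = tspace S"
    using S unfolding simple_torus_def by auto
  then show ?thesis using 1 2 by blast
qed

lemma simple_hom_injective:
  assumes S: "simple_torus S" and B: "complex_torus B" and g: "g \<in> torus_hom S B" "g \<noteq> 0"
    and s: "s \<in> tspace S" "g s = 0"
  shows "s = 0"
proof -
  have "cstruct B 0 = 0" using cstruct_lin(2)[OF B, of 0 0 0] by (simp add: subspace_0)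
  then consider "\<forall>s\<in>tspace S. g s = 0 \<longrightarrow> s = 0" | "\<forall>s\<in>tspace S. g s = 0"
    using simple_hom_dichotomy[OF S B g(1), of "{}"] by auto
  then show ?thesis
  proof cases
    case 1 then show ?thesis using s by blast
  next
    case 2
    then have "g = 0" using lin_hom_outside[OF torus_hom_lin_hom[OF g(1)]] by (auto simp: fun_eq_iff)
    then show ?thesis using g(2) by simp
  qed
qed

section \<open>Systems of successive minima\<close>

text \<open>
  The image of the sum of the first \<open>m\<close> homomorphisms on real spans. Presenting it as the span of lattice
  vectors of \<open>B\<close> makes it a rational subspace by construction.
\<close>

definition joint_image ::
    "(nat \<Rightarrow> 'a::real_vector torus) \<Rightarrow> (nat \<Rightarrow> 'a \<Rightarrow> 'b::real_vector) \<Rightarrow> nat \<Rightarrow> 'b set"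
  where "joint_image S x m = span (\<Union>i<m. x i ` lattice (S i))"

text \<open>
  Forces the sum of the homomorphisms to be injective (\<open>jointly_injective\<close>), and is stated in the
  stepwise form in which they are chosen.
\<close>

definition jointly_independent ::
    "(nat \<Rightarrow> 'a::real_vector torus) \<Rightarrow> (nat \<Rightarrow> 'a \<Rightarrow> 'b::real_vector) \<Rightarrow> nat \<Rightarrow> bool"
  where "jointly_independent S x r \<longleftrightarrow>
    (\<forall>i<r. \<forall>s\<in>tspace (S i). x i s \<in> joint_image S x i \<longrightarrow> s = 0)"

text \<open>
  A norm on homomorphisms: \<open>Bs S\<close> is a basis of the lattice of \<open>S\<close>. It is integral on homomorphisms of
  tori, so that shortest ones exist.
\<close>

definition hom_size :: "('b \<Rightarrow> real) \<Rightarrow> ('a torus \<Rightarrow> 'a set) \<Rightarrow> 'a torus \<Rightarrow> ('a \<Rightarrow> 'b) \<Rightarrow> real"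
  where "hom_size nm Bs S y = (\<Sum>s\<in>Bs S. nm (y s))"

text \<open>
  The analogue of Minkowski's successive minima. At every step the source is allowed to vary over the
  whole family \<open>\<S>\<close>, so that homomorphisms from isogenous members of \<open>\<S>\<close> compete with each other.
\<close>

definition minimal_system where
  "minimal_system \<S> B N r S x \<longleftrightarrow>
    (\<forall>m<r. S m \<in> \<S> \<and> x m \<in> torus_hom (S m) B \<and>
       (\<forall>s\<in>tspace (S m). x m s \<in> joint_image S x m \<longrightarrow> s = 0) \<and>
       (\<forall>S'\<in>\<S>. \<forall>y\<in>torus_hom S' B. (\<forall>s\<in>tspace S'. y s \<in> joint_image S x m \<longrightarrow> s = 0) \<longrightarrow>
          (N (S m) (x m) :: real) \<le> N S' y))"

lemma minimal_systemD:
  assumes "minimal_system \<S> B N r S x" "m < r"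
  shows "S m \<in> \<S>" "x m \<in> torus_hom (S m) B"
    "\<And>s. s \<in> tspace (S m) \<Longrightarrow> x m s \<in> joint_image S x m \<Longrightarrow> s = 0"
    "\<And>S' y. S' \<in> \<S> \<Longrightarrow> y \<in> torus_hom S' B \<Longrightarrow>
      (\<And>s. s \<in> tspace S' \<Longrightarrow> y s \<in> joint_image S x m \<Longrightarrow> s = 0) \<Longrightarrow> N (S m) (x m) \<le> N S' y"
proof -
  note * = assms(1)[unfolded minimal_system_def, THEN spec, THEN mp, OF assms(2)]
  show "S m \<in> \<S>" "x m \<in> torus_hom (S m) B" using * by simp_all
  show "\<And>s. s \<in> tspace (S m) \<Longrightarrow> x m s \<in> joint_image S x m \<Longrightarrow> s = 0"
    using * by simp
  show "\<And>S' y. S' \<in> \<S> \<Longrightarrow> y \<in> torus_hom S' B \<Longrightarrow>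
      (\<And>s. s \<in> tspace S' \<Longrightarrow> y s \<in> joint_image S x m \<Longrightarrow> s = 0) \<Longrightarrow> N (S m) (x m) \<le> N S' y"
    using * by simp
qed

lemma jointly_independentD:
  "jointly_independent S x r \<Longrightarrow> i < r \<Longrightarrow> s \<in> tspace (S i) \<Longrightarrow> x i s \<in> joint_image S x i \<Longrightarrow> s = 0"
  unfolding jointly_independent_def by blast

lemma minimal_system_independent:
  "minimal_system \<S> B N r S x \<Longrightarrow> jointly_independent S x r"
  unfolding minimal_system_def jointly_independent_def by simp

lemma joint_image_mono: "m \<le> n \<Longrightarrow> joint_image S x m \<subseteq> joint_image S x n"
  unfolding joint_image_def by (intro span_mono UN_mono) auto

lemma joint_image_cong:
  "(\<And>i. i < m \<Longrightarrow> S i = S' i \<and> x i = x' i) \<Longrightarrow> joint_image S x m = joint_image S' x' m"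
  unfolding joint_image_def by auto

lemma joint_image_mem:
  assumes "\<And>i. i < m \<Longrightarrow> x i \<in> torus_hom (S i) B" "\<And>i. i < m \<Longrightarrow> p i \<in> tspace (S i)"
  shows "(\<Sum>i<m. x i (p i)) \<in> joint_image S x m"
proof -
  have "x i (p i) \<in> joint_image S x m" if im: "i < m" for i
  proof -
    obtain g where g: "linear g" "\<And>v. v \<in> tspace (S i) \<Longrightarrow> g v = x i v"
      using lin_hom_extend[OF subspace_tspace torus_hom_lin_hom[OF assms(1)[OF im]]] by blast
    have "g ` lattice (S i) = x i ` lattice (S i)"
      using g(2) lattice_subset_tspace by (intro image_cong) auto
    then have "x i (p i) \<in> span (x i ` lattice (S i))"
      using assms(2)[OF im] g(2) linear_span_image[OF g(1), of "lattice (S i)"]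
      by (metis imageI tspace_def)
    then show ?thesis unfolding joint_image_def
      using span_mono[of "x i ` lattice (S i)" "\<Union>i<m. x i ` lattice (S i)"] im by blast
  qed
  then show ?thesis unfolding joint_image_def by (intro span_sum) auto
qed

lemma joint_image_rep:
  assumes x: "\<And>i. i < m \<Longrightarrow> x i \<in> torus_hom (S i) B" and u: "u \<in> joint_image S x m"
  obtains p where "\<And>i. i < m \<Longrightarrow> p i \<in> tspace (S i)" "u = (\<Sum>i<m. x i (p i))"
proof -
  let ?U = "{\<Sum>i<m. x i (p i) | p. \<forall>i<m. p i \<in> tspace (S i)}"
  have "subspace ?U"
    unfolding subspace_def
  proof (intro conjI ballI allI)
    have "(\<Sum>i<m. x i 0) = 0"
      using lin_hom_zero[OF torus_hom_lin_hom[OF x]] by (intro sum.neutral) auto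
    then show "0 \<in> ?U" by (auto intro!: exI[of _ "\<lambda>_. 0"] simp: subspace_0)
  next
    fix a b assume "a \<in> ?U" "b \<in> ?U"
    then obtain p q where "a = (\<Sum>i<m. x i (p i))" "b = (\<Sum>i<m. x i (q i))"
      and pq: "\<forall>i<m. p i \<in> tspace (S i)" "\<forall>i<m. q i \<in> tspace (S i)" by auto
    then have "a + b = (\<Sum>i<m. x i (p i + q i))"
      using lin_hom_add[OF torus_hom_lin_hom[OF x]] by (simp add: sum.distrib[symmetric])
    then show "a + b \<in> ?U" using pq
      by (auto intro!: exI[of _ "\<lambda>i. p i + q i"] simp: subspace_add)
  next
    fix r a assume "a \<in> ?U"
    then obtain p where "a = (\<Sum>i<m. x i (p i))" and p: "\<forall>i<m. p i \<in> tspace (S i)" by auto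
    then have "r *\<^sub>R a = (\<Sum>i<m. x i (r *\<^sub>R p i))"
      using lin_hom_scale[OF torus_hom_lin_hom[OF x]] by (simp add: scaleR_sum_right)
    then show "r *\<^sub>R a \<in> ?U" using p
      by (auto intro!: exI[of _ "\<lambda>i. r *\<^sub>R p i"] simp: subspace_scale)
  qed
  moreover have "(\<Union>i<m. x i ` lattice (S i)) \<subseteq> ?U"
  proof clarify
    fix j l assume j: "j < m" "l \<in> lattice (S j)"
    have "(\<Sum>i<m. x i (if i = j then l else 0)) = (\<Sum>i<m. if i = j then x j l else 0)"
      using lin_hom_zero[OF torus_hom_lin_hom[OF x]] by (intro sum.cong) auto
    then have "x j l = (\<Sum>i<m. x i (if i = j then l else 0))" using j(1) by simp
    then show "\<exists>p. x j l = (\<Sum>i<m. x i (p i)) \<and> (\<forall>i<m. p i \<in> tspace (S i))"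
      using j(2) lattice_subset_tspace by (intro exI[of _ "\<lambda>i. if i = j then l else 0"]) (auto simp: subspace_0)
  qed
  ultimately have "joint_image S x m \<subseteq> ?U" unfolding joint_image_def by (intro span_minimal)
  then show ?thesis using u that by blast
qed

lemma joint_image_zgen_rep:
  fixes m :: nat
  assumes x: "\<And>i. i < m \<Longrightarrow> x i \<in> torus_hom (S i) B"
    and L: "\<And>i. i < m \<Longrightarrow> add_subgroup (lattice (S i))"
    and u: "u \<in> zgen (\<Union>i<m. x i ` lattice (S i))"
  obtains p where "\<And>i. i < m \<Longrightarrow> p i \<in> lattice (S i)" "u = (\<Sum>i<m. x i (p i))"
proof -
  let ?U = "{\<Sum>i<m. x i (p i) | p. \<forall>i<m. p i \<in> lattice (S i)}"
  have "add_subgroup ?U"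
    unfolding add_subgroup_def
  proof (intro conjI ballI)
    have "(\<Sum>i<m. x i 0) = 0"
      using lin_hom_zero[OF torus_hom_lin_hom[OF x]] by (intro sum.neutral) auto
    then show "0 \<in> ?U" using L by (auto intro!: exI[of _ "\<lambda>_. 0"] simp: add_subgroup_zero)
  next
    fix a b assume "a \<in> ?U" "b \<in> ?U"
    then obtain p q where "a = (\<Sum>i<m. x i (p i))" "b = (\<Sum>i<m. x i (q i))"
      and pq: "\<forall>i<m. p i \<in> lattice (S i)" "\<forall>i<m. q i \<in> lattice (S i)" by auto
    moreover have "x i (p i - q i) = x i (p i) - x i (q i)" if "i < m" for i
      using lin_hom_diff[OF torus_hom_lin_hom[OF x[OF that]] subspace_tspace] pq that lattice_subset_tspace
      by blast
    ultimately have "a - b = (\<Sum>i<m. x i (p i - q i))"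
      by (simp add: sum_subtractf[symmetric])
    then show "a - b \<in> ?U" using pq L
      by (auto intro!: exI[of _ "\<lambda>i. p i - q i"] simp: add_subgroup_diff)
  qed
  moreover have "(\<Union>i<m. x i ` lattice (S i)) \<subseteq> ?U"
  proof clarify
    fix j l assume j: "j < m" "l \<in> lattice (S j)"
    have "(\<Sum>i<m. x i (if i = j then l else 0)) = (\<Sum>i<m. if i = j then x j l else 0)"
      using lin_hom_zero[OF torus_hom_lin_hom[OF x]] by (intro sum.cong) auto
    then have "x j l = (\<Sum>i<m. x i (if i = j then l else 0))" using j(1) by simp
    then show "\<exists>p. x j l = (\<Sum>i<m. x i (p i)) \<and> (\<forall>i<m. p i \<in> lattice (S i))"
      using j(2) L by (intro exI[of _ "\<lambda>i. if i = j then l else 0"]) (auto simp: add_subgroup_zero)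
  qed
  ultimately have "zgen (\<Union>i<m. x i ` lattice (S i)) \<subseteq> ?U" by (intro zgen_minimal)
  then show ?thesis using u that by blast
qed

lemma jointly_injective:
  assumes x: "\<And>i. i < r \<Longrightarrow> x i \<in> torus_hom (S i) B" and ind: "jointly_independent S x r"
    and p: "\<And>i. i < r \<Longrightarrow> p i \<in> tspace (S i)" "(\<Sum>i<r. x i (p i)) = 0" and "i < r"
  shows "p i = 0"
  using assms
proof (induction r arbitrary: i)
  case 0 then show ?case by simp
next
  case (Suc r)
  have "x r (p r) = - (\<Sum>i<r. x i (p i))"
    using Suc.prems(4) by (simp add: eq_neg_iff_add_eq_0 add.commute)
  also have "\<dots> = (-1) *\<^sub>R (\<Sum>i<r. x i (p i))" by simp
  also have "\<dots> \<in> joint_image S x r"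
    using joint_image_mem[of r x S B p] Suc.prems unfolding joint_image_def by (intro span_scale) auto
  finally have "p r = 0"
    using Suc.prems(3)[of r] by (intro jointly_independentD[OF Suc.prems(2), of r]) simp_all
  moreover have "x r 0 = 0" using lin_hom_zero[OF torus_hom_lin_hom[OF Suc.prems(1)[of r]]] by simp
  ultimately have 0: "(\<Sum>i<r. x i (p i)) = 0" using Suc.prems(4) by simp
  show ?case
  proof (cases "i = r")
    case True then show ?thesis using \<open>p r = 0\<close> by simp
  next
    case False
    then have "i < r" using Suc.prems(5) by simp
    moreover have "jointly_independent S x r" using Suc.prems(2) unfolding jointly_independent_def by (metis less_SucI)
    ultimately show ?thesis using Suc.IH[of i] Suc.prems(1,3) 0 by simp
  qed
qed

lemma joint_cstruct:
  assumes x: "\<And>i. i < m \<Longrightarrow> x i \<in> torus_hom (S i) B" and B: "complex_torus B"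
    and p: "\<And>i. i < m \<Longrightarrow> p i \<in> tspace (S i)"
  shows "cstruct B (\<Sum>i<m. x i (p i)) = (\<Sum>i<m. x i (cstruct (S i) (p i)))"
proof -
  obtain j where j: "linear j" "\<And>v. v \<in> tspace B \<Longrightarrow> j v = cstruct B v"
    using linear_on_space_extend[OF subspace_tspace, of B "cstruct B"] B unfolding complex_torus_def by blast
  have xB: "x i (p i) \<in> tspace B" if "i < m" for i
    using lin_hom_mem[OF torus_hom_lin_hom[OF x]] p that by blast
  have "(\<Sum>i<m. x i (p i)) \<in> tspace B" using xB by (intro subspace_sum) auto
  then have "cstruct B (\<Sum>i<m. x i (p i)) = j (\<Sum>i<m. x i (p i))" using j(2) by simp
  also have "\<dots> = (\<Sum>i<m. x i (cstruct (S i) (p i)))"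
    unfolding linear_sum[OF j(1)] using xB j(2) torus_hom_cstruct[OF x] p
    by (intro sum.cong) auto
  finally show ?thesis .
qed

lemma joint_image_cstruct:
  assumes x: "\<And>i. i < m \<Longrightarrow> x i \<in> torus_hom (S i) B"
    and S: "\<And>i. i < m \<Longrightarrow> complex_torus (S i)" and B: "complex_torus B"
  shows "cstruct B ` joint_image S x m \<subseteq> joint_image S x m"
proof
  fix v assume "v \<in> cstruct B ` joint_image S x m"
  then obtain u where u: "u \<in> joint_image S x m" "v = cstruct B u" by blast
  obtain p where p: "\<And>i. i < m \<Longrightarrow> p i \<in> tspace (S i)" "u = (\<Sum>i<m. x i (p i))"
    using joint_image_rep[OF x u(1)] by blast
  have "v = (\<Sum>i<m. x i (cstruct (S i) (p i)))"
    unfolding u(2) p(2) by (rule joint_cstruct[OF x B p(1)])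
  also have "\<dots> \<in> joint_image S x m"
    using p(1) S complex_torus_cstruct by (intro joint_image_mem[OF x]) auto
  finally show "v \<in> joint_image S x m" .
qed

text \<open>
  The inverse of the isogeny formed by the \<open>x i\<close>, on real spans.
\<close>

lemma joint_coordinates:
  assumes x: "\<And>i. i < r \<Longrightarrow> x i \<in> torus_hom (S i) B"
    and ind: "jointly_independent S x r"
    and full: "joint_image S x r = tspace B"
  obtains k where "linear k" "\<And>v i. v \<in> tspace B \<Longrightarrow> i < r \<Longrightarrow> k v i \<in> tspace (S i)"
    "\<And>v. v \<in> tspace B \<Longrightarrow> (\<Sum>i<r. x i (k v i)) = v"
    "\<And>p i. (\<And>i. i < r \<Longrightarrow> p i \<in> tspace (S i)) \<Longrightarrow> i < r \<Longrightarrow> k (\<Sum>i<r. x i (p i)) i = p i"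
proof -
  let ?P = "{p. \<forall>i. (i < r \<longrightarrow> p i \<in> tspace (S i)) \<and> (\<not> i < r \<longrightarrow> p i = 0)}"
  let ?F = "\<lambda>p. \<Sum>i<r. x i (p i)"
  have P: "subspace ?P"
    by (auto simp: subspace_def[of ?P] subspace_0 subspace_add subspace_scale)
  note xl = torus_hom_lin_hom[OF x]
  have "linear_on_space ?P ?F"
    unfolding linear_on_space_def
    by (auto simp: lin_hom_add[OF xl] lin_hom_scale[OF xl] sum.distrib scaleR_sum_right)
  then obtain f where f: "linear f" "\<And>p. p \<in> ?P \<Longrightarrow> f p = ?F p"
    using linear_on_space_extend[OF P] by blast
  have "inj_on f ?P"
    unfolding linear_injective_on_subspace_0[OF f(1) P]
  proof (intro ballI impI)
    fix p assume p: "p \<in> ?P" "f p = 0"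
    then have "?F p = 0" using f(2) by simp
    have "p i = 0" for i
    proof (cases "i < r")
      case True
      then show ?thesis using p(1) \<open>?F p = 0\<close> by (intro jointly_injective[OF x ind]) auto
    qed (use p(1) in auto)
    then show "p = 0" by auto
  qed
  then obtain k where k: "linear k" "\<forall>p\<in>?P. k (f p) = p"
    using linear_exists_left_inverse_on[OF f(1) P] by blast
  have kF: "k (?F p) = p" if "p \<in> ?P" for p using k(2) f(2) that by auto
  have kB: "k v \<in> ?P \<and> ?F (k v) = v" if v: "v \<in> tspace B" for v
  proof -
    have vU: "v \<in> joint_image S x r" using v full by simp
    then obtain q where q: "\<And>i. i < r \<Longrightarrow> q i \<in> tspace (S i)" "v = ?F q"
      using joint_image_rep[OF x vU] by blast
    let ?q = "\<lambda>i. if i < r then q i else 0"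
    have "?F ?q = v" unfolding q(2) by (intro sum.cong) auto
    moreover have "?q \<in> ?P" using q(1) by simp
    ultimately show ?thesis using kF[of ?q] by simp
  qed
  show ?thesis
  proof (rule that[OF k(1)])
    show "k v i \<in> tspace (S i)" if "v \<in> tspace B" "i < r" for v i using kB[OF that(1)] that(2) by simp
    show "?F (k v) = v" if "v \<in> tspace B" for v using kB[OF that] by simp
    show "k (?F p) i = p i" if p: "\<And>i. i < r \<Longrightarrow> p i \<in> tspace (S i)" and "i < r" for p i
    proof -
      let ?p = "\<lambda>i. if i < r then p i else 0"
      have "?F ?p = ?F p" by (intro sum.cong) auto
      moreover have "k (?F ?p) = ?p" using p by (intro kF) simp
      ultimately show ?thesis using that(2) by simp
    qed
  qed
qed

text \<open>
  Each step enlarges the joint image, so a system has at most \<open>n\<close> members and there is one of maximal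
  length. By the dichotomy for simple tori, a homomorphism that cannot be added to it maps into the
  joint image, and the lattice of \<open>B\<close> lies in the span of such images.
\<close>

lemma minimal_system_exists:
  assumes \<S>: "\<And>S. S \<in> \<S> \<Longrightarrow> simple_torus S" and B: "complex_torus B"
    and E: "tspace B \<subseteq> span E" "finite E" "card E \<le> n"
    and gen: "lattice B \<subseteq> span (\<Union>S\<in>\<S>. \<Union>g\<in>torus_hom S B. g ` lattice S)"
    and N: "\<And>S y. S \<in> \<S> \<Longrightarrow> y \<in> torus_hom S B \<Longrightarrow> N S y \<in> \<int> \<and> (0::real) \<le> N S y"
  obtains r S x where "r \<le> n" "minimal_system \<S> B N r S x" "joint_image S x r = tspace B"
proof -
  have UB: "joint_image S x m \<subseteq> tspace B" if ms: "minimal_system \<S> B N r S x" "m \<le> r" for m r S x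
  proof -
    have "x i l \<in> tspace B" if "i < m" "l \<in> lattice (S i)" for i l
      using ms that torus_hom_lattice[of "x i" "S i" B l] lattice_subset_tspace[of B]
      unfolding minimal_system_def by force
    then show ?thesis unfolding joint_image_def by (intro span_minimal) auto
  qed
  have bound: "r \<le> n" if ms: "minimal_system \<S> B N r S x" for r S x
  proof -
    have "m \<le> dim (joint_image S x m)" if "m \<le> r" for m
      using that
    proof (induction m)
      case (Suc m)
      have m: "S m \<in> \<S>" "x m \<in> torus_hom (S m) B"
          "\<And>s. s \<in> tspace (S m) \<Longrightarrow> x m s \<in> joint_image S x m \<Longrightarrow> s = 0"
        using minimal_systemD(1-3)[OF ms Suc_le_lessD[OF Suc.prems]] by blast+
      obtain s where s: "s \<in> tspace (S m)" "s \<noteq> 0"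
        using \<S>[OF m(1)] subspace_0[OF subspace_tspace, of "S m"] unfolding simple_torus_def by blast
      define p where "p i = (if i = m then s else 0)" for i
      have "(\<Sum>i<Suc m. x i (p i)) \<in> joint_image S x (Suc m)"
        using ms Suc.prems s by (intro joint_image_mem[of _ _ _ B]) (auto simp: minimal_system_def p_def subspace_0)
      moreover have "(\<Sum>i<m. x i (p i)) = 0"
      proof (intro sum.neutral ballI)
        fix i assume "i \<in> {..<m}"
        then have "x i \<in> torus_hom (S i) B" "p i = 0" using ms Suc.prems by (auto simp: minimal_system_def p_def)
        then show "x i (p i) = 0" using lin_hom_zero[OF torus_hom_lin_hom] by auto
      qed
      ultimately have "x m s \<in> joint_image S x (Suc m)" by (simp add: p_def)
      moreover have "x m s \<notin> joint_image S x m" using m(3) s by blast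
      ultimately have "joint_image S x m \<subset> joint_image S x (Suc m)"
        using joint_image_mono[of m "Suc m" S x] by auto
      then have "dim (joint_image S x m) < dim (joint_image S x (Suc m))"
        using UB[OF ms Suc.prems] E
        by (intro dim_strict_mono[of _ _ E]) (auto simp: joint_image_def)
      then show ?case using Suc by simp
    qed simp
    from this[of r] have "r \<le> dim (joint_image S x r)" by simp
    also have "\<dots> \<le> card E" using UB[OF ms order_refl] E by (intro dim_le_card) auto
    finally show ?thesis using E(3) by simp
  qed
  have "\<exists>S x. minimal_system \<S> B N 0 S x" by (simp add: minimal_system_def)
  moreover have "\<forall>r. (\<exists>S x. minimal_system \<S> B N r S x) \<longrightarrow> r \<le> n" using bound by blast
  ultimately obtain r where r: "\<exists>S x. minimal_system \<S> B N r S x"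
      "\<And>r'. (\<exists>S x. minimal_system \<S> B N r' S x) \<Longrightarrow> r' \<le> r"
    using Nat.ex_has_greatest_nat[of "\<lambda>r. \<exists>S x. minimal_system \<S> B N r S x" 0 n] by blast
  obtain S x where ms: "minimal_system \<S> B N r S x" using r(1) by blast
  let ?U = "joint_image S x r"
  have hx: "\<And>i. i < r \<Longrightarrow> x i \<in> torus_hom (S i) B" and hS: "\<And>i. i < r \<Longrightarrow> S i \<in> \<S>"
    using ms by (auto simp: minimal_system_def)
  define I where "I = {(S', y). S' \<in> \<S> \<and> y \<in> torus_hom S' B \<and> (\<forall>s\<in>tspace S'. y s \<in> ?U \<longrightarrow> s = 0)}"
  have "I = {}"
  proof (rule ccontr)
    assume "I \<noteq> {}"
    then obtain z0 where "z0 \<in> I" by blast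
    then obtain z where z: "z \<in> I" "\<And>z'. z' \<in> I \<Longrightarrow> nat \<lfloor>N (fst z) (snd z)\<rfloor> \<le> nat \<lfloor>N (fst z') (snd z')\<rfloor>"
      using ex_has_least_nat[of "\<lambda>z. z \<in> I" z0 "\<lambda>z. nat \<lfloor>N (fst z) (snd z)\<rfloor>"] by blast
    have zN: "N (fst z) (snd z) \<le> N (fst z') (snd z')" if z': "z' \<in> I" for z'
    proof -
      have *: "N (fst u) (snd u) \<in> \<int> \<and> 0 \<le> N (fst u) (snd u)" if "u \<in> I" for u
        using N[of "fst u" "snd u"] that by (auto simp only: I_def split_beta mem_Collect_eq)
      obtain a b where "N (fst z) (snd z) = of_int a" "N (fst z') (snd z') = of_int b"
        using *[OF z(1)] *[OF z'] by (metis Ints_cases)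
      then show ?thesis using *[OF z(1)] *[OF z'] z(2)[OF z'] by simp
    qed
    define S' where "S' = S(r := fst z)"
    define x' where "x' = x(r := snd z)"
    have U': "joint_image S' x' m = joint_image S x m" if "m \<le> r" for m
      using that by (intro joint_image_cong) (auto simp: S'_def x'_def)
    have "minimal_system \<S> B N (Suc r) S' x'"
      unfolding minimal_system_def
    proof (intro allI impI)
      fix m assume "m < Suc r"
      show "S' m \<in> \<S> \<and> x' m \<in> torus_hom (S' m) B \<and>
       (\<forall>s\<in>tspace (S' m). x' m s \<in> joint_image S' x' m \<longrightarrow> s = 0) \<and>
       (\<forall>S''\<in>\<S>. \<forall>y\<in>torus_hom S'' B. (\<forall>s\<in>tspace S''. y s \<in> joint_image S' x' m \<longrightarrow> s = 0) \<longrightarrow>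
          N (S' m) (x' m) \<le> N S'' y)"
      proof (cases "m = r")
        case True
        have zI: "fst z \<in> \<S>" "snd z \<in> torus_hom (fst z) B" "\<forall>s\<in>tspace (fst z). snd z s \<in> ?U \<longrightarrow> s = 0"
          using z(1) unfolding I_def by (simp_all add: split_beta)
        moreover have "N (fst z) (snd z) \<le> N S'' y"
          if "S'' \<in> \<S>" "y \<in> torus_hom S'' B" "\<forall>s\<in>tspace S''. y s \<in> ?U \<longrightarrow> s = 0" for S'' y
          using zN[of "(S'', y)"] that by (simp add: I_def)
        ultimately show ?thesis
          unfolding True U'[OF order_refl] by (simp add: S'_def x'_def)
      next
        case False
        then have m: "m < r" using \<open>m < Suc r\<close> by simp
        then have "S' m = S m" "x' m = x m" by (auto simp: S'_def x'_def)
        then show ?thesis using ms m U'[of m] unfolding minimal_system_def by simp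
      qed
    qed
    then have "Suc r \<le> r" using r(2) by blast
    then show False by simp
  qed
  have "g ` lattice S' \<subseteq> ?U" if S': "S' \<in> \<S>" "g \<in> torus_hom S' B" for S' g
  proof -
    let ?Y = "\<Union>i<r. x i ` lattice (S i)"
    have "?Y \<subseteq> lattice B" using hx torus_hom_lattice by blast
    moreover have "complex_torus (S i)" if "i < r" for i
      using \<S>[OF hS[OF that]] by (simp add: simple_torus_def)
    then have "cstruct B ` span ?Y \<subseteq> span ?Y"
      unfolding joint_image_def[symmetric] by (intro joint_image_cstruct[OF hx _ B])
    ultimately have "(\<forall>s\<in>tspace S'. g s \<in> ?U \<longrightarrow> s = 0) \<or> (\<forall>s\<in>tspace S'. g s \<in> ?U)"
      using simple_hom_dichotomy[OF \<S>[OF S'(1)] B S'(2), of ?Y] unfolding joint_image_def by blast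
    moreover have "\<not> (\<forall>s\<in>tspace S'. g s \<in> ?U \<longrightarrow> s = 0)"
      using \<open>I = {}\<close> S' unfolding I_def by blast
    ultimately show ?thesis using lattice_subset_tspace[of S'] by blast
  qed
  then have "span (\<Union>S\<in>\<S>. \<Union>g\<in>torus_hom S B. g ` lattice S) \<subseteq> ?U"
    unfolding joint_image_def by (intro span_minimal subspace_span) blast
  then have "lattice B \<subseteq> ?U" using gen by (rule subset_trans[rotated])
  then have "tspace B \<subseteq> ?U" unfolding tspace_def joint_image_def by (intro span_minimal) auto
  then have "?U = tspace B" using UB[OF ms order_refl] by (rule subset_antisym[rotated])
  then show ?thesis using that[OF bound[OF ms] ms] by simp
qed

section \<open>Bounded denominators\<close>

lemma integral_normD:
  assumes "integral_norm \<Gamma> nm"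
  shows "v \<in> span \<Gamma> \<Longrightarrow> nm (r *\<^sub>R v) = \<bar>r\<bar> * nm v"
    "v \<in> span \<Gamma> \<Longrightarrow> 0 \<le> nm v"
    "v \<in> span \<Gamma> \<Longrightarrow> nm v = 0 \<Longrightarrow> v = 0"
    "v \<in> \<Gamma> \<Longrightarrow> nm v \<in> \<int>"
  using assms by (auto simp: integral_norm_def)

lemma hom_size_sum:
  assumes nm: "integral_norm (lattice B) nm" and I: "finite I"
    and y: "\<And>i s. i \<in> I \<Longrightarrow> s \<in> Bs S \<Longrightarrow> y i s \<in> tspace B"
  shows "hom_size nm Bs S (\<lambda>s. \<Sum>i\<in>I. c i *\<^sub>R y i s) \<le> (\<Sum>i\<in>I. \<bar>c i\<bar> * hom_size nm Bs S (y i))"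
proof -
  have "nm (\<Sum>i\<in>I. c i *\<^sub>R y i s) \<le> (\<Sum>i\<in>I. \<bar>c i\<bar> * nm (y i s))" if s: "s \<in> Bs S" for s
  proof -
    have ys: "y i s \<in> span (lattice B)" if "i \<in> I" for i
      using y[OF that s] by (simp add: tspace_def)
    have "nm (\<Sum>i\<in>I. c i *\<^sub>R y i s) \<le> (\<Sum>i\<in>I. nm (c i *\<^sub>R y i s))"
      using ys by (intro integral_norm_sum[OF nm I] span_scale)
    also have "\<dots> = (\<Sum>i\<in>I. \<bar>c i\<bar> * nm (y i s))"
      using ys by (intro sum.cong refl integral_normD(1)[OF nm])
    finally show ?thesis .
  qed
  then have "hom_size nm Bs S (\<lambda>s. \<Sum>i\<in>I. c i *\<^sub>R y i s) \<le> (\<Sum>s\<in>Bs S. \<Sum>i\<in>I. \<bar>c i\<bar> * nm (y i s))"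
    unfolding hom_size_def by (rule sum_mono)
  also have "\<dots> = (\<Sum>i\<in>I. \<bar>c i\<bar> * hom_size nm Bs S (y i))"
    unfolding hom_size_def sum_distrib_left by (rule sum.swap)
  finally show ?thesis .
qed

lemma hom_size_nonneg:
  assumes "integral_norm (lattice B) nm" "\<And>s. s \<in> Bs S \<Longrightarrow> y s \<in> tspace B"
  shows "0 \<le> hom_size nm Bs S y"
  unfolding hom_size_def using integral_normD(2)[OF assms(1)] assms(2)
  by (intro sum_nonneg) (simp add: tspace_def)

text \<open>
  The operator bound for precomposition. The factor is expressed through the matrix of \<open>e\<close>; it does not
  involve \<open>B\<close>, \<open>nm\<close> or \<open>y\<close>, which is what makes the final denominator uniform.
\<close>

lemma hom_size_comp:
  assumes nm: "integral_norm (lattice B) nm"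
    and S': "finite (Bs S')" "independent (Bs S')" "tspace S' = span (Bs S')"
    and e: "\<And>s. s \<in> Bs S \<Longrightarrow> e s \<in> tspace S'" and y: "y \<in> lin_hom (tspace S') (tspace B)"
  shows "hom_size nm Bs S (\<lambda>s. y (e s))
    \<le> (\<Sum>s\<in>Bs S. \<Sum>s'\<in>Bs S'. \<bar>representation (Bs S') (e s) s'\<bar>) * hom_size nm Bs S' y"
proof -
  let ?R = "\<lambda>s s'. representation (Bs S') (e s) s'"
  have yB: "y s' \<in> span (lattice B)" if "s' \<in> tspace S'" for s'
    using lin_hom_mem[OF y that] by (simp add: tspace_def)
  have BsS': "s' \<in> tspace S'" if "s' \<in> Bs S'" for s' using that S'(3) span_base by blast
  have nn: "0 \<le> nm (y s')" if "s' \<in> Bs S'" for s'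
    by (rule integral_normD(2)[OF nm yB[OF BsS'[OF that]]])
  have "nm (y (e s)) \<le> (\<Sum>s'\<in>Bs S'. \<bar>?R s s'\<bar>) * hom_size nm Bs S' y" if s: "s \<in> Bs S" for s
  proof -
    have es: "e s \<in> span (Bs S')" using e[OF s] S'(3) by simp
    have "y (e s) = y (\<Sum>s'\<in>Bs S'. ?R s s' *\<^sub>R s')"
      using sum_representation_eq[OF S'(2) es S'(1) order_refl] by simp
    also have "\<dots> = (\<Sum>s'\<in>Bs S'. ?R s s' *\<^sub>R y s')"
      by (rule lin_hom_sum[OF subspace_tspace y BsS'])
    also have "nm \<dots> \<le> (\<Sum>s'\<in>Bs S'. nm (?R s s' *\<^sub>R y s'))"
      by (intro integral_norm_sum[OF nm S'(1)] span_scale yB BsS')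
    also have "\<dots> = (\<Sum>s'\<in>Bs S'. \<bar>?R s s'\<bar> * nm (y s'))"
      by (intro sum.cong refl integral_normD(1)[OF nm] yB BsS')
    also have "\<dots> \<le> (\<Sum>s'\<in>Bs S'. \<bar>?R s s'\<bar> * hom_size nm Bs S' y)"
      unfolding hom_size_def using nn S'(1)
      by (intro sum_mono mult_left_mono member_le_sum) auto
    finally show ?thesis by (simp add: sum_distrib_right)
  qed
  then have "hom_size nm Bs S (\<lambda>s. y (e s)) \<le> (\<Sum>s\<in>Bs S. (\<Sum>s'\<in>Bs S'. \<bar>?R s s'\<bar>) * hom_size nm Bs S' y)"
    unfolding hom_size_def[of nm Bs S] by (rule sum_mono)
  then show ?thesis by (simp add: sum_distrib_right)
qed

lemma hom_size_pos:
  assumes nm: "integral_norm (lattice B) nm"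
    and S: "finite (Bs S)" "tspace S = span (Bs S)" "tspace S \<noteq> {0}"
    and y: "y \<in> lin_hom (tspace S) (tspace B)" "\<And>s. s \<in> tspace S \<Longrightarrow> y s = 0 \<Longrightarrow> s = 0"
  shows "0 < hom_size nm Bs S y"
proof -
  have BsS: "s \<in> tspace S" if "s \<in> Bs S" for s using that S(2) span_base by blast
  have yB: "y s \<in> span (lattice B)" if "s \<in> Bs S" for s
    using lin_hom_mem[OF y(1) BsS[OF that]] by (simp add: tspace_def)
  have "\<not> Bs S \<subseteq> {0}"
  proof
    assume "Bs S \<subseteq> {0}"
    then have "span (Bs S) \<subseteq> {0}" by (intro span_minimal) auto
    then show False using S(2,3) span_zero[of "Bs S"] by auto
  qed
  then obtain s where s: "s \<in> Bs S" "s \<noteq> 0" by blast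
  have "y s \<noteq> 0" using y(2)[OF BsS[OF s(1)]] s(2) by blast
  then have "0 < nm (y s)"
    using integral_normD(2,3)[OF nm yB[OF s(1)]] by linarith
  also have "nm (y s) \<le> hom_size nm Bs S y"
    unfolding hom_size_def using integral_normD(2)[OF nm yB] S(1)
    by (intro member_le_sum s) auto
  finally show ?thesis .
qed

text \<open>
  The core of the argument, in the spirit of Hurwitz' proof that class numbers are finite. The
  homomorphism \<open>g\<close> has rational coordinates \<open>d i\<close> with respect to the minimal system. Approximating the
  coefficients of all of them in bases \<open>D\<close> simultaneously up to \<open>1 / M\<close> leaves remainders \<open>\<epsilon> i\<close>, and the
  condition on \<open>M\<close> makes \<open>\<Sum>x\<^sub>i \<circ> \<epsilon>\<^sub>i\<close> shorter than the \<open>x m\<close> of the last nonzero remainder. Minimality of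
  \<open>x m\<close> forces all remainders to vanish. All of \<open>n\<close>, \<open>h\<close>, \<open>C\<close>, \<open>M\<close> are independent of \<open>B\<close>.
\<close>

lemma small_relation:
  fixes \<S> :: "'a::real_vector torus set" and B :: "'b::real_vector torus"
  assumes \<S>: "\<And>S. S \<in> \<S> \<Longrightarrow> simple_torus S"
    and Bs: "\<And>S. S \<in> \<S> \<Longrightarrow> finite (Bs S) \<and> independent (Bs S) \<and> lattice S = zgen (Bs S)"
    and D: "\<And>S S'. S \<in> \<S> \<Longrightarrow> S' \<in> \<S> \<Longrightarrow> finite (D S S') \<and> D S S' \<subseteq> torus_hom S S' \<and>
        torus_hom S S' \<subseteq> span (D S S') \<and> card (D S S') \<le> h"
    and C: "0 \<le> C" "\<And>S S' e. S \<in> \<S> \<Longrightarrow> S' \<in> \<S> \<Longrightarrow> e \<in> D S S' \<Longrightarrow>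
        (\<Sum>s\<in>Bs S. \<Sum>s'\<in>Bs S'. \<bar>representation (Bs S') (e s) s'\<bar>) \<le> C"
    and M: "real (n * h) * C < real M"
    and B: "complex_torus B" and nm: "integral_norm (lattice B) nm"
    and ms: "minimal_system \<S> B (hom_size nm Bs) r S x" and rn: "r \<le> n"
    and full: "joint_image S x r = tspace B"
    and T: "T \<in> \<S>" and g: "g \<in> torus_hom T B"
  obtains t w where "0 < t" "t \<le> int (M ^ (n * h))" "\<And>i. i < r \<Longrightarrow> w i \<in> torus_hom T (S i)"
    "\<And>s. s \<in> tspace T \<Longrightarrow> of_int t *\<^sub>R g s = (\<Sum>i<r. x i (w i s))"
proof -
  have M0: "M > 0" using M C(1) by (metis gr0I le_less_trans of_nat_0 of_nat_0_le_iff mult_nonneg_nonneg less_irrefl)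
  have hS: "S i \<in> \<S>" and hx: "x i \<in> torus_hom (S i) B" if "i < r" for i
    using minimal_systemD[OF ms that] by auto
  have ct: "complex_torus R" if "R \<in> \<S>" for R using \<S>[OF that] by (simp add: simple_torus_def)
  have spBs: "tspace R = span (Bs R)" if "R \<in> \<S>" for R using Bs[OF that] by (simp add: tspace_def)
  have BsR: "s \<in> tspace R" if "R \<in> \<S>" "s \<in> Bs R" for R s using spBs[OF that(1)] that(2) by (simp add: span_base)
  note gl = torus_hom_lin_hom[OF g]
  have xl: "x i \<in> lin_hom (tspace (S i)) (tspace B)" if "i < r" for i
    by (rule torus_hom_lin_hom[OF hx[OF that]])
  obtain k where k: "linear k" "\<And>v i. v \<in> tspace B \<Longrightarrow> i < r \<Longrightarrow> k v i \<in> tspace (S i)"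
    "\<And>v. v \<in> tspace B \<Longrightarrow> (\<Sum>i<r. x i (k v i)) = v"
    "\<And>p i. (\<And>i. i < r \<Longrightarrow> p i \<in> tspace (S i)) \<Longrightarrow> i < r \<Longrightarrow> k (\<Sum>i<r. x i (p i)) i = p i"
    using joint_coordinates[OF hx minimal_system_independent[OF ms] full] by blast
  define d where "d i = (\<lambda>s. k (g s) i)" for i
  have gB: "g s \<in> tspace B" if "s \<in> tspace T" for s by (rule lin_hom_mem[OF gl that])
  have dS: "d i s \<in> tspace (S i)" if "s \<in> tspace T" "i < r" for i s
    using k(2)[OF gB[OF that(1)] that(2)] by (simp add: d_def)
  have g_eq: "g s = (\<Sum>i<r. x i (d i s))" if "s \<in> tspace T" for s
    using k(3)[OF gB[OF that]] by (simp add: d_def)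
  have d_eq: "d i s = q i"
    if "i < r" "\<And>i. i < r \<Longrightarrow> q i \<in> tspace (S i)" "g s = (\<Sum>i<r. x i (q i))" for s i q
    using k(4)[OF that(2,1)] that(3) by (simp add: d_def)
  have dl: "d i \<in> lin_hom (tspace T) (tspace (S i))" if i: "i < r" for i
    unfolding lin_hom_def linear_on_space_def
    using dS[OF _ i] lin_hom_outside[OF gl]
    by (auto simp: d_def lin_hom_add[OF gl] lin_hom_scale[OF gl] linear_add[OF k(1)] linear_scale[OF k(1)]
        linear_0[OF k(1)])
  have dJ: "d i (cstruct T s) = cstruct (S i) (d i s)" if i: "i < r" and s: "s \<in> tspace T" for i s
  proof (rule d_eq[OF i])
    show "cstruct (S i) (d i s) \<in> tspace (S i)" if "i < r" for i
      by (rule complex_torus_cstruct[OF ct[OF hS[OF that]] dS[OF s that]])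
    show "g (cstruct T s) = (\<Sum>i<r. x i (cstruct (S i) (d i s)))"
      unfolding torus_hom_cstruct[OF g s] g_eq[OF s] by (rule joint_cstruct[OF hx B dS[OF s]])
  qed
  let ?Y = "\<Union>i<r. x i ` lattice (S i)"
  have YB: "?Y \<subseteq> lattice B" using hx torus_hom_lattice by blast
  have "lattice B \<subseteq> span ?Y"
    using lattice_subset_tspace[of B] full unfolding joint_image_def by simp
  \<comment> \<open>\<open>Q\<close> depends on \<open>B\<close> without any bound. It only serves to place \<open>d i\<close> in the real span of the
    homomorphisms, and to turn \<open>\<epsilon> i\<close> into a homomorphism, to which simplicity applies.\<close>
  then obtain Q where Q: "(Q::int) > 0" "\<And>v. v \<in> lattice B \<Longrightarrow> of_int Q *\<^sub>R v \<in> zgen ?Y"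
    using clear_denominators[OF complex_torus_lattice[OF B] YB] by blast
  have Qd: "of_int Q *\<^sub>R d i \<in> torus_hom T (S i)" if i: "i < r" for i
  proof -
    have "of_int Q *\<^sub>R d i s \<in> lattice (S i)" if s: "s \<in> lattice T" for s
    proof -
      have sT: "s \<in> tspace T" using s lattice_subset_tspace by blast
      have zg: "of_int Q *\<^sub>R g s \<in> zgen ?Y" by (rule Q(2)[OF torus_hom_lattice[OF g s]])
      have ag: "add_subgroup (lattice (S i))" if "i < r" for i
        by (rule lattice_add_subgroup[OF complex_torus_lattice[OF ct[OF hS[OF that]]]])
      obtain q where q: "\<And>i. i < r \<Longrightarrow> q i \<in> lattice (S i)" "of_int Q *\<^sub>R g s = (\<Sum>i<r. x i (q i))"
        using joint_image_zgen_rep[OF hx ag zg] by blast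
      have qT: "q i \<in> tspace (S i)" if "i < r" for i using q(1)[OF that] lattice_subset_tspace by blast
      have "d i (of_int Q *\<^sub>R s) = q i"
        by (rule d_eq[OF i qT]) (simp_all add: lin_hom_scale[OF gl sT] q(2))
      moreover have "d i (of_int Q *\<^sub>R s) = of_int Q *\<^sub>R d i s"
        by (rule lin_hom_scale[OF dl[OF i] sT])
      ultimately show ?thesis using q(1)[OF i] by simp
    qed
    moreover have "of_int Q *\<^sub>R d i \<in> lin_hom (tspace T) (tspace (S i))"
      using dl[OF i] subspace_lin_hom[OF subspace_tspace, of "tspace T" "S i"] by (simp add: subspace_scale)
    moreover have "of_int Q *\<^sub>R d i (cstruct T s) = cstruct (S i) (of_int Q *\<^sub>R d i s)" if s: "s \<in> tspace T" for s
      using dJ[OF i s] cstruct_lin(2)[OF ct[OF hS[OF i]] lin_hom_mem[OF dl[OF i] s] lin_hom_mem[OF dl[OF i] s]]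
      by simp
    ultimately show ?thesis by (auto simp: torus_hom_def)
  qed
  have "\<exists>\<theta>. d i = (\<Sum>e\<in>D T (S i). \<theta> e *\<^sub>R e)" if i: "i < r" for i
  proof -
    have "of_int Q *\<^sub>R d i \<in> span (D T (S i))" using Qd[OF i] D[OF T hS[OF i]] by blast
    from span_scale[OF this, of "1 / of_int Q"] have "d i \<in> span (D T (S i))" using Q(1) by simp
    then show ?thesis using D[OF T hS[OF i]] span_finite[of "D T (S i)"] by auto
  qed
  then obtain \<theta> where \<theta>: "\<And>i. i < r \<Longrightarrow> d i = (\<Sum>e\<in>D T (S i). \<theta> i e *\<^sub>R e)" by metis
  define I where "I = Sigma {..<r} (\<lambda>i. D T (S i))"
  have fD: "finite (D T (S i))" "D T (S i) \<subseteq> torus_hom T (S i)" "card (D T (S i)) \<le> h" if "i < r" for i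
    using D[OF T hS[OF that]] by auto
  have fI: "finite I" unfolding I_def using fD by (intro finite_SigmaI) auto
  have "card I = (\<Sum>i<r. card (D T (S i)))" unfolding I_def using fD by (intro card_SigmaI) auto
  also have "\<dots> \<le> (\<Sum>i<r. h)" using fD by (intro sum_mono) auto
  also have "\<dots> \<le> n * h" using rn by simp
  finally have cI: "card I \<le> n * h" .
  obtain t P where tP: "0 < t" "t \<le> int (M ^ card I)"
    "\<And>u. u \<in> I \<Longrightarrow> \<bar>of_int t * \<theta> (fst u) (snd u) - of_int (P u)\<bar> < 1 / M"
    using Dirichlet_approx_finite[OF fI M0, of "\<lambda>u. \<theta> (fst u) (snd u)"] by metis
  define \<eta> where "\<eta> i e = of_int t * \<theta> i e - of_int (P (i, e))" for i e
  have \<eta>: "\<bar>\<eta> i e\<bar> \<le> 1 / M" if "i < r" "e \<in> D T (S i)" for i e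
    using tP(3)[of "(i, e)"] that unfolding I_def \<eta>_def by simp
  define w where "w i = (\<Sum>e\<in>D T (S i). of_int (P (i, e)) *\<^sub>R e)" for i
  have w: "w i \<in> torus_hom T (S i)" if i: "i < r" for i
    unfolding w_def using fD(2)[OF i] add_subgroup_torus_hom[OF ct[OF T] ct[OF hS[OF i]]]
    by (intro add_subgroup_sum add_subgroup_scale) auto
  define \<epsilon> where "\<epsilon> i = of_int t *\<^sub>R d i - w i" for i
  have \<epsilon>_eq: "\<epsilon> i = (\<Sum>e\<in>D T (S i). \<eta> i e *\<^sub>R e)" if i: "i < r" for i
    unfolding \<epsilon>_def \<eta>_def w_def \<theta>[OF i]
    by (simp add: scaleR_sum_right sum_subtractf scaleR_left_diff_distrib)
  have Q\<epsilon>: "of_int Q *\<^sub>R \<epsilon> i \<in> torus_hom T (S i)" if i: "i < r" for i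
  proof -
    note ag = add_subgroup_torus_hom[OF ct[OF T] ct[OF hS[OF i]]]
    have "of_int Q *\<^sub>R \<epsilon> i = of_int t *\<^sub>R (of_int Q *\<^sub>R d i) - of_int Q *\<^sub>R w i"
      by (simp add: \<epsilon>_def scaleR_right_diff_distrib mult.commute)
    also have "\<dots> \<in> torus_hom T (S i)"
      using add_subgroup_diff[OF ag add_subgroup_scale[OF ag Qd[OF i]] add_subgroup_scale[OF ag w[OF i]]] .
    finally show ?thesis .
  qed
  define y where "y = of_int t *\<^sub>R g - (\<Sum>i<r. (\<lambda>s. x i (w i s)))"
  have y: "y \<in> torus_hom T B"
    unfolding y_def using add_subgroup_torus_hom[OF ct[OF T] B] g torus_hom_comp[OF w hx]
    by (intro add_subgroup_diff add_subgroup_sum add_subgroup_scale) auto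
  have \<epsilon>S: "\<epsilon> i s \<in> tspace (S i)" if "i < r" "s \<in> tspace T" for i s
    using lin_hom_mem[OF dl[OF that(1)] that(2)] lin_hom_mem[OF torus_hom_lin_hom[OF w[OF that(1)]] that(2)]
    by (simp add: \<epsilon>_def subspace_diff subspace_scale)
  have y_eq: "y s = (\<Sum>i<r. x i (\<epsilon> i s))" if s: "s \<in> tspace T" for s
  proof -
    have "x i (\<epsilon> i s) = of_int t *\<^sub>R x i (d i s) - x i (w i s)" if i: "i < r" for i
    proof -
      have ws: "w i s \<in> tspace (S i)" by (rule lin_hom_mem[OF torus_hom_lin_hom[OF w[OF i]] s])
      have "x i (\<epsilon> i s) = x i (of_int t *\<^sub>R d i s - w i s)" by (simp add: \<epsilon>_def)
      also have "\<dots> = x i (of_int t *\<^sub>R d i s) - x i (w i s)"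
        using dS[OF s i] ws by (intro lin_hom_diff[OF xl[OF i] subspace_tspace]) (simp_all add: subspace_scale)
      finally show ?thesis by (simp add: lin_hom_scale[OF xl[OF i] dS[OF s i]])
    qed
    then have "(\<Sum>i<r. x i (\<epsilon> i s)) = (\<Sum>i<r. of_int t *\<^sub>R x i (d i s) - x i (w i s))" by simp
    then show ?thesis
      by (simp add: y_def sum_fun_apply g_eq[OF s] sum_subtractf scaleR_sum_right)
  qed
  have zero: "\<epsilon> i = 0" if "i < r" for i
  proof (rule ccontr)
    assume "\<epsilon> i \<noteq> 0"
    define m where "m = (GREATEST i. i < r \<and> \<epsilon> i \<noteq> 0)"
    have m: "m < r" "\<epsilon> m \<noteq> 0"
      using GreatestI_nat[of "\<lambda>i. i < r \<and> \<epsilon> i \<noteq> 0" i r] that \<open>\<epsilon> i \<noteq> 0\<close> unfolding m_def by auto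
    have above: "\<epsilon> j = 0" if "m < j" "j < r" for j
      using Greatest_le_nat[of "\<lambda>i. i < r \<and> \<epsilon> i \<noteq> 0" j r] that unfolding m_def by force
    have y_eq': "y s = (\<Sum>i<Suc m. x i (\<epsilon> i s))" if s: "s \<in> tspace T" for s
      unfolding y_eq[OF s]
    proof (rule sum.mono_neutral_right)
      show "\<forall>i\<in>{..<r} - {..<Suc m}. x i (\<epsilon> i s) = 0"
      proof
        fix i assume "i \<in> {..<r} - {..<Suc m}"
        then have "i < r" "\<epsilon> i = 0" using above by auto
        then show "x i (\<epsilon> i s) = 0" using lin_hom_zero[OF xl subspace_tspace] by simp
      qed
    qed (use m in auto)
    have inj: "s = 0" if s: "s \<in> tspace T" "\<epsilon> m s = 0" for s
    proof (rule simple_hom_injective[OF \<S>[OF T] ct[OF hS[OF m(1)]] Q\<epsilon>[OF m(1)] _ s(1)])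
      show "of_int Q *\<^sub>R \<epsilon> m \<noteq> 0" using m(2) Q(1) by simp
      show "(of_int Q *\<^sub>R \<epsilon> m) s = 0" using s(2) by simp
    qed
    have yind: "s = 0" if s: "s \<in> tspace T" "y s \<in> joint_image S x m" for s
    proof -
      have "(\<Sum>i<m. x i (\<epsilon> i s)) \<in> joint_image S x m"
        using m(1) \<epsilon>S s(1) hx by (intro joint_image_mem[where B = B]) auto
      then have "x m (\<epsilon> m s) \<in> joint_image S x m"
        using s(2) span_diff[of "y s" _ "\<Sum>i<m. x i (\<epsilon> i s)"] unfolding y_eq'[OF s(1)] joint_image_def by simp
      then have "\<epsilon> m s = 0" using minimal_systemD(3)[OF ms m(1)] \<epsilon>S[OF m(1) s(1)] by blast
      then show ?thesis by (rule inj[OF s(1)])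
    qed
    let ?N = "hom_size nm Bs"
    let ?c = "?N (S m) (x m)"
    have le: "?c \<le> ?N T y" by (rule minimal_systemD(4)[OF ms m(1) T y yind])
    \<comment> \<open>\<open>x m\<close> is independent of fewer predecessors as well, so it was a competitor of \<open>x i\<close>.\<close>
    have xle: "?N (S i) (x i) \<le> ?c" if "i \<le> m" for i
    proof (rule minimal_systemD(4)[OF ms _ hS[OF m(1)] hx[OF m(1)]])
      show "i < r" using that m(1) by simp
      show "s = 0" if "s \<in> tspace (S m)" "x m s \<in> joint_image S x i" for s
        using minimal_systemD(3)[OF ms m(1) that(1)] that(2) joint_image_mono[OF \<open>i \<le> m\<close>] by blast
    qed
    have cpos: "0 < ?c"
    proof (rule hom_size_pos[where Bs = Bs and S = "S m", OF nm _ spBs[OF hS[OF m(1)]] _ xl[OF m(1)]])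
      show "finite (Bs (S m))" using Bs[OF hS[OF m(1)]] by simp
      show "tspace (S m) \<noteq> {0}" using \<S>[OF hS[OF m(1)]] by (simp add: simple_torus_def)
      show "s = 0" if "s \<in> tspace (S m)" "x m s = 0" for s
        using minimal_systemD(3)[OF ms m(1) that(1)] that(2) by (simp add: joint_image_def span_zero)
    qed
    let ?I = "Sigma {..<Suc m} (\<lambda>i. D T (S i))"
    have fD': "finite (D T (S i))" "D T (S i) \<subseteq> torus_hom T (S i)" "card (D T (S i)) \<le> h"
      if "i < Suc m" for i using fD that m(1) by auto
    have fI': "finite ?I" using fD' by (intro finite_SigmaI) auto
    have "card ?I = (\<Sum>i<Suc m. card (D T (S i)))" using fD' by (intro card_SigmaI) auto
    also have "\<dots> \<le> (\<Sum>i<Suc m. h)" using fD' by (intro sum_mono) auto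
    also have "\<dots> = Suc m * h" by simp
    also have "\<dots> \<le> n * h" using rn m(1) by (intro mult_right_mono) auto
    finally have cI': "card ?I \<le> n * h" .
    have y_eq'': "y s = (\<Sum>u\<in>?I. \<eta> (fst u) (snd u) *\<^sub>R x (fst u) (snd u s))" if s: "s \<in> tspace T" for s
    proof -
      have "x i (\<epsilon> i s) = (\<Sum>e\<in>D T (S i). \<eta> i e *\<^sub>R x i (e s))" if i: "i < Suc m" for i
      proof -
        have ir: "i < r" using i m(1) by simp
        have "e s \<in> tspace (S i)" if "e \<in> D T (S i)" for e
          using lin_hom_mem[OF torus_hom_lin_hom s] fD(2)[OF ir] that by blast
        then have "x i (\<Sum>e\<in>D T (S i). \<eta> i e *\<^sub>R e s) = (\<Sum>e\<in>D T (S i). \<eta> i e *\<^sub>R x i (e s))"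
          by (rule lin_hom_sum[OF subspace_tspace xl[OF ir]])
        then show ?thesis by (simp add: \<epsilon>_eq[OF ir] sum_fun_apply)
      qed
      then have "y s = (\<Sum>i<Suc m. \<Sum>e\<in>D T (S i). \<eta> i e *\<^sub>R x i (e s))"
        unfolding y_eq'[OF s] by (intro sum.cong) auto
      also have "\<dots> = (\<Sum>(i, e)\<in>?I. \<eta> i e *\<^sub>R x i (e s))"
        using fD' by (intro sum.Sigma) auto
      finally show ?thesis by (simp add: split_beta)
    qed
    have "?N T y = ?N T (\<lambda>s. \<Sum>u\<in>?I. \<eta> (fst u) (snd u) *\<^sub>R x (fst u) (snd u s))"
      unfolding hom_size_def using y_eq''[OF BsR[OF T]] by (intro sum.cong) auto
    also have "\<dots> \<le> (\<Sum>u\<in>?I. \<bar>\<eta> (fst u) (snd u)\<bar> * ?N T (\<lambda>s. x (fst u) (snd u s)))"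
    proof (rule hom_size_sum[OF nm fI'])
      fix u s assume u: "u \<in> ?I" and s: "s \<in> Bs T"
      obtain i e where ie: "u = (i, e)" "i < r" "e \<in> D T (S i)" using u m(1) by auto
      have "e \<in> torus_hom T (S i)" using fD(2)[OF ie(2)] ie(3) by blast
      then have "e s \<in> tspace (S i)" by (rule lin_hom_mem[OF torus_hom_lin_hom BsR[OF T s]])
      then show "x (fst u) (snd u s) \<in> tspace B"
        using lin_hom_mem[OF xl[OF ie(2)]] by (simp add: ie(1))
    qed
    also have "\<dots> \<le> (\<Sum>u\<in>?I. 1 / M * (C * ?c))"
    proof (intro sum_mono mult_mono)
      fix u assume u: "u \<in> ?I"
      obtain i e where ie: "u = (i, e)" "i \<le> m" "i < r" "e \<in> D T (S i)"
        using u m(1) by auto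
      show "\<bar>\<eta> (fst u) (snd u)\<bar> \<le> 1 / M" using \<eta>[OF ie(3,4)] by (simp add: ie(1))
      have eS: "e s \<in> tspace (S i)" if "s \<in> Bs T" for s
        using lin_hom_mem[OF torus_hom_lin_hom BsR[OF T that]] fD(2)[OF ie(3)] ie(4) by blast
      have "?N T (\<lambda>s. x i (e s)) \<le> (\<Sum>s\<in>Bs T. \<Sum>s'\<in>Bs (S i). \<bar>representation (Bs (S i)) (e s) s'\<bar>) * ?N (S i) (x i)"
        using Bs[OF hS[OF ie(3)]] spBs[OF hS[OF ie(3)]] eS by (intro hom_size_comp[where Bs = Bs and S' = "S i", OF nm _ _ _ _ xl[OF ie(3)]]) auto
      also have "\<dots> \<le> C * ?c"
      proof (rule mult_mono)
        show "0 \<le> ?N (S i) (x i)"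
          using lin_hom_mem[OF xl[OF ie(3)] BsR[OF hS[OF ie(3)]]] by (intro hom_size_nonneg[OF nm])
      qed (use C(1) C(2)[OF T hS[OF ie(3)] ie(4)] xle[OF ie(2)] in auto)
      finally show "?N T (\<lambda>s. x (fst u) (snd u s)) \<le> C * ?c" by (simp add: ie(1))
      show "0 \<le> ?N T (\<lambda>s. x (fst u) (snd u s))"
        using lin_hom_mem[OF xl[OF ie(3)] eS] by (intro hom_size_nonneg[OF nm]) (simp add: ie(1))
    qed simp
    also have "\<dots> = real (card ?I) * (C * ?c) / M" by simp
    also have "\<dots> \<le> real (n * h) * (C * ?c) / M"
      using cI' C(1) cpos by (intro divide_right_mono mult_right_mono) (auto simp del: of_nat_mult)
    also have "\<dots> = (real (n * h) * C) * ?c / M" by simp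
    also have "\<dots> < real M * ?c / M"
      using M cpos M0 by (intro divide_strict_right_mono mult_strict_right_mono) auto
    also have "\<dots> = ?c" using M0 by simp
    finally show False using le by simp
  qed
  have "of_int t *\<^sub>R g s = (\<Sum>i<r. x i (w i s))" if s: "s \<in> tspace T" for s
  proof -
    have "y s = 0"
      unfolding y_eq[OF s] using zero lin_hom_zero[OF xl subspace_tspace] by (intro sum.neutral) auto
    then show ?thesis by (simp add: y_def sum_fun_apply)
  qed
  moreover have "t \<le> int (M ^ (n * h))"
  proof -
    have "M ^ card I \<le> M ^ (n * h)" using cI M0 by (intro power_increasing) auto
    then have "int (M ^ card I) \<le> int (M ^ (n * h))" by (simp only: of_nat_le_iff)
    with tP(2) show ?thesis by (rule order_trans)
  qed
  ultimately show ?thesis using that tP(1) w by blast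
qed

text \<open>
  A factorial serves as a common multiple of all the multipliers \<open>t\<close> that can occur.
\<close>

lemma bounded_denominator:
  fixes \<S> :: "'a::real_vector torus set"
  assumes fin: "finite \<S>" and \<S>: "\<And>S. S \<in> \<S> \<Longrightarrow> simple_torus S"
    and Bs: "\<And>S. S \<in> \<S> \<Longrightarrow> finite (Bs S) \<and> independent (Bs S) \<and> lattice S = zgen (Bs S)"
  obtains K :: int where "K > 0"
    "\<And>(B :: 'b::real_vector torus) nm r S x T g. \<lbrakk>complex_torus B; integral_norm (lattice B) nm;
      minimal_system \<S> B (hom_size nm Bs) r S x; r \<le> n; joint_image S x r = tspace B;
      T \<in> \<S>; g \<in> torus_hom T B\<rbrakk> \<Longrightarrow>
      \<exists>w. (\<forall>i<r. w i \<in> torus_hom T (S i)) \<and>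
        (\<forall>s\<in>tspace T. of_int K *\<^sub>R g s = (\<Sum>i<r. x i (w i s)))"
proof -
  have ct: "complex_torus R" if "R \<in> \<S>" for R using \<S>[OF that] by (simp add: simple_torus_def)
  have "\<exists>D. finite D \<and> D \<subseteq> torus_hom S S' \<and> torus_hom S S' \<subseteq> span D" if "S \<in> \<S>" "S' \<in> \<S>" for S S'
    using torus_hom_basis[OF complex_torus_lattice[OF ct[OF that(1)]] complex_torus_lattice[OF ct[OF that(2)]]]
    by metis
  then obtain D where D: "\<And>S S'. S \<in> \<S> \<Longrightarrow> S' \<in> \<S> \<Longrightarrow>
      finite (D S S') \<and> D S S' \<subseteq> torus_hom S S' \<and> torus_hom S S' \<subseteq> span (D S S')" by metis
  define h where "h = (\<Sum>S\<in>\<S>. \<Sum>S'\<in>\<S>. card (D S S'))"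
  have h: "card (D S S') \<le> h" if "S \<in> \<S>" "S' \<in> \<S>" for S S'
  proof -
    have "card (D S S') \<le> (\<Sum>S'\<in>\<S>. card (D S S'))" using fin that by (intro member_le_sum) auto
    also have "\<dots> \<le> h" unfolding h_def
      using fin that member_le_sum[of S \<S> "\<lambda>S. \<Sum>S'\<in>\<S>. card (D S S')"] by auto
    finally show ?thesis .
  qed
  define c where "c S S' e = (\<Sum>s\<in>Bs S. \<Sum>s'\<in>Bs S'. \<bar>representation (Bs S') (e s) s'\<bar>)" for S S' and e :: "'a \<Rightarrow> 'a"
  have c0: "0 \<le> c S S' e" for S S' e unfolding c_def by (intro sum_nonneg) auto
  define C where "C = (\<Sum>S\<in>\<S>. \<Sum>S'\<in>\<S>. \<Sum>e\<in>D S S'. c S S' e)"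
  have C0: "0 \<le> C" unfolding C_def by (intro sum_nonneg c0)
  have C: "c S S' e \<le> C" if "S \<in> \<S>" "S' \<in> \<S>" "e \<in> D S S'" for S S' e
  proof -
    have "c S S' e \<le> (\<Sum>e\<in>D S S'. c S S' e)" using D[OF that(1,2)] that c0 by (intro member_le_sum) auto
    also have "\<dots> \<le> (\<Sum>S'\<in>\<S>. \<Sum>e\<in>D S S'. c S S' e)"
      using fin that(2) by (intro member_le_sum[where f = "\<lambda>S'. \<Sum>e\<in>D S S'. c S S' e"] sum_nonneg c0) auto
    also have "\<dots> \<le> C" unfolding C_def
      using fin that(1)
      by (intro member_le_sum[where f = "\<lambda>S. \<Sum>S'\<in>\<S>. \<Sum>e\<in>D S S'. c S S' e"] sum_nonneg c0) auto
    finally show ?thesis .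
  qed
  obtain M :: nat where M: "real (n * h) * C < real M" using reals_Archimedean2 by blast
  define K where "K = (fact (M ^ (n * h)) :: int)"
  show ?thesis
  proof (rule that[of K])
    show "K > 0" by (simp add: K_def)
    fix B :: "'b torus" and nm r S x T g
    assume a: "complex_torus B" "integral_norm (lattice B) nm"
      "minimal_system \<S> B (hom_size nm Bs) r S x" "r \<le> n" "joint_image S x r = tspace B"
      "T \<in> \<S>" "g \<in> torus_hom T B"
    obtain t w where tw: "0 < t" "t \<le> int (M ^ (n * h))" "\<And>i. i < r \<Longrightarrow> w i \<in> torus_hom T (S i)"
      "\<And>s. s \<in> tspace T \<Longrightarrow> of_int t *\<^sub>R g s = (\<Sum>i<r. x i (w i s))"
      using small_relation[where Bs = Bs and D = D and h = h and C = C, OF \<S> Bs _ C0 _ M a] D h C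
      unfolding c_def by blast
    have "nat t \<le> M ^ (n * h)" using tw(2) by (simp add: nat_le_iff)
    then have "nat t dvd fact (M ^ (n * h))" using tw(1) by (intro dvd_fact) auto
    then have "int (nat t) dvd int (fact (M ^ (n * h)))" by (simp only: int_dvd_int_iff)
    then have "t dvd K" using tw(1) by (simp add: K_def)
    then obtain k where k: "K = k * t" by (metis dvdE mult.commute)
    show "\<exists>w. (\<forall>i<r. w i \<in> torus_hom T (S i)) \<and>
        (\<forall>s\<in>tspace T. of_int K *\<^sub>R g s = (\<Sum>i<r. x i (w i s)))"
    proof (intro exI[of _ "\<lambda>i. of_int k *\<^sub>R w i"] conjI allI impI ballI)
      fix i assume i: "i < r"
      have "S i \<in> \<S>" using minimal_systemD(1)[OF a(3) i] .
      then show "of_int k *\<^sub>R w i \<in> torus_hom T (S i)"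
        using add_subgroup_scale[OF add_subgroup_torus_hom tw(3)[OF i]] ct a(6) by blast
    next
      fix s assume s: "s \<in> tspace T"
      have "of_int K *\<^sub>R g s = of_int k *\<^sub>R (of_int t *\<^sub>R g s)" by (simp add: k)
      also have "\<dots> = (\<Sum>i<r. of_int k *\<^sub>R x i (w i s))" unfolding tw(4)[OF s] by (rule scaleR_sum_right)
      also have "\<dots> = (\<Sum>i<r. x i ((of_int k *\<^sub>R w i) s))"
      proof (intro sum.cong refl)
        fix i assume "i \<in> {..<r}"
        then have i: "i < r" by simp
        show "of_int k *\<^sub>R x i (w i s) = x i ((of_int k *\<^sub>R w i) s)"
          using lin_hom_scale[OF torus_hom_lin_hom[OF minimal_systemD(2)[OF a(3) i]]
              lin_hom_mem[OF torus_hom_lin_hom[OF tw(3)[OF i]] s], of "of_int k"]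
          by simp
      qed
      finally show "of_int K *\<^sub>R g s = (\<Sum>i<r. x i ((of_int k *\<^sub>R w i) s))" .
    qed
  qed
qed

section \<open>Finiteness of the lattices between a product and its multiple\<close>

definition lattice_tuples :: "nat \<Rightarrow> (nat \<Rightarrow> 'a::real_vector torus) \<Rightarrow> (nat \<Rightarrow> 'a) set"
  where "lattice_tuples r S = {p. \<forall>i. (i < r \<longrightarrow> p i \<in> lattice (S i)) \<and> (\<not> i < r \<longrightarrow> p i = 0)}"

text \<open>
  \<open>B\<close> is covered by the product of \<open>S 0, \<dots>, S (r - 1)\<close> through an isogeny whose cokernel is killed
  by \<open>K\<close>.
\<close>

definition torus_model ::
    "int \<Rightarrow> 'b::real_vector torus \<Rightarrow> nat \<Rightarrow> (nat \<Rightarrow> 'a::real_vector torus) \<Rightarrow> (nat \<Rightarrow> 'a \<Rightarrow> 'b) \<Rightarrow> bool"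
  where "torus_model K B r S x \<longleftrightarrow>
    (\<forall>i<r. complex_torus (S i) \<and> x i \<in> torus_hom (S i) B) \<and> jointly_independent S x r \<and>
    joint_image S x r = tspace B \<and>
    (\<forall>b\<in>lattice B. \<exists>p\<in>lattice_tuples r S. of_int K *\<^sub>R b = (\<Sum>i<r. x i (p i)))"

text \<open>
  The lattice of \<open>B\<close>, multiplied by \<open>K\<close> and pulled back to the product. This subgroup contains \<open>K\<close> times
  the product lattice and determines \<open>B\<close> up to isomorphism.
\<close>

definition model_fiber where
  "model_fiber K B r S x =
    {p \<in> lattice_tuples r S. \<exists>b\<in>lattice B. of_int K *\<^sub>R b = (\<Sum>i<r. x i (p i))}"

lemma torus_modelD:
  assumes "torus_model K B r S x"
  shows "i < r \<Longrightarrow> complex_torus (S i)" "i < r \<Longrightarrow> x i \<in> torus_hom (S i) B"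
    "jointly_independent S x r"
    "joint_image S x r = tspace B"
    "b \<in> lattice B \<Longrightarrow> \<exists>p\<in>lattice_tuples r S. of_int K *\<^sub>R b = (\<Sum>i<r. x i (p i))"
  using assms unfolding torus_model_def by simp_all

lemma torus_model_transfer:
  assumes m: "torus_model K B r S x" and m': "torus_model K B' r S x'" and K: "K > 0"
    and B: "complex_torus B" and B': "complex_torus B'"
    and fib: "model_fiber K B r S x \<subseteq> model_fiber K B' r S x'"
  obtains h where "linear h" "h ` lattice B \<subseteq> lattice B'"
    "\<And>v. v \<in> tspace B \<Longrightarrow> h (cstruct B v) = cstruct B' (h v)"
    "\<And>p. (\<And>i. i < r \<Longrightarrow> p i \<in> tspace (S i)) \<Longrightarrow> h (\<Sum>i<r. x i (p i)) = (\<Sum>i<r. x' i (p i))"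
proof -
  note hx = torus_modelD(2)[OF m] and hx' = torus_modelD(2)[OF m']
  obtain k where k: "linear k" "\<And>v i. v \<in> tspace B \<Longrightarrow> i < r \<Longrightarrow> k v i \<in> tspace (S i)"
    "\<And>v. v \<in> tspace B \<Longrightarrow> (\<Sum>i<r. x i (k v i)) = v"
    "\<And>p i. (\<And>i. i < r \<Longrightarrow> p i \<in> tspace (S i)) \<Longrightarrow> i < r \<Longrightarrow> k (\<Sum>i<r. x i (p i)) i = p i"
    using joint_coordinates[OF hx torus_modelD(3,4)[OF m]] by blast
  let ?h = "\<lambda>v. \<Sum>i<r. x' i (k v i)"
  have "linear_on_space (tspace B) ?h"
    unfolding linear_on_space_def
    by (auto simp: linear_add[OF k(1)] linear_scale[OF k(1)] k(2) lin_hom_add[OF torus_hom_lin_hom[OF hx']]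
        lin_hom_scale[OF torus_hom_lin_hom[OF hx']] sum.distrib scaleR_sum_right)
  then obtain h where h: "linear h" "\<And>v. v \<in> tspace B \<Longrightarrow> h v = ?h v"
    using linear_on_space_extend[OF subspace_tspace] by blast
  have joint: "(\<Sum>i<r. x i (p i)) \<in> tspace B" if "\<And>i. i < r \<Longrightarrow> p i \<in> tspace (S i)" for p
    unfolding torus_modelD(4)[OF m, symmetric] by (rule joint_image_mem[OF hx that])
  have hp: "h (\<Sum>i<r. x i (p i)) = (\<Sum>i<r. x' i (p i))" if p: "\<And>i. i < r \<Longrightarrow> p i \<in> tspace (S i)" for p
  proof -
    have "k (\<Sum>i<r. x i (p i)) i = p i" if "i < r" for i by (rule k(4)) (use p that in auto)
    moreover have "h (\<Sum>i<r. x i (p i)) = ?h (\<Sum>i<r. x i (p i))" by (rule h(2), rule joint, rule p)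
    ultimately show ?thesis by simp
  qed
  have "h b \<in> lattice B'" if b: "b \<in> lattice B" for b
  proof -
    obtain p where p: "p \<in> lattice_tuples r S" "of_int K *\<^sub>R b = (\<Sum>i<r. x i (p i))"
      using torus_modelD(5)[OF m b] by blast
    then have "p \<in> model_fiber K B r S x" using b by (auto simp: model_fiber_def)
    then obtain b' where b': "b' \<in> lattice B'" "of_int K *\<^sub>R b' = (\<Sum>i<r. x' i (p i))"
      using fib by (auto simp: model_fiber_def)
    have "p i \<in> tspace (S i)" if "i < r" for i
      using p(1) that lattice_subset_tspace[of "S i"] by (auto simp: lattice_tuples_def)
    then have "of_int K *\<^sub>R h b = of_int K *\<^sub>R b'"
      using hp[of p] by (simp add: linear_scale[OF h(1), symmetric] p(2) b'(2))
    then have "h b = b'" using K by simp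
    then show ?thesis using b'(1) by simp
  qed
  moreover have "h (cstruct B v) = cstruct B' (h v)" if v: "v \<in> tspace B" for v
  proof -
    have Jk: "cstruct (S i) (k v i) \<in> tspace (S i)" if "i < r" for i
      by (rule complex_torus_cstruct[OF torus_modelD(1)[OF m that] k(2)[OF v that]])
    have "h (cstruct B v) = h (cstruct B (\<Sum>i<r. x i (k v i)))" using k(3)[OF v] by simp
    also have "\<dots> = h (\<Sum>i<r. x i (cstruct (S i) (k v i)))"
      using joint_cstruct[where p = "k v", OF hx B k(2)[OF v]] by simp
    also have "\<dots> = (\<Sum>i<r. x' i (cstruct (S i) (k v i)))" by (rule hp[OF Jk])
    also have "\<dots> = cstruct B' (\<Sum>i<r. x' i (k v i))"
      using joint_cstruct[where p = "k v", OF hx' B' k(2)[OF v]] by simp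
    finally show ?thesis using h(2)[OF v] by simp
  qed
  ultimately show ?thesis using that[OF h(1)] hp by blast
qed

lemma torus_model_iso:
  assumes m: "torus_model K B r S x" and m': "torus_model K B' r S x'" and K: "K > 0"
    and B: "complex_torus B" and B': "complex_torus B'"
    and fib: "model_fiber K B r S x = model_fiber K B' r S x'"
  shows "torus_iso B B'"
proof -
  obtain h where h: "linear h" "h ` lattice B \<subseteq> lattice B'"
    "\<And>v. v \<in> tspace B \<Longrightarrow> h (cstruct B v) = cstruct B' (h v)"
    "\<And>p. (\<And>i. i < r \<Longrightarrow> p i \<in> tspace (S i)) \<Longrightarrow> h (\<Sum>i<r. x i (p i)) = (\<Sum>i<r. x' i (p i))"
    using torus_model_transfer[OF m m' K B B' equalityD1[OF fib]] by blast
  obtain h' where h': "linear h'" "h' ` lattice B' \<subseteq> lattice B"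
    "\<And>v. v \<in> tspace B' \<Longrightarrow> h' (cstruct B' v) = cstruct B (h' v)"
    "\<And>p. (\<And>i. i < r \<Longrightarrow> p i \<in> tspace (S i)) \<Longrightarrow> h' (\<Sum>i<r. x' i (p i)) = (\<Sum>i<r. x i (p i))"
    using torus_model_transfer[OF m' m K B' B equalityD2[OF fib]] by blast
  have inv: "h' (h v) = v" if "v \<in> lattice B" for v
  proof -
    have vU: "v \<in> joint_image S x r" using that torus_modelD(4)[OF m] lattice_subset_tspace by blast
    then obtain p where "\<And>i. i < r \<Longrightarrow> p i \<in> tspace (S i)" "v = (\<Sum>i<r. x i (p i))"
      using joint_image_rep[OF torus_modelD(2)[OF m] vU] by blast
    then show ?thesis using h(4)[of p] h'(4)[of p] by simp
  qed
  have inv': "h (h' v) = v" if "v \<in> lattice B'" for v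
  proof -
    have vU: "v \<in> joint_image S x' r" using that torus_modelD(4)[OF m'] lattice_subset_tspace by blast
    then obtain p where "\<And>i. i < r \<Longrightarrow> p i \<in> tspace (S i)" "v = (\<Sum>i<r. x' i (p i))"
      using joint_image_rep[OF torus_modelD(2)[OF m'] vU] by blast
    then show ?thesis using h(4)[of p] h'(4)[of p] by simp
  qed
  have "bij_betw h (lattice B) (lattice B')"
    by (rule bij_betw_byWitness[where f' = h']) (use h(2) h'(2) inv inv' in auto)
  then show ?thesis
    unfolding torus_iso_def using h(3) linear_on_space_linear[OF h(1)] by blast
qed

lemma lattice_residues:
  assumes "is_lattice \<Gamma>" and K: "K > (0::int)"
  obtains R where "finite R" "R \<subseteq> \<Gamma>" "\<And>l. l \<in> \<Gamma> \<Longrightarrow> \<exists>\<rho>\<in>R. \<exists>q\<in>\<Gamma>. l = \<rho> + of_int K *\<^sub>R q"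
proof -
  obtain E where E: "finite E" "\<Gamma> = range (\<lambda>k. \<Sum>e\<in>E. of_int (k e) *\<^sub>R e)"
    using assms(1) unfolding is_lattice_def by blast
  let ?f = "\<lambda>k. \<Sum>e\<in>E. of_int (k e) *\<^sub>R e"
  let ?C = "{k. \<forall>e. (e \<in> E \<longrightarrow> k e \<in> {0..<K}) \<and> (e \<notin> E \<longrightarrow> k e = 0)}"
  show ?thesis
  proof (rule that[of "?f ` ?C"])
    show "finite (?f ` ?C)" using E(1) by (intro finite_imageI finite_set_of_finite_funs) auto
    show "?f ` ?C \<subseteq> \<Gamma>" unfolding E(2) by auto
    fix l assume "l \<in> \<Gamma>"
    then obtain k where k: "l = ?f k" unfolding E(2) by blast
    let ?m = "\<lambda>e. if e \<in> E then k e mod K else 0"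
    have "of_int (k e) *\<^sub>R e = of_int (k e mod K) *\<^sub>R e + of_int K *\<^sub>R (of_int (k e div K) *\<^sub>R e)" for e
    proof -
      have "real_of_int (k e) = of_int (k e mod K) + of_int K * of_int (k e div K)"
        by (metis mod_mult_div_eq of_int_add of_int_mult)
      then show ?thesis by (simp add: scaleR_left_distrib)
    qed
    then have "l = (\<Sum>e\<in>E. of_int (k e mod K) *\<^sub>R e) + of_int K *\<^sub>R ?f (\<lambda>e. k e div K)"
      unfolding k by (simp add: sum.distrib scaleR_sum_right)
    also have "(\<Sum>e\<in>E. of_int (k e mod K) *\<^sub>R e) = ?f ?m" by (intro sum.cong) auto
    finally have "l = ?f ?m + of_int K *\<^sub>R ?f (\<lambda>e. k e div K)" .
    moreover have "?f ?m \<in> ?f ` ?C" using K by (intro imageI) auto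
    moreover have "?f (\<lambda>e. k e div K) \<in> \<Gamma>" unfolding E(2) by (rule rangeI)
    ultimately show "\<exists>\<rho>\<in>?f ` ?C. \<exists>q\<in>\<Gamma>. l = \<rho> + of_int K *\<^sub>R q" by blast
  qed
qed

text \<open>
  Because it contains \<open>K\<close> times the product lattice, the subgroup is recovered from the representatives
  of residue classes modulo \<open>K\<close> that belong to it.
\<close>

lemma model_fiber_residues:
  assumes m: "torus_model K B r S x" and B: "complex_torus B"
    and R: "\<And>i. i < r \<Longrightarrow> R (S i) \<subseteq> lattice (S i)"
      "\<And>i l. i < r \<Longrightarrow> l \<in> lattice (S i) \<Longrightarrow> \<exists>\<rho>\<in>R (S i). \<exists>q\<in>lattice (S i). l = \<rho> + of_int K *\<^sub>R q"
  shows "model_fiber K B r S x = {p \<in> lattice_tuples r S. \<exists>\<rho>\<in>lattice_tuples r S. \<exists>q\<in>lattice_tuples r S.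
    (\<forall>i<r. \<rho> i \<in> R (S i)) \<and> \<rho> \<in> model_fiber K B r S x \<and> p = (\<lambda>i. \<rho> i + of_int K *\<^sub>R q i)}"
proof -
  note xl = torus_hom_lin_hom[OF torus_modelD(2)[OF m]]
  have LV: "l \<in> tspace A" if "l \<in> lattice A" for l and A :: "'c::real_vector torus"
    using that lattice_subset_tspace by blast
  have *: "\<rho> \<in> model_fiber K B r S x \<longleftrightarrow> p \<in> model_fiber K B r S x"
    if \<rho>: "\<rho> \<in> lattice_tuples r S" and q: "q \<in> lattice_tuples r S" and p: "p \<in> lattice_tuples r S"
      and eq: "p = (\<lambda>i. \<rho> i + of_int K *\<^sub>R q i)" for p q \<rho>
  proof -
    let ?Q = "\<Sum>i<r. x i (q i)"
    have Q: "?Q \<in> lattice B"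
      using q torus_hom_lattice[OF torus_modelD(2)[OF m]] lattice_add_subgroup[OF complex_torus_lattice[OF B]]
      by (intro add_subgroup_sum) (auto simp: lattice_tuples_def)
    have "x i (p i) = x i (\<rho> i) + of_int K *\<^sub>R x i (q i)" if i: "i < r" for i
    proof -
      have "\<rho> i \<in> tspace (S i)" "q i \<in> tspace (S i)" using \<rho> q i by (auto simp: lattice_tuples_def intro: LV)
      then show ?thesis
        by (simp add: eq lin_hom_add[OF xl[OF i]] lin_hom_scale[OF xl[OF i]] subspace_scale)
    qed
    then have sum: "(\<Sum>i<r. x i (p i)) = (\<Sum>i<r. x i (\<rho> i)) + of_int K *\<^sub>R ?Q"
      by (simp add: sum.distrib scaleR_sum_right)
    note ag = lattice_add_subgroup[OF complex_torus_lattice[OF B]]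
    show ?thesis
    proof
      assume "\<rho> \<in> model_fiber K B r S x"
      then obtain b where "b \<in> lattice B" "of_int K *\<^sub>R b = (\<Sum>i<r. x i (\<rho> i))"
        by (auto simp: model_fiber_def)
      then have "b + ?Q \<in> lattice B" "of_int K *\<^sub>R (b + ?Q) = (\<Sum>i<r. x i (p i))"
        using add_subgroup_add[OF ag _ Q] sum by (auto simp: scaleR_right_distrib)
      then show "p \<in> model_fiber K B r S x" using p unfolding model_fiber_def by blast
    next
      assume "p \<in> model_fiber K B r S x"
      then obtain b where "b \<in> lattice B" "of_int K *\<^sub>R b = (\<Sum>i<r. x i (p i))"
        by (auto simp: model_fiber_def)
      then have "b - ?Q \<in> lattice B" "of_int K *\<^sub>R (b - ?Q) = (\<Sum>i<r. x i (\<rho> i))"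
        using add_subgroup_diff[OF ag _ Q] sum by (auto simp: scaleR_right_diff_distrib)
      then show "\<rho> \<in> model_fiber K B r S x" using \<rho> unfolding model_fiber_def by blast
    qed
  qed
  show ?thesis (is "?L = ?R")
  proof
    show "?R \<subseteq> ?L" using * by blast
    show "?L \<subseteq> ?R"
    proof
      fix p assume p: "p \<in> ?L"
      then have pL: "p \<in> lattice_tuples r S" by (simp add: model_fiber_def)
      have "\<forall>i. \<exists>\<rho> q. if i < r then \<rho> \<in> R (S i) \<and> q \<in> lattice (S i) \<and> p i = \<rho> + of_int K *\<^sub>R q
          else \<rho> = 0 \<and> q = 0"
      proof
        fix i
        show "\<exists>\<rho> q. if i < r then \<rho> \<in> R (S i) \<and> q \<in> lattice (S i) \<and> p i = \<rho> + of_int K *\<^sub>R q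
          else \<rho> = 0 \<and> q = 0"
        proof (cases "i < r")
          case True
          then have "p i \<in> lattice (S i)" using pL by (simp add: lattice_tuples_def)
          then obtain \<rho> q where "\<rho> \<in> R (S i)" "q \<in> lattice (S i)" "p i = \<rho> + of_int K *\<^sub>R q"
            using R(2)[OF True] by blast
          then show ?thesis using True by auto
        qed auto
      qed
      then obtain \<rho> q where \<rho>q: "\<And>i. if i < r then \<rho> i \<in> R (S i) \<and> q i \<in> lattice (S i) \<and> p i = \<rho> i + of_int K *\<^sub>R q i
          else \<rho> i = 0 \<and> q i = 0" by metis
      have 1: "\<rho> i \<in> R (S i)" "q i \<in> lattice (S i)" "p i = \<rho> i + of_int K *\<^sub>R q i" if "i < r" for i
        using \<rho>q[of i] that by simp_all
      have 2: "\<rho> i = 0" "q i = 0" "p i = 0" if "\<not> i < r" for i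
        using \<rho>q[of i] pL that by (simp_all add: lattice_tuples_def)
      have "\<rho> \<in> lattice_tuples r S" "q \<in> lattice_tuples r S"
        using 1(2) subsetD[OF R(1) 1(1)] 2(1,2) by (simp_all add: lattice_tuples_def)
      moreover have "p = (\<lambda>i. \<rho> i + of_int K *\<^sub>R q i)"
      proof
        show "p i = \<rho> i + of_int K *\<^sub>R q i" for i using 1 2 by (cases "i < r") simp_all
      qed
      moreover have "\<forall>i<r. \<rho> i \<in> R (S i)" using 1(1) by blast
      ultimately show "p \<in> ?R" using * p pL by blast
    qed
  qed
qed

lemma torus_iso_class_eq:
  assumes "abelian_variety B" "abelian_variety B'" "torus_iso B B'"
  shows "abelian_variety_iso `` {B} = abelian_variety_iso `` {B'}"
proof -
  have ct: "complex_torus B" "complex_torus B'" using assms by (auto simp: abelian_variety_def)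
  have "torus_iso B' B"
    using torus_iso_sym[OF assms(3)] complex_torus_lattice complex_torus_cstruct lattice_add_subgroup ct by blast
  then have "torus_iso B C \<longleftrightarrow> torus_iso B' C" for C
    using torus_iso_trans assms(3) complex_torus_cstruct ct by blast
  then show ?thesis using assms(1,2) by (auto simp: abelian_variety_iso_def)
qed

text \<open>
  The invariant \<open>?F\<close> records the number of factors, the factors and the residue classes of the fiber;
  it takes finitely many values and determines the isomorphism class.
\<close>

lemma finite_iso_classes:
  fixes X :: "'b::real_vector torus set" and \<S> :: "'a::real_vector torus set"
  assumes \<S>: "finite \<S>" "\<And>S. S \<in> \<S> \<Longrightarrow> complex_torus S" and K: "K > 0"
    and X: "\<And>B. B \<in> X \<Longrightarrow> abelian_variety B"
    and model: "\<And>B. B \<in> X \<Longrightarrow> \<exists>r S x. r \<le> n \<and> (\<forall>i<r. S i \<in> \<S>) \<and> torus_model K B r S x"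
  shows "finite (X // abelian_variety_iso)"
proof -
  have "\<exists>R. finite R \<and> R \<subseteq> lattice S \<and> (\<forall>l\<in>lattice S. \<exists>\<rho>\<in>R. \<exists>q\<in>lattice S. l = \<rho> + of_int K *\<^sub>R q)"
    if "S \<in> \<S>" for S
    using lattice_residues[OF complex_torus_lattice[OF \<S>(2)[OF that]] K] by metis
  then obtain R where R: "\<And>S. S \<in> \<S> \<Longrightarrow> finite (R S) \<and> R S \<subseteq> lattice S \<and>
      (\<forall>l\<in>lattice S. \<exists>\<rho>\<in>R S. \<exists>q\<in>lattice S. l = \<rho> + of_int K *\<^sub>R q)" by metis
  obtain r S x where m: "\<And>B. B \<in> X \<Longrightarrow> r B \<le> n \<and> (\<forall>i<r B. S B i \<in> \<S>) \<and> torus_model K B (r B) (S B) (x B)"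
    using model by metis
  let ?S = "\<lambda>B i. if i < r B then S B i else undefined"
  let ?res = "\<lambda>B. {\<rho> \<in> model_fiber K B (r B) (S B) (x B). \<forall>i<r B. \<rho> i \<in> R (S B i)}"
  let ?F = "\<lambda>B. (r B, ?S B, ?res B)"
  let ?A = "{f :: nat \<Rightarrow> 'a torus. \<forall>i. (i \<in> {..<n} \<longrightarrow> f i \<in> insert undefined \<S>) \<and> (i \<notin> {..<n} \<longrightarrow> f i = undefined)}"
  let ?B = "{f :: nat \<Rightarrow> 'a. \<forall>i. (i \<in> {..<n} \<longrightarrow> f i \<in> insert 0 (\<Union>S\<in>\<S>. R S)) \<and> (i \<notin> {..<n} \<longrightarrow> f i = 0)}"
  have "?F ` X \<subseteq> {..n} \<times> ?A \<times> Pow ?B"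
  proof
    fix z assume "z \<in> ?F ` X"
    then obtain B where B: "B \<in> X" "z = ?F B" by blast
    have mB: "r B \<le> n" "\<And>i. i < r B \<Longrightarrow> S B i \<in> \<S>" using m[OF B(1)] by auto
    have "?S B \<in> ?A" using mB by auto
    moreover have "?res B \<subseteq> ?B"
    proof
      fix \<rho> assume "\<rho> \<in> ?res B"
      then have "\<And>i. i < r B \<Longrightarrow> \<rho> i \<in> R (S B i)" "\<And>i. \<not> i < r B \<Longrightarrow> \<rho> i = 0"
        by (auto simp: model_fiber_def lattice_tuples_def)
      then show "\<rho> \<in> ?B" using mB by (auto intro: classical)
    qed
    ultimately show "z \<in> {..n} \<times> ?A \<times> Pow ?B" using mB(1) B(2) by blast
  qed
  moreover have "finite ({..n} \<times> ?A \<times> Pow ?B)"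
    using \<S>(1) R by (intro finite_cartesian_product finite_Pow_iff[THEN iffD2] finite_set_of_finite_funs) auto
  ultimately have fin: "finite (?F ` X)" by (rule finite_subset)
  have same: "abelian_variety_iso `` {B} = abelian_variety_iso `` {B'}"
    if B: "B \<in> X" "B' \<in> X" and F: "?F B = ?F B'" for B B'
  proof -
    note F' = F[unfolded prod.inject]
    have rr: "r B = r B'" by (rule conjunct1[OF F'])
    have eqS: "?S B = ?S B'" by (rule conjunct1[OF conjunct2[OF F']])
    have res: "?res B = ?res B'" by (rule conjunct2[OF conjunct2[OF F']])
    have SS: "S B i = S B' i" if "i < r B" for i
      using fun_cong[OF eqS, of i] that rr by simp
    have mB: "torus_model K B (r B) (S B) (x B)" and mB': "torus_model K B' (r B') (S B') (x B')"
      and S\<S>: "\<And>i. i < r B \<Longrightarrow> S B i \<in> \<S>"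
      using m B by auto
    have ji: "joint_image (S B') (x B') j = joint_image (S B) (x B') j" if "j \<le> r B" for j
      using SS that by (intro joint_image_cong) auto
    have lt: "lattice_tuples (r B) (S B') = lattice_tuples (r B) (S B)"
      using SS by (auto simp: lattice_tuples_def)
    have jind: "jointly_independent (S B') (x B') (r B) = jointly_independent (S B) (x B') (r B)"
      unfolding jointly_independent_def by (intro all_cong1 imp_cong refl) (simp add: SS ji)
    have mB'': "torus_model K B' (r B) (S B) (x B')"
      using mB' SS unfolding torus_model_def rr[symmetric] lt jind by (simp add: ji)
    have mf: "model_fiber K B' (r B') (S B') (x B') = model_fiber K B' (r B) (S B) (x B')"
      unfolding model_fiber_def rr[symmetric] lt ..
    have res': "{\<rho> \<in> model_fiber K B (r B) (S B) (x B). \<forall>i<r B. \<rho> i \<in> R (S B i)} =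
        {\<rho> \<in> model_fiber K B' (r B) (S B) (x B'). \<forall>i<r B. \<rho> i \<in> R (S B i)}"
      using res SS unfolding mf by (simp add: rr[symmetric] cong: conj_cong)
    have ct: "complex_torus B" "complex_torus B'" using X B by (auto simp: abelian_variety_def)
    have R1: "R (S B i) \<subseteq> lattice (S B i)" if "i < r B" for i using R[OF S\<S>[OF that]] by blast
    have R2: "\<exists>\<rho>\<in>R (S B i). \<exists>q\<in>lattice (S B i). l = \<rho> + of_int K *\<^sub>R q"
      if "i < r B" "l \<in> lattice (S B i)" for i l using R[OF S\<S>[OF that(1)]] that(2) by blast
    let ?M = "model_fiber K B (r B) (S B) (x B)" and ?M' = "model_fiber K B' (r B) (S B) (x B')"
    have mem: "((\<forall>i<r B. \<rho> i \<in> R (S B i)) \<and> \<rho> \<in> ?M \<and> Z) =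
        ((\<forall>i<r B. \<rho> i \<in> R (S B i)) \<and> \<rho> \<in> ?M' \<and> Z)" for \<rho> Z
      using eqset_imp_iff[OF res', of \<rho>] by auto
    note M = model_fiber_residues[where R = R, OF mB ct(1) R1 R2]
    note M' = model_fiber_residues[where R = R, OF mB'' ct(2) R1 R2]
    have "?M = ?M'" by (rule trans[OF M trans[OF _ M'[symmetric]]]) (assumption | intro Collect_cong conj_cong bex_cong refl mem)+
    then have "torus_iso B B'" by (rule torus_model_iso[OF mB mB'' K ct])
    then show ?thesis by (rule torus_iso_class_eq[OF X[OF B(1)] X[OF B(2)]])
  qed
  let ?c = "\<lambda>z. abelian_variety_iso `` {SOME B. B \<in> X \<and> ?F B = z}"
  have "X // abelian_variety_iso \<subseteq> ?c ` ?F ` X"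
  proof
    fix q assume "q \<in> X // abelian_variety_iso"
    then obtain B where B: "B \<in> X" "q = abelian_variety_iso `` {B}" by (auto elim: quotientE)
    let ?B = "SOME B'. B' \<in> X \<and> ?F B' = ?F B"
    have "?B \<in> X \<and> ?F ?B = ?F B" by (rule someI[of _ B]) (use B(1) in simp)
    then have "q = ?c (?F B)" unfolding B(2) using same[of ?B B] B(1) by blast
    then show "q \<in> ?c ` ?F ` X" using B(1) by blast
  qed
  then show ?thesis using fin finite_subset by blast
qed

section \<open>Mirror partners\<close>

lemma restrict_torus_hom:
  assumes f: "linear f" and L: "f ` lattice A \<subseteq> lattice B"
    and J: "\<And>v. v \<in> tspace A \<Longrightarrow> cstruct A v \<in> tspace A"
      "\<And>v. v \<in> tspace A \<Longrightarrow> f (cstruct A v) = cstruct B (f v)"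
  shows "(\<lambda>v. if v \<in> tspace A then f v else 0) \<in> torus_hom A B"
proof -
  have "f ` tspace A \<subseteq> tspace B"
    unfolding tspace_def linear_span_image[OF f, symmetric] using L by (rule span_mono)
  moreover have "f l \<in> lattice B" if "l \<in> lattice A" for l using L that by blast
  ultimately show ?thesis
    using J lattice_subset_tspace[of A]
    by (auto simp: torus_hom_def lin_hom_def linear_on_space_def subspace_add subspace_scale
        linear_add[OF f] linear_scale[OF f])
qed

text \<open>
  The map is the polarization \<open>v \<mapsto> c(v, \<cdot>)\<close>. It commutes with the complex structures because
  \<open>c(J v, u) = c(J J v, J u) = c(v, - J u)\<close>, and it is onto on real spans because \<open>c(v, J v) > 0\<close>.
\<close>

lemma dual_isogeny:
  assumes "abelian_variety A"
  obtains \<phi> k where "linear \<phi>" "\<phi> ` lattice A \<subseteq> lattice (dual_torus A)"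
    "\<And>v. v \<in> tspace A \<Longrightarrow> \<phi> (cstruct A v) = cstruct (dual_torus A) (\<phi> v)"
    "(k::int) > 0" "\<And>w. w \<in> lattice (dual_torus A) \<Longrightarrow> of_int k *\<^sub>R w \<in> \<phi> ` lattice A"
proof -
  let ?V = "tspace A" and ?L = "lattice A" and ?J = "cstruct A"
  obtain c where ct: "complex_torus A" and pol: "polarization A c"
    using assms unfolding abelian_variety_def by blast
  have lat: "is_lattice ?L" by (rule complex_torus_lattice[OF ct])
  have J: "?J v \<in> ?V" "?J (?J v) = - v" if "v \<in> ?V" for v
    using ct that by (auto simp: complex_torus_def)
  have c: "c \<in> lin_hom ?V (dual_space ?V)"
      and cJ: "\<And>v w. v \<in> ?V \<Longrightarrow> w \<in> ?V \<Longrightarrow> c (?J v) (?J w) = c v w"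
      and cint: "\<And>v w. v \<in> ?L \<Longrightarrow> w \<in> ?L \<Longrightarrow> c v w \<in> \<int>"
      and cpos: "\<And>v. v \<in> ?V \<Longrightarrow> v \<noteq> 0 \<Longrightarrow> c v (?J v) > 0"
    using pol unfolding polarization_def neron_severi_def by blast+
  have cd: "c v \<in> lin_hom ?V UNIV" if "v \<in> ?V" for v
    using lin_hom_mem[OF c that] by (simp add: dual_space_def)
  obtain \<phi> where \<phi>: "linear \<phi>" "\<And>v. v \<in> ?V \<Longrightarrow> \<phi> v = c v"
    using lin_hom_extend[OF subspace_tspace c] by blast
  have LV: "l \<in> ?V" if "l \<in> ?L" for l using that lattice_subset_tspace by blast
  have \<phi>L: "\<phi> ` ?L \<subseteq> lattice (dual_torus A)"
  proof
    fix w assume "w \<in> \<phi> ` ?L"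
    then obtain l where l: "l \<in> ?L" "w = c l" using \<phi>(2) LV by auto
    then show "w \<in> lattice (dual_torus A)"
      using cint[OF l(1)] lin_hom_mem[OF c LV[OF l(1)]] by (simp add: dual_torus_def)
  qed
  have \<phi>J: "\<phi> (?J v) = cstruct (dual_torus A) (\<phi> v)" if v: "v \<in> ?V" for v
  proof
    fix u
    show "\<phi> (?J v) u = cstruct (dual_torus A) (\<phi> v) u"
    proof (cases "u \<in> ?V")
      case True
      have "c (?J v) u = c (?J (?J v)) (?J u)" using cJ[OF J(1)[OF v] True] by simp
      also have "\<dots> = c ((-1) *\<^sub>R v) (?J u)" using J(2)[OF v] by simp
      also have "\<dots> = - c v (?J u)" using lin_hom_scale[OF c v, of "-1"] by simp
      also have "\<dots> = c v ((-1) *\<^sub>R ?J u)" using lin_hom_scale[OF cd[OF v] J(1)[OF True], of "-1"] by simp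
      finally show ?thesis using True v J(1)[OF v] by (simp add: \<phi>(2) dual_torus_def)
    next
      case False
      then show ?thesis
        using lin_hom_outside[OF cd[OF J(1)[OF v]] False] v J(1)[OF v] by (simp add: \<phi>(2) dual_torus_def)
    qed
  qed
  obtain E where E: "finite E" "?L = zgen E" using lattice_basis[OF lat] by metis
  have "c ` ?V = dual_space ?V"
  proof (rule nondegenerate_surj[OF _ E(1) subspace_tspace])
    show "?V \<subseteq> span E" by (simp add: tspace_def E(2))
    show "linear_on_space ?V c" "c ` ?V \<subseteq> dual_space ?V" using c by (auto simp: lin_hom_def)
    fix v assume v: "v \<in> ?V" "c v = 0"
    then have "c v (?J v) = 0" by simp
    then show "v = 0" using cpos[OF v(1)] by auto
  qed
  moreover have "c ` ?V = \<phi> ` ?V" using \<phi>(2) by auto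
  ultimately have "dual_space ?V = span (\<phi> ` ?L)"
    using linear_span_image[OF \<phi>(1), of ?L] by (simp add: tspace_def)
  then have "lattice (dual_torus A) \<subseteq> span (\<phi> ` ?L)" by (auto simp: dual_torus_def)
  then obtain k where k: "(k::int) > 0" "\<And>w. w \<in> lattice (dual_torus A) \<Longrightarrow> of_int k *\<^sub>R w \<in> zgen (\<phi> ` ?L)"
    using clear_denominators[OF dual_lattice(1)[OF lat] \<phi>L] by blast
  have "add_subgroup (\<phi> ` ?L)"
    unfolding add_subgroup_def
  proof (intro conjI ballI)
    note ag = lattice_add_subgroup[OF lat]
    show "0 \<in> \<phi> ` ?L" using add_subgroup_zero[OF ag] linear_0[OF \<phi>(1)] by (metis imageI)
    fix a b assume "a \<in> \<phi> ` ?L" "b \<in> \<phi> ` ?L"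
    then obtain l l' where "l \<in> ?L" "l' \<in> ?L" "a = \<phi> l" "b = \<phi> l'" by blast
    then show "a - b \<in> \<phi> ` ?L"
      using add_subgroup_diff[OF ag, of l l'] linear_diff[OF \<phi>(1), of l l'] by (metis imageI)
  qed
  then have "zgen (\<phi> ` ?L) \<subseteq> \<phi> ` ?L" by (intro zgen_minimal order_refl)
  then show ?thesis using that[OF \<phi>(1) \<phi>L \<phi>J k(1)] k(2) by blast
qed

text \<open>
  Let \<open>f\<close> be the isomorphism of the products and \<open>\<phi> : A \<rightarrow> A^\<close> the isogeny of a polarization. The two
  homomorphisms are \<open>pr\<^sub>1 \<circ> f\<close> restricted to \<open>A\<close> and composed with \<open>\<phi>\<close>, respectively. The factor \<open>k\<close> kills
  the cokernel of \<open>\<phi>\<close>, hence depends on \<open>A\<close> only.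
\<close>

lemma partner_generated:
  assumes A: "abelian_variety A"
  obtains k where "(k::int) > 0"
    "\<And>B :: 'b::real_vector torus. complex_torus B \<Longrightarrow>
      torus_iso (prod_torus A (dual_torus A)) (prod_torus B (dual_torus B)) \<Longrightarrow>
      \<exists>l1\<in>torus_hom A B. \<exists>l2\<in>torus_hom A B. \<forall>b\<in>lattice B. \<exists>a1\<in>lattice A. \<exists>a2\<in>lattice A.
        of_int k *\<^sub>R b = l1 a1 + l2 a2"
proof -
  let ?V = "tspace A" and ?L = "lattice A" and ?J = "cstruct A"
  have ct: "complex_torus A" using A by (simp add: abelian_variety_def)
  have lat: "is_lattice ?L" by (rule complex_torus_lattice[OF ct])
  obtain \<phi> k where \<phi>: "linear \<phi>" "\<phi> ` ?L \<subseteq> lattice (dual_torus A)"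
    "\<And>v. v \<in> ?V \<Longrightarrow> \<phi> (?J v) = cstruct (dual_torus A) (\<phi> v)"
    and k: "(k::int) > 0" "\<And>w. w \<in> lattice (dual_torus A) \<Longrightarrow> of_int k *\<^sub>R w \<in> \<phi> ` ?L"
    using dual_isogeny[OF A] by blast
  let ?AA = "prod_torus A (dual_torus A)"
  note tAA = prod_dual_tspace[OF lat]
  have \<phi>V: "\<phi> v \<in> dual_space ?V" if "v \<in> ?V" for v
  proof -
    have "\<phi> v \<in> span (\<phi> ` ?L)" using that linear_span_image[OF \<phi>(1), of ?L] by (simp add: tspace_def)
    then have "\<phi> v \<in> tspace (dual_torus A)" using span_mono[OF \<phi>(2)] by (auto simp: tspace_def)
    then show ?thesis by (simp add: dual_lattice(2)[OF lat])
  qed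
  have J0: "?J 0 = 0" using cstruct_lin(2)[OF ct, of 0 0 0] by (simp add: subspace_0)
  have JV: "?J v \<in> ?V" if "v \<in> ?V" for v by (rule complex_torus_cstruct[OF ct that])
  have d0: "0 \<in> dual_space ?V" unfolding dual_space_def by (intro subspace_0 subspace_lin_hom subspace_UNIV)
  have J1: "cstruct ?AA (v, 0) = (?J v, 0)" for v
    by (auto simp: prod_torus_def dual_torus_def)
  have J2: "cstruct ?AA (0, \<phi> v) = (0, \<phi> (?J v))" if "v \<in> ?V" for v
    using \<phi>(3)[OF that] J0 by (simp add: prod_torus_def)
  have m1: "(v, 0) \<in> tspace ?AA" and m2: "(0, \<phi> v) \<in> tspace ?AA" if "v \<in> ?V" for v
    using that \<phi>V d0 unfolding tAA by (auto simp: subspace_0)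
  have AL: "add_subgroup ?L" "add_subgroup (lattice (dual_torus A))"
    using lat dual_lattice(1)[OF lat] by (auto intro: lattice_add_subgroup)
  show ?thesis
  proof (rule that[OF k(1)])
    fix B :: "'b torus"
    assume B: "complex_torus B" and iso: "torus_iso ?AA (prod_torus B (dual_torus B))"
    obtain f where f: "linear f" "bij_betw f (lattice ?AA) (lattice (prod_torus B (dual_torus B)))"
      "\<And>v. v \<in> tspace ?AA \<Longrightarrow> cstruct ?AA v \<in> tspace ?AA \<Longrightarrow>
        f (cstruct ?AA v) = cstruct (prod_torus B (dual_torus B)) (f v)"
      using torus_iso_extend[OF iso] by metis
    have fB: "fst (f z) \<in> lattice B" if "z \<in> lattice ?AA" for z
      using bij_betw_apply[OF f(2) that] by (auto simp: prod_torus_def)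
    have fJ: "fst (f (cstruct ?AA v)) = cstruct B (fst (f v))"
      if "v \<in> tspace ?AA" "cstruct ?AA v \<in> tspace ?AA" for v
      using f(3)[OF that] by (simp add: prod_torus_def)
    let ?f1 = "\<lambda>v. fst (f (v, 0))" and ?f2 = "\<lambda>v. fst (f (0, \<phi> v))"
    have f_add: "f (a + b, c + d) = f (a, c) + f (b, d)" for a b c d
      using linear_add[OF f(1), of "(a, c)" "(b, d)"] by simp
    have f_scale: "f (r *\<^sub>R a, r *\<^sub>R c) = r *\<^sub>R f (a, c)" for r a c
      using linear_scale[OF f(1), of r "(a, c)"] by simp
    have l1: "linear ?f1" using f_add[of _ _ 0 0] f_scale[of _ _ 0] by (intro linearI) simp_all
    have l2: "linear ?f2" using f_add[of 0 0] f_scale[of _ 0]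
      by (intro linearI) (simp_all add: linear_add[OF \<phi>(1)] linear_scale[OF \<phi>(1)])
    let ?l1 = "\<lambda>v. if v \<in> ?V then ?f1 v else 0" and ?l2 = "\<lambda>v. if v \<in> ?V then ?f2 v else 0"
    have h1: "?l1 \<in> torus_hom A B"
    proof (rule restrict_torus_hom[OF l1 _ JV])
      show "?f1 ` ?L \<subseteq> lattice B"
        using AL add_subgroup_zero by (auto intro!: fB simp: prod_torus_def)
      show "?f1 (?J v) = cstruct B (?f1 v)" if "v \<in> ?V" for v
        using fJ[OF m1[OF that]] m1[OF JV[OF that]] unfolding J1 by simp
    qed
    have h2: "?l2 \<in> torus_hom A B"
    proof (rule restrict_torus_hom[OF l2 _ JV])
      show "?f2 ` ?L \<subseteq> lattice B"
        using add_subgroup_zero[OF AL(1)] subsetD[OF \<phi>(2) imageI] by (auto intro!: fB simp: prod_torus_def)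
      show "?f2 (?J v) = cstruct B (?f2 v)" if "v \<in> ?V" for v
        using fJ[OF m2[OF that]] m2[OF JV[OF that]] unfolding J2[OF that] by simp
    qed
    have "\<exists>a1\<in>?L. \<exists>a2\<in>?L. of_int k *\<^sub>R b = ?l1 a1 + ?l2 a2" if b: "b \<in> lattice B" for b
    proof -
      have "0 \<in> lattice (dual_torus B)"
        using dual_lattice(1)[OF complex_torus_lattice[OF B]] by (auto intro: add_subgroup_zero lattice_add_subgroup)
      then have "(b, 0) \<in> lattice (prod_torus B (dual_torus B))" using b by (simp add: prod_torus_def)
      then have "(b, 0) \<in> f ` lattice ?AA" using f(2) by (simp add: bij_betw_def)
      then obtain a w where aw: "a \<in> ?L" "w \<in> lattice (dual_torus A)" "f (a, w) = (b, 0)"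
        by (auto simp: prod_torus_def)
      obtain a2 where a2: "a2 \<in> ?L" "of_int k *\<^sub>R w = \<phi> a2" using k(2)[OF aw(2)] by blast
      have a1: "of_int k *\<^sub>R a \<in> ?L" by (rule add_subgroup_scale[OF AL(1) aw(1)])
      have "of_int k *\<^sub>R (b, 0) = f (of_int k *\<^sub>R a, of_int k *\<^sub>R w)"
        by (simp only: f_scale aw(3))
      also have "\<dots> = f (of_int k *\<^sub>R a, 0) + f (0, \<phi> a2)"
        using f_add[of "of_int k *\<^sub>R a" 0 0 "\<phi> a2"] a2(2) by simp
      finally have "of_int k *\<^sub>R b = ?f1 (of_int k *\<^sub>R a) + ?f2 a2"
        by (metis fst_add fst_scaleR fst_conv)
      then have "of_int k *\<^sub>R b = ?l1 (of_int k *\<^sub>R a) + ?l2 a2"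
        using a1 a2(1) lattice_subset_tspace[of A] by (simp add: subset_iff)
      then show ?thesis using a1 a2(1) by blast
    qed
    then show "\<exists>l1\<in>torus_hom A B. \<exists>l2\<in>torus_hom A B. \<forall>b\<in>lattice B. \<exists>a1\<in>lattice A. \<exists>a2\<in>lattice A.
        of_int k *\<^sub>R b = l1 a1 + l2 a2"
      using h1 h2 by (intro bexI[of _ ?l1] bexI[of _ ?l2] ballI)
  qed
qed

text \<open>
  The finiteness theorem without reference to mirror symmetry: it concerns the tori that are covered,
  up to a fixed factor, by two copies of a fixed abelian variety. Two copies bound the rank by
  \<open>n = 2 \<cdot> rank A\<close>, and the simple summands of \<open>A\<close> furnish the family to which the successive minima apply.
\<close>

lemma finite_generated_tori:
  fixes A :: "'a::real_vector torus" and X :: "'b::real_vector torus set"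
  assumes A: "abelian_variety A" and k1: "(k1::int) > 0"
    and X: "\<And>B. B \<in> X \<Longrightarrow> abelian_variety B"
    and gen: "\<And>B. B \<in> X \<Longrightarrow> \<exists>l1\<in>torus_hom A B. \<exists>l2\<in>torus_hom A B. \<forall>b\<in>lattice B.
      \<exists>a1\<in>lattice A. \<exists>a2\<in>lattice A. of_int k1 *\<^sub>R b = l1 a1 + l2 a2"
  shows "finite (X // abelian_variety_iso)"
proof -
  have ctA: "complex_torus A" using A by (simp add: abelian_variety_def)
  obtain E where E: "finite E" "lattice A = zgen E"
    using lattice_basis[OF complex_torus_lattice[OF ctA]] by metis
  obtain \<S> where \<S>: "finite \<S>"
    "\<And>S. S \<in> \<S> \<Longrightarrow> simple_torus S \<and> lattice S \<subseteq> lattice A \<and> cstruct S = cstruct A"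
    "lattice A \<subseteq> span (\<Union>S\<in>\<S>. lattice S)"
    using simple_decomposition[OF A] by blast
  have simp: "simple_torus S" and ct: "complex_torus S" if "S \<in> \<S>" for S
    using \<S>(2)[OF that] by (auto simp: simple_torus_def)
  have "(\<Union>S\<in>\<S>. lattice S) \<subseteq> lattice A" using \<S>(2) by blast
  then obtain k2 where k2: "(k2::int) > 0"
    "\<And>a. a \<in> lattice A \<Longrightarrow> of_int k2 *\<^sub>R a \<in> zgen (\<Union>S\<in>\<S>. lattice S)"
    using clear_denominators[OF complex_torus_lattice[OF ctA] _ \<S>(3)] by blast
  have "\<exists>F. finite F \<and> independent F \<and> lattice S = zgen F" if "S \<in> \<S>" for S
    using complex_torus_lattice[OF ct[OF that]] by (simp add: is_lattice_iff)
  then obtain Bs where Bs: "\<And>S. S \<in> \<S> \<Longrightarrow> finite (Bs S) \<and> independent (Bs S) \<and> lattice S = zgen (Bs S)"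
    by metis
  define n where "n = card E + card E"
  obtain K :: int where K: "K > 0"
    "\<And>(B :: 'b torus) nm r S x T g. \<lbrakk>complex_torus B; integral_norm (lattice B) nm;
      minimal_system \<S> B (hom_size nm Bs) r S x; r \<le> n; joint_image S x r = tspace B;
      T \<in> \<S>; g \<in> torus_hom T B\<rbrakk> \<Longrightarrow>
      \<exists>w. (\<forall>i<r. w i \<in> torus_hom T (S i)) \<and>
        (\<forall>s\<in>tspace T. of_int K *\<^sub>R g s = (\<Sum>i<r. x i (w i s)))"
    using bounded_denominator[OF \<S>(1) simp Bs, where n = n] by blast
  define KK where "KK = K * (k2 * k1)"
  have "\<exists>r S x. r \<le> n \<and> (\<forall>i<r. S i \<in> \<S>) \<and> torus_model KK B r S x" if BX: "B \<in> X" for B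
  proof -
    have ctB: "complex_torus B" using X[OF BX] by (simp add: abelian_variety_def)
    have agB: "add_subgroup (lattice B)" by (rule lattice_add_subgroup[OF complex_torus_lattice[OF ctB]])
    obtain l1 l2 where l: "l1 \<in> torus_hom A B" "l2 \<in> torus_hom A B"
      "\<And>b. b \<in> lattice B \<Longrightarrow> \<exists>a1\<in>lattice A. \<exists>a2\<in>lattice A. of_int k1 *\<^sub>R b = l1 a1 + l2 a2"
      using gen[OF BX] by blast
    let ?G = "\<Union>S\<in>\<S>. \<Union>g\<in>torus_hom S B. g ` lattice S"
    have la: "of_int k2 *\<^sub>R l a \<in> zgen ?G" if l: "l \<in> torus_hom A B" and a: "a \<in> lattice A" for l a
    proof -
      obtain l' where l': "linear l'" "\<And>v. v \<in> tspace A \<Longrightarrow> l' v = l v"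
        using lin_hom_extend[OF subspace_tspace torus_hom_lin_hom[OF l]] by blast
      have "l' s \<in> ?G" if S: "S \<in> \<S>" and s: "s \<in> lattice S" for S s
      proof -
        have SA: "lattice S \<subseteq> lattice A" "cstruct S = cstruct A" using \<S>(2)[OF S] by auto
        then have VV: "tspace S \<subseteq> tspace A" unfolding tspace_def by (intro span_mono)
        have "(\<lambda>v. if v \<in> tspace S then l' v else 0) \<in> torus_hom S B"
        proof (rule restrict_torus_hom[OF l'(1)])
          show "l' ` lattice S \<subseteq> lattice B"
            using SA(1) l'(2) torus_hom_lattice[OF l] lattice_subset_tspace[of A] by (auto simp: subset_iff)
          show "cstruct S v \<in> tspace S" if "v \<in> tspace S" for v
            by (rule complex_torus_cstruct[OF ct[OF S] that])
          show "l' (cstruct S v) = cstruct B (l' v)" if "v \<in> tspace S" for v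
          proof -
            have "v \<in> tspace A" using VV that by blast
            then show ?thesis
              using torus_hom_cstruct[OF l] complex_torus_cstruct[OF ctA] by (simp add: SA(2) l'(2))
          qed
        qed
        moreover have "l' s = (\<lambda>v. if v \<in> tspace S then l' v else 0) s"
          using s lattice_subset_tspace[of S] by auto
        ultimately show ?thesis using S s by blast
      qed
      then have "(\<Union>S\<in>\<S>. lattice S) \<subseteq> {v. l' v \<in> zgen ?G}" by (auto intro!: zgen.base)
      moreover have "add_subgroup {v. l' v \<in> zgen ?G}"
        by (auto simp: add_subgroup_def linear_0[OF l'(1)] linear_diff[OF l'(1)] intro: zgen.zero zgen.diff)
      ultimately have "zgen (\<Union>S\<in>\<S>. lattice S) \<subseteq> {v. l' v \<in> zgen ?G}" by (rule zgen_minimal)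
      then have "l' (of_int k2 *\<^sub>R a) \<in> zgen ?G" using k2(2)[OF a] by blast
      then show ?thesis using a lattice_subset_tspace[of A] by (auto simp: linear_scale[OF l'(1)] l'(2))
    qed
    have bG: "of_int (k2 * k1) *\<^sub>R b \<in> zgen ?G" if b: "b \<in> lattice B" for b
    proof -
      obtain a1 a2 where a: "a1 \<in> lattice A" "a2 \<in> lattice A" "of_int k1 *\<^sub>R b = l1 a1 + l2 a2"
        using l(3)[OF b] by blast
      have "of_int (k2 * k1) *\<^sub>R b = of_int k2 *\<^sub>R (of_int k1 *\<^sub>R b)" by simp
      also have "\<dots> = of_int k2 *\<^sub>R l1 a1 + of_int k2 *\<^sub>R l2 a2" unfolding a(3) by (rule scaleR_right_distrib)
      also have "\<dots> \<in> zgen ?G"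
        by (rule add_subgroup_add[OF add_subgroup_zgen la[OF l(1) a(1)] la[OF l(2) a(2)]])
      finally show ?thesis .
    qed
    have genB: "lattice B \<subseteq> span ?G"
    proof
      fix b assume "b \<in> lattice B"
      then have "of_int (k2 * k1) *\<^sub>R b \<in> span ?G" using bG zgen_subset_span by blast
      from span_scale[OF this, of "1 / of_int (k2 * k1)"] show "b \<in> span ?G"
        using k1 k2(1) by simp
    qed
    have EV: "e \<in> tspace A" if "e \<in> E" for e using that by (simp add: tspace_def E(2) span_base)
    have spE: "l a \<in> span (l ` E)" if l: "l \<in> torus_hom A B" and a: "a \<in> lattice A" for l a
    proof -
      obtain u where u: "a = (\<Sum>e\<in>E. of_int (u e) *\<^sub>R e)" using a E zgen_finite[OF E(1)] by auto
      have "l a = (\<Sum>e\<in>E. of_int (u e) *\<^sub>R l e)"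
        unfolding u by (rule lin_hom_sum[OF subspace_tspace torus_hom_lin_hom[OF l] EV])
      also have "\<dots> \<in> span (l ` E)" by (intro span_sum span_scale span_base imageI)
      finally show ?thesis .
    qed
    let ?E = "l1 ` E \<union> l2 ` E"
    have "lattice B \<subseteq> span ?E"
    proof
      fix b assume "b \<in> lattice B"
      then obtain a1 a2 where a: "a1 \<in> lattice A" "a2 \<in> lattice A" "of_int k1 *\<^sub>R b = l1 a1 + l2 a2"
        using l(3) by blast
      have "l1 a1 \<in> span ?E" "l2 a2 \<in> span ?E"
        using spE[OF l(1) a(1)] spE[OF l(2) a(2)] span_mono[of "l1 ` E" ?E] span_mono[of "l2 ` E" ?E] by auto
      then have "of_int k1 *\<^sub>R b \<in> span ?E" unfolding a(3) by (rule span_add)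
      from span_scale[OF this, of "1 / of_int k1"] show "b \<in> span ?E" using k1 by simp
    qed
    then have tE: "tspace B \<subseteq> span ?E" unfolding tspace_def by (intro span_minimal) auto
    have fE: "finite ?E" using E(1) by simp
    have "card ?E \<le> card (l1 ` E) + card (l2 ` E)" by (rule card_Un_le)
    also have "\<dots> \<le> n" unfolding n_def using E(1) by (intro add_mono card_image_le)
    finally have cE: "card ?E \<le> n" .
    obtain nm where nm: "integral_norm (lattice B) nm"
      using lattice_integral_norm[OF complex_torus_lattice[OF ctB]] by blast
    have N: "hom_size nm Bs S y \<in> \<int> \<and> 0 \<le> hom_size nm Bs S y" if S: "S \<in> \<S>" and y: "y \<in> torus_hom S B" for S y
    proof -
      have yB: "y s \<in> lattice B" if "s \<in> Bs S" for s
        using torus_hom_lattice[OF y] Bs[OF S] that by (simp add: zgen.base)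
      have "hom_size nm Bs S y \<in> \<int>"
        unfolding hom_size_def by (intro Ints_sum integral_normD(4)[OF nm] yB)
      moreover have "0 \<le> hom_size nm Bs S y"
        using yB lattice_subset_tspace[of B] by (intro hom_size_nonneg[OF nm]) blast
      ultimately show ?thesis by blast
    qed
    obtain r S x where ms: "r \<le> n" "minimal_system \<S> B (hom_size nm Bs) r S x" "joint_image S x r = tspace B"
      using minimal_system_exists[where N = "hom_size nm Bs", OF simp ctB tE fE cE genB N] by blast
    have hS: "S i \<in> \<S>" and hx: "x i \<in> torus_hom (S i) B" if "i < r" for i
      using minimal_systemD(1,2)[OF ms(2) that] by auto
    let ?P = "{v. \<exists>p\<in>lattice_tuples r S. of_int K *\<^sub>R v = (\<Sum>i<r. x i (p i))}"
    have LVS: "q \<in> tspace (S i)" if "q \<in> lattice (S i)" for q i using that lattice_subset_tspace by blast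
    have agS: "add_subgroup (lattice (S i))" if "i < r" for i
      by (rule lattice_add_subgroup[OF complex_torus_lattice[OF ct[OF hS[OF that]]]])
    have "add_subgroup ?P"
      unfolding add_subgroup_def
    proof (intro conjI ballI)
      have "(\<lambda>i. 0) \<in> lattice_tuples r S" using agS by (simp add: lattice_tuples_def add_subgroup_zero)
      moreover have "(\<Sum>i<r. x i 0) = 0"
        using lin_hom_zero[OF torus_hom_lin_hom[OF hx] subspace_tspace] by (intro sum.neutral) auto
      ultimately show "0 \<in> ?P" by (auto intro!: bexI[of _ "\<lambda>i. 0"])
      fix a b assume "a \<in> ?P" "b \<in> ?P"
      then obtain p q where pq: "p \<in> lattice_tuples r S" "q \<in> lattice_tuples r S"
        "of_int K *\<^sub>R a = (\<Sum>i<r. x i (p i))" "of_int K *\<^sub>R b = (\<Sum>i<r. x i (q i))" by blast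
      have "x i (p i - q i) = x i (p i) - x i (q i)" if "i < r" for i
        using pq(1,2) that
        by (intro lin_hom_diff[OF torus_hom_lin_hom[OF hx[OF that]] subspace_tspace] LVS)
           (simp_all add: lattice_tuples_def)
      then have "of_int K *\<^sub>R (a - b) = (\<Sum>i<r. x i (p i - q i))"
        by (simp add: scaleR_diff_right pq(3,4) sum_subtractf)
      moreover have "(\<lambda>i. p i - q i) \<in> lattice_tuples r S"
        using pq(1,2) agS by (simp add: lattice_tuples_def add_subgroup_diff)
      ultimately show "a - b \<in> ?P" by (intro CollectI bexI[of _ "\<lambda>i. p i - q i"])
    qed
    moreover have "?G \<subseteq> ?P"
    proof clarify
      fix T g s assume T: "T \<in> \<S>" and g: "g \<in> torus_hom T B" and s: "s \<in> lattice T"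
      obtain w where w: "\<forall>i<r. w i \<in> torus_hom T (S i)"
        "\<forall>s\<in>tspace T. of_int K *\<^sub>R g s = (\<Sum>i<r. x i (w i s))"
        using K(2)[OF ctB nm ms(2,1,3) T g] by blast
      let ?p = "\<lambda>i. if i < r then w i s else 0"
      have "?p \<in> lattice_tuples r S"
        using torus_hom_lattice[OF w(1)[rule_format] s] by (simp add: lattice_tuples_def)
      moreover have "of_int K *\<^sub>R g s = (\<Sum>i<r. x i (?p i))"
        using w(2) s lattice_subset_tspace[of T] by (auto simp: subset_iff)
      ultimately show "\<exists>p\<in>lattice_tuples r S. of_int K *\<^sub>R g s = (\<Sum>i<r. x i (p i))"
        by (intro bexI[of _ ?p])
    qed
    ultimately have GP: "zgen ?G \<subseteq> ?P" by (rule zgen_minimal[rotated])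
    have "\<exists>p\<in>lattice_tuples r S. of_int KK *\<^sub>R b = (\<Sum>i<r. x i (p i))" if "b \<in> lattice B" for b
    proof -
      have "of_int (k2 * k1) *\<^sub>R b \<in> ?P" using bG[OF that] GP by blast
      then show ?thesis by (simp add: KK_def)
    qed
    then have "torus_model KK B r S x"
      unfolding torus_model_def using ct hS hx minimal_system_independent[OF ms(2)] ms(3) by blast
    then show ?thesis using ms(1) hS by blast
  qed
  moreover have "KK > 0" using K(1) k1 k2(1) by (simp add: KK_def)
  ultimately show ?thesis using finite_iso_classes[OF \<S>(1) ct _ X, where n = n] by blast
qed

theorem mainTheorem6:
  fixes A :: "'a::real_vector torus"
    and \<omega>A :: "('a \<Rightarrow> 'a \<Rightarrow> real) \<times> ('a \<Rightarrow> 'a \<Rightarrow> real)"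
  assumes "weak_pair A \<omega>A"
  shows "finite ({B :: 'b::real_vector torus. abelian_variety B \<and>
           (\<exists>\<omega>B. weak_pair B \<omega>B \<and> mirror_symmetric A \<omega>A B \<omega>B)} // abelian_variety_iso)"
proof -
  let ?X = "{B :: 'b torus. abelian_variety B \<and>
           (\<exists>\<omega>B. weak_pair B \<omega>B \<and> mirror_symmetric A \<omega>A B \<omega>B)}"
  show ?thesis
  proof (cases "?X = {}")
    case True
    then show ?thesis by (simp only: quotient_empty finite.emptyI)
  next
    case False
    then obtain B0 \<omega>0 where B0: "abelian_variety (B0 :: 'b torus)" "mirror_symmetric A \<omega>A B0 \<omega>0" by blast
    obtain k where k: "(k::int) > 0"
      "\<And>B :: 'b torus. complex_torus B \<Longrightarrow>
        torus_iso (prod_torus B0 (dual_torus B0)) (prod_torus B (dual_torus B)) \<Longrightarrow>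
        \<exists>l1\<in>torus_hom B0 B. \<exists>l2\<in>torus_hom B0 B. \<forall>b\<in>lattice B. \<exists>a1\<in>lattice B0. \<exists>a2\<in>lattice B0.
          of_int k *\<^sub>R b = l1 a1 + l2 a2"
      using partner_generated[OF B0(1)] by blast
    have ct: "complex_torus B" if "abelian_variety B" for B :: "'b torus"
      using that by (simp add: abelian_variety_def)
    show ?thesis
    proof (rule finite_generated_tori[OF B0(1) k(1)])
      fix B assume "B \<in> ?X"
      then obtain \<omega>B where B: "abelian_variety B" "mirror_symmetric A \<omega>A B \<omega>B" by blast
      show "abelian_variety B" by (rule B(1))
      show "\<exists>l1\<in>torus_hom B0 B. \<exists>l2\<in>torus_hom B0 B. \<forall>b\<in>lattice B. \<exists>a1\<in>lattice B0. \<exists>a2\<in>lattice B0.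
          of_int k *\<^sub>R b = l1 a1 + l2 a2"
        by (rule k(2)[OF ct[OF B(1)] mirror_partners_iso[OF assms B0(2) ct[OF B0(1)] B(2)]])
    qed
  qed
qed

end
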